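(* Let $d\in\mathbb{N}^+$ and let $\rho_d$ be the direct sum of $d$ copies of the standard $2$-dimensional representation of $G=SL(2,\mathbb{R})$ on $\mathbb{R}^{2d}$. For each $1\le i\le 2d$ fix a $(\wedge^i\rho_d)(K)$-invariant quasinorm $|\cdot|_i$ on $\wedge^i\mathbb{R}^{2d}$. Let $\beta>0$ with $\beta d>2$. Then there is a constant $R$, depending only on $\beta$ and the choice of the quasinorms $|\cdot|_i$, such that for every $h\in G$ and every lattice $\Delta$ in $\mathbb{R}^{2d}$, $$\int_K\alpha(hk\Delta)^\beta\,d\sigma(k)\le R\,\alpha(\Delta)^\beta\,\|h\|^{\beta d-2}.$$
   Context: $K=SO(2)\subset G$, $\sigma$ the normalized Haar measure on $K$, and $\|h\|$ the operator norm of $h$ with respect to the Euclidean norm on $\mathbb{R}^2$. $G$ acts on $\mathbb{R}^{2d}$ via $\rho_d$ and hence on lattices. A quasinorm on a real vector space $V$ is a continuous function $|\cdot|:V\to[0,\infty)$ with $|v|=0$ iff $v=0$ and $|\lambda v|=|\lambda||v|$. For a lattice $\Delta\subset\mathbb{R}^{2d}$, a subspace $L$ is $\Delta$-rational if $L\cap\Delta$ is a lattice in $L$; then $d_\Delta(L)=|u_1\wedge\dots\wedge u_l|_l$ for a $\mathbb{Z}$-basis $u_1,\dots,u_l$ of $L\cap\Delta$ ($l=\dim L$), and $d_\Delta(\{0\})=1$. $\alpha_l(\Delta)=\sup\{1/d_\Delta(L): L$ $\Delta$-rational of dimension $l\}$ for $0\le l\le 2d$, and $\alpha(\Delta)=\max_{0\le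 l\le 2d}\alpha_l(\Delta)$. *)

theory Defs
  imports "HOL-Analysis.Analysis"
begin

section \<open>The groups and the representation\<close>

definition SL2 :: "(real^2^2) set" where
  "SL2 = {h. det h = 1}"

definition SO2 :: "(real^2^2) set" where
  "SO2 = {k. rotation_matrix k}"

text \<open>The space \<open>\<real>\<^sup>2\<^sup>d\<close> is \<open>real^('d \<times> 2)\<close> with \<open>d = CARD('d)\<close>: the coordinates \<open>(i, 1)\<close> and
  \<open>(i, 2)\<close> are those of the \<open>i\<close>-th copy of the plane. Hence \<open>rho h\<close> is block diagonal, all blocks
  being \<open>h\<close>.\<close>

definition rho :: "real^2^2 \<Rightarrow> real^('d::finite \<times> 2)^('d \<times> 2)" where
  "rho h = (\<chi> p q. if fst p = fst q then h $ snd p $ snd q else 0)"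

definition normalized_haar :: "(real^2^2) set \<Rightarrow> (real^2^2) measure \<Rightarrow> bool" where
  "normalized_haar K \<sigma> \<longleftrightarrow>
     sets \<sigma> = sets (restrict_space borel K) \<and>
     emeasure \<sigma> K = 1 \<and>
     (\<forall>k\<in>K. distr \<sigma> \<sigma> (\<lambda>x. k ** x) = \<sigma>)"


section \<open>Exterior powers\<close>

text \<open>The exterior algebra of \<open>real^'n\<close> is realised as \<open>real^('n set)\<close>. Every \<open>S\<close> with
  \<open>card S = l\<close> is enumerated by \<open>from_nat_into S\<close> on \<open>{..<l}\<close>, and the wedge product of the
  standard basis vectors with these indices, in this order, is the unit vector \<open>axis S 1\<close>
  (lemma \<open>wedge_axis\<close>). The \<open>S\<close>-coordinate of the wedge product of \<open>u 0, \<dots>, u (l - 1)\<close> is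
  thus the corresponding \<open>l \<times> l\<close> minor, here given by the Leibniz formula. No order on \<open>'n\<close> is
  needed: the choice of enumerations affects only the signs of the basis vectors.\<close>

definition wedge :: "nat \<Rightarrow> (nat \<Rightarrow> real^'n::finite) \<Rightarrow> real^('n set)" where
  "wedge l u = (\<chi> S. if card S = l
     then \<Sum>p | p permutes {..<l}. of_int (sign p) * (\<Prod>a<l. u a $ from_nat_into S (p a))
     else 0)"

definition ext_pow :: "nat \<Rightarrow> (real^('n::finite set)) set" where
  "ext_pow l = span (range (wedge l))"

text \<open>The \<open>l\<close>-th exterior power of a linear map, given by its values on the basis
  \<open>axis S 1\<close>, \<open>card S = l\<close>.\<close>

definition ext_map :: "nat \<Rightarrow> real^'n::finite^'n \<Rightarrow> real^('n set) \<Rightarrow> real^('n set)" where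
  "ext_map l A x =
     (\<Sum>S | card S = l. x $ S *\<^sub>R wedge l (\<lambda>a. A *v axis (from_nat_into S a) 1))"

lemma wedge_axis:
  fixes S :: "'n::finite set"
  shows "wedge (card S) (\<lambda>a. axis (from_nat_into S a) 1) = axis S 1"
proof -
  define l where "l = card S"
  define e where "e = from_nat_into S"
  have bij: "bij_betw e {..<l} S"
    unfolding e_def l_def by (rule bij_betw_from_nat_into_finite) simp
  have "(\<Sum>p | p permutes {..<l}. of_int (sign p) *
          (\<Prod>a<l. axis (e a) (1::real) $ from_nat_into T (p a))) = (if T = S then 1 else 0)"
    if T: "card T = l" for T :: "'n set"
  proof -
    define f where "f = from_nat_into T"
    have bijT: "bij_betw f {..<l} T"
      unfolding f_def T[symmetric] by (rule bij_betw_from_nat_into_finite) simp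
    have prod: "(\<Prod>a<l. axis (e a) (1::real) $ f (p a)) = (if T = S \<and> p = id then 1 else 0)"
      if p: "p permutes {..<l}" for p
    proof (cases "\<forall>a<l. e a = f (p a)")
      case True
      have "S = e ` {..<l}" using bij by (simp add: bij_betw_def)
      also have "\<dots> = f ` p ` {..<l}" using True by (auto simp: image_image)
      also have "\<dots> = T" using bijT permutes_image[OF p] by (simp add: bij_betw_def)
      finally have ST: "S = T" .
      have "p a = a" for a
      proof (cases "a < l")
        case a: True
        have "f a = f (p a)" using True a ST by (simp add: e_def f_def)
        moreover have "p a < l" using permutes_in_image[OF p, of a] a by simp
        ultimately show ?thesis using bijT a by (auto simp: bij_betw_def inj_on_def)
      next
        case False
        then show ?thesis using p by (simp add: permutes_def)
      qed
      then have "p = id" by auto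
      with True ST show ?thesis by (simp add: axis_def)
    next
      case False
      then obtain a where a: "a < l" "e a \<noteq> f (p a)" by auto
      then have "(\<Prod>a<l. axis (e a) (1::real) $ f (p a)) = 0"
        by (intro prod_zero bexI[of _ a]) (auto simp: axis_def)
      moreover have "\<not> (T = S \<and> p = id)" using a by (auto simp: e_def f_def)
      ultimately show ?thesis by (simp only: if_False)
    qed
    have "(\<Sum>p | p permutes {..<l}. of_int (sign p) * (\<Prod>a<l. axis (e a) (1::real) $ f (p a)))
        = (\<Sum>p | p permutes {..<l}. if p = id then (if T = S then 1 else 0) else 0)"
      by (rule sum.cong) (auto simp: prod sign_id)
    also have "\<dots> = (if T = S then 1 else 0)"
      by (subst sum.delta) (auto simp: finite_permutations permutes_id)
    finally show ?thesis by (simp add: f_def)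
  qed
  then show ?thesis
    by (auto simp: wedge_def vec_eq_iff axis_def e_def l_def)
qed

definition quasinorm_on :: "'a::real_normed_vector set \<Rightarrow> ('a \<Rightarrow> real) \<Rightarrow> bool" where
  "quasinorm_on V q \<longleftrightarrow>
     continuous_on V q \<and>
     (\<forall>v\<in>V. 0 \<le> q v) \<and>
     (\<forall>v\<in>V. q v = 0 \<longleftrightarrow> v = 0) \<and>
     (\<forall>v\<in>V. \<forall>c. q (c *\<^sub>R v) = \<bar>c\<bar> * q v)"


section \<open>Lattices and the function \<open>\<alpha>\<close>\<close>

definition zbasis :: "nat \<Rightarrow> (nat \<Rightarrow> 'a::real_vector) \<Rightarrow> 'a set \<Rightarrow> bool" where
  "zbasis l u \<Gamma> \<longleftrightarrow>
     inj_on u {..<l} \<and> independent (u ` {..<l}) \<and>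
     \<Gamma> = {\<Sum>a<l. real_of_int (c a) *\<^sub>R u a | c. True}"

definition lattice_in :: "'a::euclidean_space set \<Rightarrow> 'a set \<Rightarrow> bool" where
  "lattice_in L \<Gamma> \<longleftrightarrow> (\<exists>u. zbasis (dim L) u \<Gamma> \<and> span (u ` {..<dim L}) = L)"

definition rational :: "'a::euclidean_space set \<Rightarrow> 'a set \<Rightarrow> bool" where
  "rational \<Delta> L \<longleftrightarrow> subspace L \<and> lattice_in L (L \<inter> \<Delta>)"

text \<open>\<open>q l\<close> is the quasinorm on the \<open>l\<close>-th exterior power. The value \<open>covol q \<Delta> L\<close> is
  independent of the chosen basis, since two bases give the same wedge product up to sign.\<close>

definition covol :: "(nat \<Rightarrow> real^('n::finite set) \<Rightarrow> real) \<Rightarrow> (real^'n) set \<Rightarrow> (real^'n) set \<Rightarrow> real" where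
  "covol q \<Delta> L =
     (if L = {0} then 1 else q (dim L) (wedge (dim L) (SOME u. zbasis (dim L) u (L \<inter> \<Delta>))))"

text \<open>For a lattice \<open>\<Delta>\<close> and quasinorms \<open>q\<close> the supremum is over a nonempty set that is bounded
  above, the wedge products of lattice vectors being discrete.\<close>

definition alpha_l ::
    "(nat \<Rightarrow> real^('n::finite set) \<Rightarrow> real) \<Rightarrow> nat \<Rightarrow> (real^'n) set \<Rightarrow> real" where
  "alpha_l q l \<Delta> = Sup {1 / covol q \<Delta> L | L. rational \<Delta> L \<and> dim L = l}"

definition alpha :: "(nat \<Rightarrow> real^('n::finite set) \<Rightarrow> real) \<Rightarrow> (real^'n) set \<Rightarrow> real" where
  "alpha q \<Delta> = Max ((\<lambda>l. alpha_l q l \<Delta>) ` {0..CARD('n)})"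

end

theory Submission
  imports Defs
begin

text \<open>
  A lattice \<open>\<Delta> = B \<int>\<^sup>2\<^sup>d\<close> and the group element \<open>h = k\<^sub>1 diag(s, 1/s) k\<^sub>2\<close> are studied along the
  curves \<open>a\<^sub>n u\<^sub>x B\<close> with \<open>a\<^sub>n = diag(2^n, 2^-n)\<close>, \<open>2^n \<le> s < 2^(n+1)\<close> and \<open>u\<^sub>x\<close> unipotent. Two facts
  drive the estimate, both for the Euclidean norms, to which the quasinorms are comparable.

  For a fixed rational subspace \<open>L\<close> of dimension \<open>l\<close>, the inverse covolume \<open>f\<^sub>L\<close> satisfies, with
  \<open>m = min l (2d - l)\<close> and \<open>\<theta> = \<beta> - 2/d\<close>, the bound
  \<open>\<integral> f\<^sub>L(a\<^sub>n u\<^sub>x)^\<beta> dx \<le> C 2^(\<theta> m n) f\<^sub>L(1)^\<beta>\<close>, because the components of nonnegative weight of a vector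
  along \<open>u\<^sub>x\<close> are polynomials in \<open>x\<close> of controlled degree that do not all vanish.

  For \<open>L \<noteq> M\<close> of the same dimension \<open>l\<close>, \<open>f\<^sub>L f\<^sub>M \<le> f\<^sub>I f\<^sub>U\<close> with \<open>dim I = l - j\<close>, \<open>dim U = l + j\<close>, \<open>j > 0\<close>.
  Hence at each scale either one subspace clearly dominates all others of its dimension, or the
  supremum \<open>\<alpha>\<^sub>l\<close> is controlled by \<open>sqrt(\<alpha>\<^sub>l\<^sub>-\<^sub>j \<alpha>\<^sub>l\<^sub>+\<^sub>j)\<close>. Splitting the path at the last scale of
  the second kind and using the first fact afterwards gives, by induction on \<open>n\<close>,
  \<open>\<integral> \<alpha>\<^sub>l(a\<^sub>n u\<^sub>x B)^\<beta> dx \<le> C 2^(\<theta> w(l) n) \<alpha>(B)^\<beta>\<close> with the strictly concave weight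
  \<open>w(l) = l (2d - l) / d\<close>: strict concavity makes the sum over the scales geometric, and
  \<open>\<theta> w(d) = \<beta> d - 2\<close> is the exponent of the theorem.
\<close>

section \<open>Exterior algebra\<close>

text \<open>The supremum runs over infinitely many subspaces, so the bounds for single ones cannot
  be added up; isolation is what leaves one subspace per cell and scale. The exponents come from
  sublevel sets. A coordinate of weight W of a vector moved by \<open>unip y\<close> has degree at
  most (W + m)/2 in y and is then stretched by 2^(Wn), while no vector shrinks by more than about
  2^(mn). In the Remez estimate these balance so that W cancels: the set where the norm drops by a
  factor \<open>lam\<close> has measure at most a constant times \<open>lam powr (-2/m)\<close>, and
  m is at most d. This tail is the source of the loss 2/d in \<theta>. As a function of l, m is
  concave but linear on either side of d, so geometric means of its neighbours yield no gain there;
  the quadratic \<open>w\<close> majorises it, agrees with it at d, and has midpoint defect at least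
  1/d. The same defect closes the induction: the constant is \<open>B powr (1 + w l)\<close>, so
  each passage to neighbouring dimensions saves \<open>B powr (1/d)\<close>, which pays for the
  other constants.\<close>

lemma wedge_cong:
  assumes "\<And>a. a < l \<Longrightarrow> u a = v a"
  shows "wedge l u = wedge l v"
  unfolding wedge_def by (intro arg_cong[of _ _ vec_lambda] ext if_cong refl sum.cong arg_cong2[of _ _ _ _ "(*)"] prod.cong) (simp add: assms)

lemma wedge_nth_card_ne: "card S \<noteq> l \<Longrightarrow> wedge l u $ S = 0"
  by (simp add: wedge_def)

lemma wedge_nth:
  "card S = l \<Longrightarrow> wedge l u $ S =
     (\<Sum>p | p permutes {..<l}. of_int (sign p) * (\<Prod>a<l. u a $ from_nat_into S (p a)))"
  by (simp add: wedge_def)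

lemma wedge_permute:
  fixes u :: "nat \<Rightarrow> real^'n::finite"
  assumes \<pi>: "\<pi> permutes {..<l}"
  shows "wedge l (u \<circ> \<pi>) = of_int (sign \<pi>) *\<^sub>R wedge l u"
proof (subst vec_eq_iff, rule allI)
  fix S :: "'n set"
  show "wedge l (u \<circ> \<pi>) $ S = (of_int (sign \<pi>) *\<^sub>R wedge l u) $ S"
  proof (cases "card S = l")
    case False
    then show ?thesis by (simp add: wedge_nth_card_ne)
  next
    case True
    let ?e = "from_nat_into S"
    have "wedge l (u \<circ> \<pi>) $ S
        = (\<Sum>p | p permutes {..<l}. of_int (sign (p \<circ> \<pi>)) * (\<Prod>a<l. u (\<pi> a) $ ?e ((p \<circ> \<pi>) a)))"
      unfolding wedge_nth[OF True] comp_def[of u]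
      by (rule sum_permutations_compose_right[OF \<pi>])
    also have "\<dots> = (\<Sum>p | p permutes {..<l}. of_int (sign \<pi>) * (of_int (sign p) * (\<Prod>a<l. u a $ ?e (p a))))"
    proof (rule sum.cong[OF refl])
      fix p assume p: "p \<in> {p. p permutes {..<l}}"
      have "(\<Prod>a<l. u (\<pi> a) $ ?e ((p \<circ> \<pi>) a)) = (\<Prod>a<l. u a $ ?e (p a))"
        using prod.permute[OF \<pi>, of "\<lambda>a. u a $ ?e (p a)"] by (simp add: comp_def)
      moreover have "sign (p \<circ> \<pi>) = sign p * sign \<pi>"
        by (rule sign_compose) (use p \<pi> in \<open>auto intro: permutation_permutes[THEN iffD2]\<close>)
      ultimately show "of_int (sign (p \<circ> \<pi>)) * (\<Prod>a<l. u (\<pi> a) $ ?e ((p \<circ> \<pi>) a))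
          = of_int (sign \<pi>) * (of_int (sign p) * (\<Prod>a<l. u a $ ?e (p a)))" by simp
    qed
    also have "\<dots> = (of_int (sign \<pi>) *\<^sub>R wedge l u) $ S"
      by (simp add: wedge_nth[OF True] sum_distrib_left)
    finally show ?thesis .
  qed
qed

lemma wedge_repeat:
  assumes "a < l" "b < l" "a \<noteq> b" "u a = u b"
  shows "wedge l u = 0"
proof -
  have \<pi>: "Transposition.transpose a b permutes {..<l}" using assms by (intro permutes_swap_id) auto
  have "u \<circ> Transposition.transpose a b = u" using assms by (auto simp: Transposition.transpose_def fun_eq_iff)
  with wedge_permute[OF \<pi>, of u] assms have "wedge l u = - wedge l u"
    by (simp add: sign_swap_id)
  then have "2 *\<^sub>R wedge l u = 0" by (metis add.right_inverse scaleR_2)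
  then show ?thesis by simp
qed

lemma wedge_not_inj:
  assumes "\<not> inj_on \<phi> {..<l}"
  shows "wedge l (\<lambda>a. v (\<phi> a)) = 0"
  using assms wedge_repeat[of _ l _ "\<lambda>a. v (\<phi> a)"] unfolding inj_on_def by (metis lessThan_iff)

text \<open>Multilinearity in all slots at once. The index set is any finite set, so the same
  expansion serves for integer coefficient matrices and for the standard basis.\<close>

lemma wedge_sum_expand:
  fixes v :: "'b \<Rightarrow> real^'n::finite"
  assumes "finite I"
  shows "wedge l (\<lambda>a. \<Sum>b\<in>I. C a b *\<^sub>R v b)
       = (\<Sum>\<phi>\<in>PiE {..<l} (\<lambda>_. I). (\<Prod>a<l. C a (\<phi> a)) *\<^sub>R wedge l (\<lambda>a. v (\<phi> a)))"
proof (subst vec_eq_iff, rule allI)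
  fix S :: "'n set"
  let ?P = "{p. p permutes {..<l}}" and ?F = "PiE {..<l} (\<lambda>_. I)"
  show "wedge l (\<lambda>a. \<Sum>b\<in>I. C a b *\<^sub>R v b) $ S
    = (\<Sum>\<phi>\<in>?F. (\<Prod>a<l. C a (\<phi> a)) *\<^sub>R wedge l (\<lambda>a. v (\<phi> a))) $ S"
  proof (cases "card S = l")
    case False
    then show ?thesis by (simp add: wedge_nth_card_ne)
  next
    case True
    let ?e = "from_nat_into S"
    have "wedge l (\<lambda>a. \<Sum>b\<in>I. C a b *\<^sub>R v b) $ S
      = (\<Sum>p\<in>?P. of_int (sign p) * (\<Prod>a<l. \<Sum>b\<in>I. C a b * v b $ ?e (p a)))"
      by (simp add: wedge_nth[OF True])
    also have "\<dots> = (\<Sum>p\<in>?P. \<Sum>\<phi>\<in>?F. of_int (sign p) * (\<Prod>a<l. C a (\<phi> a) * v (\<phi> a) $ ?e (p a)))"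
      by (subst prod_sum_PiE) (auto simp: assms sum_distrib_left)
    also have "\<dots> = (\<Sum>\<phi>\<in>?F. \<Sum>p\<in>?P. (\<Prod>a<l. C a (\<phi> a)) * (of_int (sign p) * (\<Prod>a<l. v (\<phi> a) $ ?e (p a))))"
      by (subst sum.swap) (simp add: prod.distrib mult_ac)
    also have "\<dots> = (\<Sum>\<phi>\<in>?F. (\<Prod>a<l. C a (\<phi> a)) *\<^sub>R wedge l (\<lambda>a. v (\<phi> a))) $ S"
      by (simp add: wedge_nth[OF True] sum_distrib_left)
    finally show ?thesis .
  qed
qed

text \<open>Cramer's rule: after expanding slot \<open>i\<close>, every term with \<open>b\<close>
  different from \<open>i\<close> repeats a vector of another slot. It later yields uniqueness of
  coefficients and the descent that produces primitive bases.\<close>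

lemma wedge_replace:
  assumes "i < l" and u: "\<And>a. a < l \<Longrightarrow> a \<noteq> i \<Longrightarrow> u a = v a"
    and ui: "u i = (\<Sum>b<l. c b *\<^sub>R v b)"
  shows "wedge l u = c i *\<^sub>R wedge l v"
proof -
  define C where "C a b = (if a = i then c b else if a = b then 1 else (0::real))" for a b
  have "wedge l u = wedge l (\<lambda>a. \<Sum>b<l. C a b *\<^sub>R v b)"
  proof (rule wedge_cong)
    fix a assume a: "a < l"
    show "u a = (\<Sum>b<l. C a b *\<^sub>R v b)"
    proof (cases "a = i")
      case True
      then show ?thesis by (simp add: ui C_def)
    next
      case False
      then have "C a b *\<^sub>R v b = (if a = b then v b else 0)" for b by (simp add: C_def)
      then show ?thesis using a False by (simp add: u)
    qed
  qed
  also have "\<dots> = (\<Sum>\<phi>\<in>PiE {..<l} (\<lambda>_. {..<l}). (\<Prod>a<l. C a (\<phi> a)) *\<^sub>R wedge l (\<lambda>a. v (\<phi> a)))"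
    by (rule wedge_sum_expand) simp
  also have "\<dots> = (\<Sum>\<phi>\<in>PiE {..<l} (\<lambda>_. {..<l}). if \<phi> = restrict id {..<l} then c i *\<^sub>R wedge l v else 0)"
  proof (rule sum.cong[OF refl])
    fix \<phi> assume \<phi>: "\<phi> \<in> PiE {..<l} (\<lambda>_. {..<l})"
    show "(\<Prod>a<l. C a (\<phi> a)) *\<^sub>R wedge l (\<lambda>a. v (\<phi> a))
        = (if \<phi> = restrict id {..<l} then c i *\<^sub>R wedge l v else 0)"
    proof (cases "\<forall>a<l. a \<noteq> i \<longrightarrow> \<phi> a = a")
      case False
      then obtain a where "a < l" "a \<noteq> i" "\<phi> a \<noteq> a" by auto
      then have "(\<Prod>a<l. C a (\<phi> a)) = 0"
        by (intro prod_zero bexI[of _ a]) (auto simp: C_def)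
      then show ?thesis using \<open>a < l\<close> \<open>\<phi> a \<noteq> a\<close> by auto
    next
      case True
      show ?thesis
      proof (cases "\<phi> i = i")
        case False
        \<comment> \<open>The index \<open>\<phi> i\<close> is another slot, and there
          \<open>\<phi>\<close> is the identity, so the value \<open>\<phi> i\<close> is taken
          twice.\<close>
        have "\<not> inj_on \<phi> {..<l}"
        proof
          assume inj: "inj_on \<phi> {..<l}"
          have "\<phi> i < l" using \<phi> \<open>i < l\<close> by auto
          with True False have "\<phi> (\<phi> i) = \<phi> i" by auto
          with inj \<open>\<phi> i < l\<close> \<open>i < l\<close> False show False by (auto simp: inj_on_def)
        qed
        then have "wedge l (\<lambda>a. v (\<phi> a)) = 0" by (rule wedge_not_inj)
        then show ?thesis using False \<open>i < l\<close> by auto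
      next
        case ii: True
        have all: "\<phi> a = a" if "a < l" for a using True ii that by (cases "a = i") auto
        have "\<phi> = restrict id {..<l}"
          using \<phi> all by (auto simp: fun_eq_iff PiE_def extensional_def)
        moreover have "(\<Prod>a<l. C a (\<phi> a)) = (\<Prod>a<l. if a = i then c i else 1)"
          by (rule prod.cong) (auto simp: all C_def)
        moreover have "\<dots> = c i" using \<open>i < l\<close> by (simp add: prod.delta)
        moreover have "wedge l (\<lambda>a. v (\<phi> a)) = wedge l v" by (rule wedge_cong) (simp add: all)
        ultimately show ?thesis by simp
      qed
    qed
  qed
  also have "\<dots> = c i *\<^sub>R wedge l v"
    by (subst sum.delta) (auto intro!: finite_PiE)
  finally show ?thesis .
qed

text \<open>The integer is the determinant of \<open>C\<close>. Only integrality matters, so the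
  expansion over maps is summed without forming it: injective self-maps of the slots contribute a
  sign, the others nothing.\<close>

lemma wedge_int_comb:
  assumes "\<And>a. a < l \<Longrightarrow> u a = (\<Sum>b<l. real_of_int (C a b) *\<^sub>R v b)"
  shows "\<exists>c::int. wedge l u = real_of_int c *\<^sub>R wedge l v"
proof -
  let ?F = "PiE {..<l} (\<lambda>_. {..<l})"
  have 1: "wedge l u = wedge l (\<lambda>a. \<Sum>b<l. real_of_int (C a b) *\<^sub>R v b)"
    using assms by (rule wedge_cong)
  have ex: "\<exists>c::int. wedge l (\<lambda>a. v (\<phi> a)) = real_of_int c *\<^sub>R wedge l v" if "\<phi> \<in> ?F" for \<phi>
  proof (cases "inj_on \<phi> {..<l}")
    case False
    then show ?thesis using wedge_not_inj[OF False, of v] by (intro exI[of _ 0]) simp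
  next
    case True
    define \<pi> where "\<pi> a = (if a < l then \<phi> a else a)" for a
    have "bij_betw \<phi> {..<l} {..<l}"
      using True that endo_inj_surj[of "{..<l}" \<phi>] by (auto simp: bij_betw_def)
    then have "bij_betw \<pi> {..<l} {..<l}" by (rule bij_betw_cong[THEN iffD1, rotated]) (simp add: \<pi>_def)
    then have "\<pi> permutes {..<l}" by (rule bij_imp_permutes) (simp add: \<pi>_def)
    moreover have "wedge l (\<lambda>a. v (\<phi> a)) = wedge l (v \<circ> \<pi>)"
      by (rule wedge_cong) (simp add: \<pi>_def)
    ultimately show ?thesis using wedge_permute[of \<pi> l v] by auto
  qed
  then obtain s :: "(nat \<Rightarrow> nat) \<Rightarrow> int" where s: "\<And>\<phi>. \<phi> \<in> ?F \<Longrightarrow> wedge l (\<lambda>a. v (\<phi> a)) = real_of_int (s \<phi>) *\<^sub>R wedge l v"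
    by metis
  show ?thesis
  proof
    show "wedge l u = real_of_int (\<Sum>\<phi>\<in>?F. (\<Prod>a<l. C a (\<phi> a)) * s \<phi>) *\<^sub>R wedge l v"
      unfolding 1 by (subst wedge_sum_expand) (simp_all add: s scaleR_sum_left)
  qed
qed

text \<open>An injective map is its image \<open>S\<close> together with a permutation, via the
  fixed enumeration of \<open>S\<close>. This groups multilinear expansions into coordinates of
  wedge products, with the permutations producing minors.\<close>

lemma sum_PiE_inj:
  fixes G :: "(nat \<Rightarrow> 'n::finite) \<Rightarrow> 'v::comm_monoid_add"
  assumes zero: "\<And>\<phi>. \<not> inj_on \<phi> {..<l} \<Longrightarrow> G \<phi> = 0"
    and cong: "\<And>\<phi> \<psi>. (\<And>a. a < l \<Longrightarrow> \<phi> a = \<psi> a) \<Longrightarrow> G \<phi> = G \<psi>"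
  shows "(\<Sum>\<phi>\<in>PiE {..<l} (\<lambda>_. UNIV). G \<phi>)
       = (\<Sum>S | card S = l. \<Sum>p | p permutes {..<l}. G (\<lambda>a. from_nat_into S (p a)))"
proof -
  let ?F = "PiE {..<l} (\<lambda>_. UNIV :: 'n set)" and ?P = "{p. p permutes {..<l}}"
  let ?I = "{\<phi>\<in>?F. inj_on \<phi> {..<l}}"
  have finF: "finite ?F" by (intro finite_PiE) auto
  have "(\<Sum>\<phi>\<in>?F. G \<phi>) = (\<Sum>\<phi>\<in>?I. G \<phi>)"
    using finF by (intro sum.mono_neutral_right) (auto intro: zero)
  also have "\<dots> = (\<Sum>S | card S = l. \<Sum>\<phi> | \<phi> \<in> ?I \<and> \<phi> ` {..<l} = S. G \<phi>)"
  proof (rule sum.group[symmetric])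
    show "finite ?I" using finF by simp
    show "finite {S :: 'n set. card S = l}" by simp
    show "(\<lambda>\<phi>. \<phi> ` {..<l}) ` ?I \<subseteq> {S. card S = l}"
      using card_image by fastforce
  qed
  also have "\<dots> = (\<Sum>S | card S = l. \<Sum>p\<in>?P. G (\<lambda>a. from_nat_into S (p a)))"
  proof (rule sum.cong[OF refl])
    fix S :: "'n set" assume "S \<in> {S. card S = l}"
    then have S: "card S = l" by simp
    let ?e = "from_nat_into S"
    have e: "bij_betw ?e {..<l} S"
      unfolding S[symmetric] by (rule bij_betw_from_nat_into_finite) simp
    show "(\<Sum>\<phi> | \<phi> \<in> ?I \<and> \<phi> ` {..<l} = S. G \<phi>) = (\<Sum>p\<in>?P. G (\<lambda>a. ?e (p a)))"
    proof (rule sum.reindex_bij_betw[THEN trans[OF sym]])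
      show "bij_betw (\<lambda>p. restrict (\<lambda>a. ?e (p a)) {..<l}) ?P {\<phi>. \<phi> \<in> ?I \<and> \<phi> ` {..<l} = S}"
      proof (rule bij_betwI')
        fix p p' assume p: "p \<in> ?P" "p' \<in> ?P"
        show "(restrict (\<lambda>a. ?e (p a)) {..<l} = restrict (\<lambda>a. ?e (p' a)) {..<l}) = (p = p')"
        proof
          assume eq: "restrict (\<lambda>a. ?e (p a)) {..<l} = restrict (\<lambda>a. ?e (p' a)) {..<l}"
          have "p a = p' a" for a
          proof (cases "a < l")
            case True
            then have "?e (p a) = ?e (p' a)" using fun_cong[OF eq, of a] by simp
            moreover have "p a < l" "p' a < l"
              using p True permutes_in_image[of p "{..<l}" a] permutes_in_image[of p' "{..<l}" a] by auto
            ultimately show ?thesis using e by (auto simp: bij_betw_def inj_on_def)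
          next
            case False
            then show ?thesis using p by (simp add: permutes_def)
          qed
          then show "p = p'" by auto
        qed simp
      next
        fix p assume "p \<in> ?P"
        then have p: "p permutes {..<l}" by simp
        have b: "bij_betw (\<lambda>a. ?e (p a)) {..<l} S"
          using bij_betw_trans[OF permutes_imp_bij[OF p] e] by (simp add: comp_def)
        then show "restrict (\<lambda>a. ?e (p a)) {..<l} \<in> {\<phi>. \<phi> \<in> ?I \<and> \<phi> ` {..<l} = S}"
          by (auto simp: bij_betw_def inj_on_def image_iff)
      next
        fix \<phi> assume "\<phi> \<in> {\<phi>. \<phi> \<in> ?I \<and> \<phi> ` {..<l} = S}"
        then have \<phi>: "\<phi> \<in> ?F" "bij_betw \<phi> {..<l} S" by (auto simp: bij_betw_def)
        define p where "p a = (if a < l then the_inv_into {..<l} ?e (\<phi> a) else a)" for a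
        have "bij_betw (the_inv_into {..<l} ?e \<circ> \<phi>) {..<l} {..<l}"
          by (rule bij_betw_trans[OF \<phi>(2) bij_betw_the_inv_into[OF e]])
        then have "bij_betw p {..<l} {..<l}"
          by (rule bij_betw_cong[THEN iffD1, rotated]) (simp add: p_def)
        then have p: "p permutes {..<l}" by (rule bij_imp_permutes) (simp add: p_def)
        have "?e (p a) = \<phi> a" if "a < l" for a
        proof -
          have "\<phi> a \<in> S" using \<phi>(2) that by (auto simp: bij_betw_def)
          then show ?thesis using e that by (auto simp: p_def bij_betw_def intro!: f_the_inv_into_f)
        qed
        then have "\<phi> = restrict (\<lambda>a. ?e (p a)) {..<l}"
          using \<phi>(1) by (auto simp: fun_eq_iff PiE_def extensional_def)
        with p show "\<exists>p\<in>?P. \<phi> = restrict (\<lambda>a. ?e (p a)) {..<l}" by auto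
      qed
      show "(\<Sum>p\<in>?P. G (restrict (\<lambda>a. ?e (p a)) {..<l})) = (\<Sum>p\<in>?P. G (\<lambda>a. ?e (p a)))"
        by (intro sum.cong refl cong) auto
    qed
  qed
  finally show ?thesis .
qed

text \<open>Justifies \<open>ext_map\<close>, which is defined through basis vectors only: expanding
  every \<open>u a\<close> in the standard basis and grouping the index maps by their image leaves
  exactly the minors of \<open>u\<close> as coefficients.\<close>

lemma ext_map_wedge:
  fixes A :: "real^'n::finite^'n"
  shows "ext_map l A (wedge l u) = wedge l (\<lambda>a. A *v u a)"
proof -
  let ?v = "\<lambda>i. A *v axis i 1" and ?P = "{p. p permutes {..<l}}"
  have "A *v u a = (\<Sum>i\<in>UNIV. u a $ i *\<^sub>R ?v i)" for a
    by (simp add: vec_eq_iff matrix_vector_mult_basis column_def) (simp add: matrix_vector_mult_def mult_ac)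
  then have "wedge l (\<lambda>a. A *v u a)
      = (\<Sum>\<phi>\<in>PiE {..<l} (\<lambda>_. UNIV). (\<Prod>a<l. u a $ \<phi> a) *\<^sub>R wedge l (\<lambda>a. ?v (\<phi> a)))"
    by (simp add: wedge_sum_expand)
  also have "\<dots> = (\<Sum>S | card S = l. \<Sum>p\<in>?P. (\<Prod>a<l. u a $ from_nat_into S (p a)) *\<^sub>R
                   wedge l (\<lambda>a. ?v (from_nat_into S (p a))))"
  proof (rule sum_PiE_inj)
    fix \<phi> :: "nat \<Rightarrow> 'n" assume "\<not> inj_on \<phi> {..<l}"
    then show "(\<Prod>a<l. u a $ \<phi> a) *\<^sub>R wedge l (\<lambda>a. ?v (\<phi> a)) = 0"
      by (simp add: wedge_not_inj[of \<phi> l ?v])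
  next
    fix \<phi> \<psi> :: "nat \<Rightarrow> 'n" assume "\<And>a. a < l \<Longrightarrow> \<phi> a = \<psi> a"
    then show "(\<Prod>a<l. u a $ \<phi> a) *\<^sub>R wedge l (\<lambda>a. ?v (\<phi> a)) = (\<Prod>a<l. u a $ \<psi> a) *\<^sub>R wedge l (\<lambda>a. ?v (\<psi> a))"
      by (intro arg_cong2[of _ _ _ _ "(*\<^sub>R)"] prod.cong wedge_cong) auto
  qed
  also have "\<dots> = ext_map l A (wedge l u)"
    unfolding ext_map_def
  proof (rule sum.cong[OF refl])
    fix S :: "'n set" assume "S \<in> {S. card S = l}"
    then have S: "card S = l" by simp
    have "(\<Sum>p\<in>?P. (\<Prod>a<l. u a $ from_nat_into S (p a)) *\<^sub>R wedge l (\<lambda>a. ?v (from_nat_into S (p a))))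
        = (\<Sum>p\<in>?P. (of_int (sign p) * (\<Prod>a<l. u a $ from_nat_into S (p a))) *\<^sub>R wedge l (\<lambda>a. ?v (from_nat_into S a)))"
    proof (rule sum.cong[OF refl])
      fix p assume "p \<in> ?P"
      then have p: "p permutes {..<l}" by simp
      show "(\<Prod>a<l. u a $ from_nat_into S (p a)) *\<^sub>R wedge l (\<lambda>a. ?v (from_nat_into S (p a)))
        = (of_int (sign p) * (\<Prod>a<l. u a $ from_nat_into S (p a))) *\<^sub>R wedge l (\<lambda>a. ?v (from_nat_into S a))"
        using wedge_permute[OF p, of "\<lambda>a. ?v (from_nat_into S a)"] by (simp add: comp_def mult.commute)
    qed
    also have "\<dots> = wedge l u $ S *\<^sub>R wedge l (\<lambda>a. ?v (from_nat_into S a))"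
      by (simp add: wedge_nth[OF S] scaleR_sum_left)
    finally show "(\<Sum>p\<in>?P. (\<Prod>a<l. u a $ from_nat_into S (p a)) *\<^sub>R wedge l (\<lambda>a. ?v (from_nat_into S (p a))))
        = wedge l u $ S *\<^sub>R wedge l (\<lambda>a. ?v (from_nat_into S a))" .
  qed
  finally show ?thesis ..
qed

section \<open>Exterior powers of matrices: composition, identity and adjoint\<close>

lemma linear_ext_map: "linear (ext_map l A)"
  unfolding ext_map_def
  by (rule linearI) (simp_all add: scaleR_left_distrib sum.distrib scaleR_sum_right)

lemma ext_map_mult: "ext_map l (A ** B) x = ext_map l A (ext_map l B x)"
proof -
  have "ext_map l A (ext_map l B x)
      = (\<Sum>S | card S = l. x $ S *\<^sub>R ext_map l A (wedge l (\<lambda>a. B *v axis (from_nat_into S a) 1)))"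
    unfolding ext_map_def[of l B] by (simp add: linear_sum[OF linear_ext_map] linear_scale[OF linear_ext_map])
  also have "\<dots> = ext_map l (A ** B) x"
    by (simp add: ext_map_wedge matrix_vector_mul_assoc ext_map_def[of l "A ** B"])
  finally show ?thesis ..
qed

lemma wedge_in_ext_pow: "wedge l u \<in> ext_pow l"
  by (auto simp: ext_pow_def intro: span_base)

lemma ext_map_in_ext_pow: "ext_map l A x \<in> ext_pow l"
  unfolding ext_map_def ext_pow_def
  by (intro span_sum span_scale span_base) auto

lemma ext_pow_nth:
  fixes x :: "real^('n::finite set)"
  assumes "x \<in> ext_pow l" "card S \<noteq> l" shows "x $ S = 0"
proof -
  have "subspace {x. x $ S = 0}"
    by (auto simp: subspace_def)
  moreover have "range (wedge l) \<subseteq> {x. x $ S = 0}" using assms(2) by (auto simp: wedge_nth_card_ne)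
  ultimately have "ext_pow l \<subseteq> {x. x $ S = 0}" unfolding ext_pow_def by (metis span_minimal)
  then show ?thesis using assms(1) by auto
qed

lemma ext_map_axis:
  "card S = l \<Longrightarrow> ext_map l A (axis S 1) = wedge l (\<lambda>a. A *v axis (from_nat_into S a) 1)"
  unfolding ext_map_def by (simp add: axis_def if_distrib[of "\<lambda>t. t *\<^sub>R _"] cong: if_cong)

lemma ext_pow_eq_sum:
  fixes x :: "real^('n::finite set)"
  assumes "x \<in> ext_pow l"
  shows "x = (\<Sum>S | card S = l. x $ S *\<^sub>R axis S 1)"
proof (subst vec_eq_iff, rule allI)
  fix T
  have "(\<Sum>S | card S = l. x $ S *\<^sub>R axis S 1) $ T = (\<Sum>S | card S = l. if S = T then x $ T else 0)"
    unfolding sum_component by (rule sum.cong) (auto simp: axis_def)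
  also have "\<dots> = (if card T = l then x $ T else 0)"
    by (subst sum.delta) auto
  finally show "x $ T = (\<Sum>S | card S = l. x $ S *\<^sub>R axis S 1) $ T"
    using ext_pow_nth[OF assms, of T] by auto
qed

lemma ext_map_one:
  assumes "x \<in> ext_pow l" shows "ext_map l (mat 1) x = x"
proof -
  have "ext_map l (mat 1) x = (\<Sum>S | card S = l. x $ S *\<^sub>R axis S 1)"
    unfolding ext_map_def by (rule sum.cong) (auto simp: wedge_axis[symmetric] intro!: arg_cong2[of _ _ _ _ "(*\<^sub>R)"])
  then show ?thesis using ext_pow_eq_sum[OF assms] by simp
qed

lemma ext_map_nth_axis:
  assumes "card S = l" "card T = l"
  shows "ext_map l A (axis T 1) $ S =
    (\<Sum>p | p permutes {..<l}. of_int (sign p) * (\<Prod>a<l. A $ from_nat_into S (p a) $ from_nat_into T a))"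
  by (simp add: ext_map_axis assms wedge_nth matrix_vector_mult_basis column_def)

text \<open>Transposed minors agree by inverting the permutation in the Leibniz sum, which preserves
  its sign.\<close>

lemma ext_map_transpose_axis:
  assumes "card S = l" "card T = l"
  shows "ext_map l (transpose A) (axis T 1) $ S = ext_map l A (axis S 1) $ T"
proof -
  let ?P = "{p. p permutes {..<l}}"
  have "ext_map l A (axis S 1) $ T
    = (\<Sum>p\<in>?P. of_int (sign (inv p)) * (\<Prod>a<l. A $ from_nat_into T (inv p a) $ from_nat_into S a))"
    unfolding ext_map_nth_axis[OF assms(2,1)] by (rule sum_permutations_inverse)
  also have "\<dots> = (\<Sum>p\<in>?P. of_int (sign p) * (\<Prod>a<l. A $ from_nat_into T a $ from_nat_into S (p a)))"
  proof (rule sum.cong[OF refl])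
    fix p assume "p \<in> ?P"
    then have p: "p permutes {..<l}" by simp
    have "(\<Prod>a<l. A $ from_nat_into T (inv p a) $ from_nat_into S a)
        = (\<Prod>a<l. A $ from_nat_into T a $ from_nat_into S (p a))"
      using prod.permute[OF p, of "\<lambda>a. A $ from_nat_into T (inv p a) $ from_nat_into S a"]
        permutes_inverses(2)[OF p] by (simp add: comp_def)
    moreover have "sign (inv p) = sign p"
      by (rule sign_inverse) (use p in \<open>auto intro: permutation_permutes[THEN iffD2]\<close>)
    ultimately show "of_int (sign (inv p)) * (\<Prod>a<l. A $ from_nat_into T (inv p a) $ from_nat_into S a)
      = of_int (sign p) * (\<Prod>a<l. A $ from_nat_into T a $ from_nat_into S (p a))" by simp
  qed
  also have "\<dots> = ext_map l (transpose A) (axis T 1) $ S"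
    by (simp add: ext_map_nth_axis[OF assms] transpose_def)
  finally show ?thesis ..
qed

lemma ext_map_transpose:
  fixes x y :: "real^('n::finite set)"
  assumes "x \<in> ext_pow l" "y \<in> ext_pow l"
  shows "ext_map l A x \<bullet> y = x \<bullet> ext_map l (transpose A) y"
proof -
  let ?C = "{S :: 'n set. card S = l}"
  have exp: "ext_map l M z = (\<Sum>S\<in>?C. z $ S *\<^sub>R ext_map l M (axis S 1))" for M z
    unfolding ext_map_def by (rule sum.cong) (simp_all flip: ext_map_def add: ext_map_axis)
  have inn: "w \<bullet> z = (\<Sum>T\<in>?C. w $ T * z $ T)" if "z \<in> ext_pow l" for w z :: "real^('n set)"
    unfolding inner_vec_def inner_real_def
    by (rule sum.mono_neutral_right) (auto simp: ext_pow_nth[OF that])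
  have "ext_map l A x \<bullet> y = (\<Sum>T\<in>?C. \<Sum>S\<in>?C. x $ S * ext_map l A (axis S 1) $ T * y $ T)"
    unfolding inn[OF assms(2)] exp[of A x] by (simp add: sum_distrib_right)
  also have "\<dots> = (\<Sum>S\<in>?C. \<Sum>T\<in>?C. x $ S * (y $ T * ext_map l (transpose A) (axis T 1) $ S))"
    by (subst sum.swap) (auto intro!: sum.cong simp: ext_map_transpose_axis)
  also have "\<dots> = x \<bullet> ext_map l (transpose A) y"
    by (subst inn[OF ext_map_in_ext_pow], subst exp[of "transpose A" y]) (simp add: sum_distrib_left)
  finally show ?thesis .
qed

lemma wedge_eq_0_card: "CARD('n) < l \<Longrightarrow> wedge l u = (0 :: real^('n::finite set))"
  unfolding vec_eq_iff
proof
  fix S :: "'n set" assume "CARD('n) < l"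
  then have "card S \<noteq> l" using card_mono[of UNIV S] by auto
  then show "wedge l u $ S = 0 $ S" by (simp add: wedge_nth_card_ne)
qed

section \<open>Nonvanishing wedge products and linear independence\<close>

lemma span_image_lessThan:
  assumes "x \<in> span (v ` {..<l::nat})"
  obtains c where "x = (\<Sum>b<l. c b *\<^sub>R v b)"
proof -
  let ?R = "range (\<lambda>c. \<Sum>b<l. c b *\<^sub>R v b)"
  have "subspace ?R"
  proof (rule subspaceI)
    show "0 \<in> ?R" by (rule image_eqI[of _ _ "\<lambda>_. 0"]) auto
    show "x + y \<in> ?R" if "x \<in> ?R" "y \<in> ?R" for x y
    proof -
      from that obtain c c' where "x = (\<Sum>b<l. c b *\<^sub>R v b)" "y = (\<Sum>b<l. c' b *\<^sub>R v b)" by auto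
      then show ?thesis
        by (intro image_eqI[of _ _ "\<lambda>b. c b + c' b"]) (auto simp: scaleR_left_distrib sum.distrib)
    qed
    show "r *\<^sub>R x \<in> ?R" if "x \<in> ?R" for r x
    proof -
      from that obtain c where "x = (\<Sum>b<l. c b *\<^sub>R v b)" by auto
      then show ?thesis
        by (intro image_eqI[of _ _ "\<lambda>b. r * c b"]) (auto simp: scaleR_sum_right)
    qed
  qed
  moreover have "v ` {..<l} \<subseteq> ?R"
  proof
    fix y assume "y \<in> v ` {..<l}"
    then obtain a where a: "a < l" "y = v a" by auto
    have "(\<Sum>b<l. (if b = a then 1 else 0) *\<^sub>R v b) = (\<Sum>b<l. if b = a then v b else 0)"
      by (rule sum.cong) auto
    then have "y = (\<Sum>b<l. (if b = a then 1 else 0) *\<^sub>R v b)" using a by simp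
    then show "y \<in> ?R" by (intro range_eqI[of _ _ "\<lambda>b. if b = a then 1 else 0"])
  qed
  ultimately have "span (v ` {..<l}) \<subseteq> ?R" by (rule span_minimal[rotated])
  with assms that show ?thesis by auto
qed

lemma wedge_nonzero_coeffs_unique:
  assumes "wedge l u \<noteq> 0" "(\<Sum>b<l. c b *\<^sub>R u b) = (\<Sum>b<l. c' b *\<^sub>R u b)" "a < l"
  shows "c a = c' a"
proof -
  let ?x = "\<Sum>b<l. c b *\<^sub>R u b"
  have "wedge l (u(a := ?x)) = c a *\<^sub>R wedge l u" "wedge l (u(a := ?x)) = c' a *\<^sub>R wedge l u"
    using assms by (intro wedge_replace; simp)+
  with assms(1) show ?thesis by (metis scaleR_cancel_right)
qed

text \<open>If \<open>u i\<close> depends on the others, Cramer's rule gives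
  \<open>wedge l u\<close> the factor 0. Conversely an independent family can be mapped to standard
  basis vectors, whose wedge product is a unit vector, and the linear \<open>ext_map\<close> cannot
  reach it from 0.\<close>

lemma wedge_nonzero_iff:
  fixes u :: "nat \<Rightarrow> real^'n::finite"
  shows "wedge l u \<noteq> 0 \<longleftrightarrow> inj_on u {..<l} \<and> independent (u ` {..<l})"
proof
  assume nz: "wedge l u \<noteq> 0"
  have inj: "inj_on u {..<l}" using nz wedge_not_inj[of u l "\<lambda>x. x"] by auto
  have "independent (u ` {..<l})"
  proof
    assume "dependent (u ` {..<l})"
    then obtain i where i: "i < l" "u i \<in> span (u ` {..<l} - {u i})" by (auto simp: dependent_def)
    \<comment> \<open>Zeroing slot \<open>i\<close> keeps the indexing by all slots while removing
      \<open>u i\<close> from the span.\<close>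
    define v where "v a = (if a = i then 0 else u a)" for a
    have "span (u ` {..<l} - {u i}) \<subseteq> span (v ` {..<l})"
    proof (rule span_mono, rule subsetI)
      fix x assume "x \<in> u ` {..<l} - {u i}"
      then obtain a where "a < l" "x = u a" "a \<noteq> i" by auto
      then show "x \<in> v ` {..<l}" by (intro image_eqI[of _ _ a]) (auto simp: v_def)
    qed
    with i obtain c where c: "u i = (\<Sum>b<l. c b *\<^sub>R v b)" by (auto elim: span_image_lessThan)
    have "(\<Sum>b<l. c b *\<^sub>R v b) = (\<Sum>b<l. (if b = i then 0 else c b) *\<^sub>R u b)"
      by (rule sum.cong) (auto simp: v_def)
    with c have "wedge l u = (if i = i then 0 else c i) *\<^sub>R wedge l u"
      by (intro wedge_replace[OF i(1)]) auto
    with nz show False by simp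
  qed
  with inj show "inj_on u {..<l} \<and> independent (u ` {..<l})" ..
next
  assume u: "inj_on u {..<l} \<and> independent (u ` {..<l})"
  have "l = card (u ` {..<l})" using u by (simp add: card_image)
  also have "\<dots> \<le> CARD('n)" using u independent_bound[of "u ` {..<l}"] by simp
  finally obtain S :: "'n set" where S: "card S = l"
    using obtain_subset_with_card_n[of l UNIV] by auto
  have "\<exists>g. linear g \<and> (\<forall>x\<in>u ` {..<l}. g x = axis (from_nat_into S (the_inv_into {..<l} u x)) (1::real))"
    using u by (intro linear_independent_extend) auto
  then obtain g where g: "linear g" "\<And>a. a < l \<Longrightarrow> g (u a) = axis (from_nat_into S a) (1::real)"
    using u by (auto simp: the_inv_into_f_f)
  have "ext_map l (matrix g) (wedge l u) = wedge l (\<lambda>a. axis (from_nat_into S a) 1)"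
    unfolding ext_map_wedge by (rule wedge_cong) (simp add: g matrix_works)
  also have "\<dots> = axis S 1" using wedge_axis[of S] S by simp
  finally show "wedge l u \<noteq> 0"
    using linear_0[OF linear_ext_map, of l "matrix g"] axis_eq_0_iff[of S "1::real"] by force
qed

lemma dim_span_wedge:
  fixes u :: "nat \<Rightarrow> real^'n::finite"
  assumes "wedge l u \<noteq> 0"
  shows "dim (span (u ` {..<l})) = l"
  using assms unfolding wedge_nonzero_iff
  by (simp add: dim_eq_card_independent card_image)

text \<open>As \<open>dependent\<close> sees only the set of vectors, a repeated vector needs its
  own relation, with coefficients 1 and -1.\<close>

lemma wedge_zero_dependence:
  fixes u :: "nat \<Rightarrow> real^'n::finite"
  assumes "wedge l u = 0"
  obtains r b where "(\<Sum>a<l. r a *\<^sub>R u a) = 0" "b < l" "r b \<noteq> 0"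
proof (cases "inj_on u {..<l}")
  case False
  then obtain a b where ab: "a < l" "b < l" "a \<noteq> b" "u a = u b" by (auto simp: inj_on_def)
  define r where "r c = (if c = a then 1 else if c = b then -1 else (0::real))" for c
  have "(\<Sum>c<l. r c *\<^sub>R u c) = (\<Sum>c\<in>{a,b}. r c *\<^sub>R u c)"
    using ab by (intro sum.mono_neutral_right) (auto simp: r_def)
  also have "\<dots> = 0" using ab by (simp add: r_def)
  finally show ?thesis using that[of r a] ab by (simp add: r_def)
next
  case True
  with assms have "dependent (u ` {..<l})" by (metis wedge_nonzero_iff)
  then obtain c v where c: "(\<Sum>x\<in>u ` {..<l}. c x *\<^sub>R x) = 0" "v \<in> u ` {..<l}" "c v \<noteq> 0"
    by (auto simp: dependent_finite)
  from c(1) True have "(\<Sum>a<l. c (u a) *\<^sub>R u a) = 0" by (simp add: sum.reindex)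
  with c(2,3) that[of "\<lambda>a. c (u a)"] show ?thesis by auto
qed

section \<open>Gram determinants and the Fischer inequality\<close>

lemma axis_in_ext_pow: "axis S 1 \<in> ext_pow (card S)"
  by (metis wedge_axis wedge_in_ext_pow)

text \<open>The Gram determinant in Leibniz form. Both families are written as images of one unit
  vector \<open>axis T 1\<close> under matrices, so the adjoint rule turns the inner product into a
  single minor of a product matrix.\<close>

lemma wedge_inner:
  fixes u v :: "nat \<Rightarrow> real^'n::finite"
  assumes "l \<le> CARD('n)"
  shows "wedge l u \<bullet> wedge l v = (\<Sum>p | p permutes {..<l}. of_int (sign p) * (\<Prod>a<l. u (p a) \<bullet> v a))"
proof -
  obtain T :: "'n set" where T: "card T = l"
    using obtain_subset_with_card_n[of l UNIV] assms by auto
  let ?e = "from_nat_into T"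
  have e: "bij_betw ?e {..<l} T"
    unfolding T[symmetric] by (rule bij_betw_from_nat_into_finite) simp
  \<comment> \<open>Column \<open>j\<close> in \<open>T\<close> carries the vector whose number is
    that of \<open>j\<close> in the enumeration; columns outside \<open>T\<close> are arbitrary and
    do not enter the minor.\<close>
  define M where "M w = (\<chi> i j. w (the_inv_into {..<l} ?e j) $ i)" for w :: "nat \<Rightarrow> real^'n"
  have M: "M w *v axis (?e a) 1 = w a" if "a < l" for w a
    using e that by (simp add: vec_eq_iff matrix_vector_mult_basis column_def M_def the_inv_into_f_f bij_betw_def)
  have Mw: "wedge l w = ext_map l (M w) (axis T 1)" for w
    unfolding ext_map_axis[OF T] by (rule wedge_cong) (simp add: M)
  have "wedge l u \<bullet> wedge l v = axis T 1 \<bullet> ext_map l (transpose (M u)) (ext_map l (M v) (axis T 1))"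
    unfolding Mw using T axis_in_ext_pow[of T] by (simp add: ext_map_transpose ext_map_in_ext_pow)
  also have "\<dots> = ext_map l (transpose (M u) ** M v) (axis T 1) $ T"
    by (simp add: ext_map_mult inner_axis')
  also have "\<dots> = (\<Sum>p | p permutes {..<l}. of_int (sign p) * (\<Prod>a<l. u (p a) \<bullet> v a))"
    unfolding ext_map_nth_axis[OF T T]
  proof (intro sum.cong refl arg_cong2[of _ _ _ _ "(*)"] prod.cong)
    fix p a assume "p \<in> {p. p permutes {..<l}}" "a \<in> {..<l}"
    then have "p a < l" "a < l" using permutes_in_image[of p "{..<l}" a] by auto
    then show "(transpose (M u) ** M v) $ ?e (p a) $ ?e a = u (p a) \<bullet> v a"
      using e by (simp add: matrix_matrix_mult_def transpose_def M_def inner_vec_def the_inv_into_f_f bij_betw_def)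
  qed
  finally show ?thesis .
qed

text \<open>In the Gram sum a permutation that moves \<open>l\<close> has the factor
  \<open>v (p l) \<bullet> v l\<close>, which is 0; what remains is the Gram sum of the first
  \<open>l\<close> vectors.\<close>

lemma norm_wedge_Suc_orthogonal:
  fixes v :: "nat \<Rightarrow> real^'n::finite"
  assumes l: "Suc l \<le> CARD('n)" and orth: "\<And>a. a < l \<Longrightarrow> v a \<bullet> v l = 0"
  shows "norm (wedge (Suc l) v) = norm (v l) * norm (wedge l v)"
proof -
  let ?f = "\<lambda>k p. of_int (sign p) * (\<Prod>a<k. v (p a) \<bullet> v a) :: real"
  have "wedge (Suc l) v \<bullet> wedge (Suc l) v = (\<Sum>p | p permutes {..<Suc l}. ?f (Suc l) p)"
    using l by (rule wedge_inner)
  also have "\<dots> = (\<Sum>p | p permutes {..<l}. ?f (Suc l) p)"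
  proof (rule sum.mono_neutral_right)
    show "finite {p. p permutes {..<Suc l}}" by (simp add: finite_permutations)
    show "{p. p permutes {..<l}} \<subseteq> {p. p permutes {..<Suc l}}"
      by (auto intro: permutes_subset)
    show "\<forall>p\<in>{p. p permutes {..<Suc l}} - {p. p permutes {..<l}}. ?f (Suc l) p = 0"
    proof
      fix p assume p: "p \<in> {p. p permutes {..<Suc l}} - {p. p permutes {..<l}}"
      have "p l \<noteq> l"
      proof
        assume "p l = l"
        have "p permutes {..<l}"
        proof (rule permutes_superset)
          show "p permutes {..<Suc l}" using p by blast
          show "p x = x" if "x \<in> {..<Suc l} - {..<l}" for x
          proof -
            from that have "x = l" by (simp add: less_Suc_eq)
            with \<open>p l = l\<close> show ?thesis by simp
          qed
        qed
        with p show False by blast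
      qed
      moreover have "p l < Suc l" using p permutes_in_image[of p "{..<Suc l}" l] by blast
      ultimately have "v (p l) \<bullet> v l = 0" by (intro orth) simp
      then show "?f (Suc l) p = 0" by simp
    qed
  qed
  also have "\<dots> = (v l \<bullet> v l) * (\<Sum>p | p permutes {..<l}. ?f l p)"
    unfolding sum_distrib_left
    by (rule sum.cong) (auto simp: permutes_not_in)
  also have "(\<Sum>p | p permutes {..<l}. ?f l p) = wedge l v \<bullet> wedge l v"
    using l by (simp add: wedge_inner)
  finally have "(norm (wedge (Suc l) v))\<^sup>2 = (norm (v l) * norm (wedge l v))\<^sup>2"
    by (simp add: power_mult_distrib dot_square_norm)
  then show ?thesis by (simp add: power2_eq_iff_nonneg)
qed

text \<open>Base times height: \<open>wedge_replace\<close> removes the part of \<open>v l\<close>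
  that lies in the span of the others.\<close>

lemma norm_wedge_Suc:
  fixes v :: "nat \<Rightarrow> real^'n::finite"
  assumes l: "Suc l \<le> CARD('n)" and p: "p \<in> span (v ` {..<l})"
    and z: "\<And>w. w \<in> span (v ` {..<l}) \<Longrightarrow> orthogonal z w" and vl: "v l = p + z"
  shows "norm (wedge (Suc l) v) = norm z * norm (wedge l v)"
proof -
  from p obtain c where c: "p = (\<Sum>b<l. c b *\<^sub>R v b)" by (rule span_image_lessThan)
  let ?u = "v(l := z)" and ?c = "c(l := 1)"
  have "(\<Sum>b<Suc l. ?c b *\<^sub>R ?u b) = p + z" by (simp add: c)
  then have "wedge (Suc l) v = ?c l *\<^sub>R wedge (Suc l) ?u"
    by (intro wedge_replace) (auto simp: vl)
  moreover have "norm (wedge (Suc l) ?u) = norm (?u l) * norm (wedge l ?u)"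
  proof (rule norm_wedge_Suc_orthogonal[OF l])
    fix a assume "a < l"
    then have "orthogonal z (v a)" by (intro z span_base) simp
    with \<open>a < l\<close> show "?u a \<bullet> ?u l = 0" by (simp add: orthogonal_def inner_commute)
  qed
  moreover have "wedge l ?u = wedge l v" by (rule wedge_cong) auto
  ultimately show ?thesis by simp
qed

text \<open>Submodularity of volume. By induction on \<open>m\<close>: on the left each further
  \<open>y\<close> is adjoined to a family with the larger span, so its height there is at most its
  height over the \<open>y\<close> already present on the right.\<close>

lemma fischer_inequality:
  fixes x y :: "nat \<Rightarrow> real^'n::finite"
  assumes "i \<le> l" and xy: "\<And>a. a < i \<Longrightarrow> x a = y a"
  shows "norm (wedge (l + m) (\<lambda>a. if a < l then x a else y (a - l + i))) * norm (wedge i x)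
       \<le> norm (wedge l x) * norm (wedge (i + m) y)"
proof (induction m)
  case 0
  have "wedge l (\<lambda>a. if a < l then x a else y (a - l + i)) = wedge l x" "wedge i x = wedge i y"
    by (rule wedge_cong; simp add: xy)+
  then show ?case by simp
next
  case (Suc m)
  define c where "c a = (if a < l then x a else y (a - l + i))" for a
  have c_eq: "c = (\<lambda>a. if a < l then x a else y (a - l + i))" by (auto simp: c_def)
  show ?case
  proof (cases "Suc (l + m) \<le> CARD('n)")
    case False
    then show ?thesis by (simp add: wedge_eq_0_card)
  next
    case True
    obtain p z where z: "p \<in> span (c ` {..<l+m})" "\<And>w. w \<in> span (c ` {..<l+m}) \<Longrightarrow> orthogonal z w"
      "c (l + m) = p + z" using orthogonal_subspace_decomp_exists[of "c ` {..<l+m}" "c (l + m)"] by metis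
    obtain p' z' where z': "p' \<in> span (y ` {..<i+m})" "\<And>w. w \<in> span (y ` {..<i+m}) \<Longrightarrow> orthogonal z' w"
      "y (i + m) = p' + z'" using orthogonal_subspace_decomp_exists[of "y ` {..<i+m}" "y (i + m)"] by metis
    have "y ` {..<i+m} \<subseteq> c ` {..<l+m}"
    proof (rule image_subsetI)
      fix a assume "a \<in> {..<i+m}"
      then show "y a \<in> c ` {..<l+m}"
        using \<open>i \<le> l\<close> by (cases "a < i") (auto simp: c_def xy intro!: image_eqI[of _ _ "if a < i then a else a - i + l"])
    qed
    then have "p' \<in> span (c ` {..<l+m})" using z'(1) span_mono by blast
    with z(1) have "p' - p \<in> span (c ` {..<l+m})" by (rule span_diff[rotated])
    \<comment> \<open>The two heights differ by a vector of the larger span, to which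
      \<open>z\<close> is orthogonal; Pythagoras compares them.\<close>
    then have "orthogonal z (p' - p)" by (rule z(2))
    moreover have zz: "z' = z - (p' - p)"
      using z(3) z'(3) by (simp add: c_def add.commute algebra_simps)
    ultimately have "(norm z')\<^sup>2 = (norm z)\<^sup>2 + (norm (p' - p))\<^sup>2"
      unfolding zz orthogonal_def by (simp add: power2_norm_eq_inner inner_diff inner_commute algebra_simps)
    then have le: "norm z \<le> norm z'" by (simp add: power2_le_imp_le)
    have "norm (wedge (l + Suc m) c) * norm (wedge i x) = norm z * (norm (wedge (l + m) c) * norm (wedge i x))"
      using norm_wedge_Suc[OF True z] by simp
    also have "\<dots> \<le> norm z' * (norm (wedge l x) * norm (wedge (i + m) y))"
      by (rule mult_mono[OF le Suc[folded c_eq]]) auto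
    also have "\<dots> = norm (wedge l x) * norm (wedge (i + Suc m) y)"
      using norm_wedge_Suc[OF _ z'] True \<open>i \<le> l\<close> by simp
    finally show ?thesis unfolding c_eq .
  qed
qed

section \<open>Rational subspaces\<close>

definition zvec :: "(real^'n) set" where
  "zvec = {v. \<forall>i. v $ i \<in> \<int>}"

text \<open>Saturation phrased by coefficients: integral points of the span have integral
  coordinates. In this form it can be checked one coefficient at a time in the descent of
  \<open>primitive_extend\<close>.\<close>

definition primitive :: "nat \<Rightarrow> (nat \<Rightarrow> real^'n::finite) \<Rightarrow> bool" where
  "primitive l u \<longleftrightarrow> wedge l u \<noteq> 0 \<and> (\<forall>a<l. u a \<in> zvec) \<and>
     (\<forall>c. (\<Sum>a<l. c a *\<^sub>R u a) \<in> zvec \<longrightarrow> (\<forall>a<l. c a \<in> \<int>))"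

lemma zvec_sum: "(\<And>a. a \<in> I \<Longrightarrow> c a \<in> \<int>) \<Longrightarrow> (\<And>a. a \<in> I \<Longrightarrow> u a \<in> zvec) \<Longrightarrow> (\<Sum>a\<in>I. c a *\<^sub>R u a) \<in> zvec"
  by (auto simp: zvec_def intro!: Ints_mult Ints_sum)

lemma zvec_diff: "x \<in> zvec \<Longrightarrow> y \<in> zvec \<Longrightarrow> x - y \<in> zvec"
  by (auto simp: zvec_def)

lemma axis_in_zvec: "axis i 1 \<in> zvec"
  by (auto simp: zvec_def axis_def)

lemma wedge_zvec:
  assumes "\<And>a. a < l \<Longrightarrow> u a \<in> zvec"
  shows "wedge l u \<in> zvec"
proof -
  have "wedge l u $ S \<in> \<int>" for S
    using assms by (cases "card S = l") (auto simp: wedge_nth wedge_nth_card_ne zvec_def intro!: Ints_sum Ints_mult Ints_prod)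
  then show ?thesis by (simp add: zvec_def)
qed

lemma norm_zvec_ge_1:
  assumes "x \<in> zvec" "x \<noteq> 0" shows "1 \<le> norm x"
proof -
  obtain i where "x $ i \<noteq> 0" using assms(2) by (auto simp: vec_eq_iff)
  then have "1 \<le> \<bar>x $ i\<bar>" using assms(1) by (intro Ints_nonzero_abs_ge1) (auto simp: zvec_def)
  also have "\<dots> \<le> norm x" by (rule component_le_norm_cart)
  finally show ?thesis .
qed

text \<open>Dirichlet approximation makes the integer combination of norm below 1, and an integer
  vector that short is 0.\<close>

lemma int_dependence:
  fixes v :: "nat \<Rightarrow> real^'n::finite"
  assumes v: "\<And>a. a < N \<Longrightarrow> v a \<in> zvec"
    and r: "(\<Sum>a<N. r a *\<^sub>R v a) = 0" "b < N" "r b \<noteq> 0"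
  obtains p :: "nat \<Rightarrow> int" and b where "(\<Sum>a<N. of_int (p a) *\<^sub>R v a) = 0" "b < N" "p b \<noteq> 0"
proof -
  define M where "M = (\<Sum>a<N. norm (v a))"
  \<comment> \<open>Approximation errors below \<open>1 / K\<close> are weighted by norms of total
    \<open>M\<close>, so \<open>K > M\<close> keeps the error vector below norm 1.\<close>
  define K where "K = nat \<lceil>M\<rceil> + 2"
  have K: "0 < K" "M < real K" "2 \<le> real K" by (auto simp: K_def) linarith
  obtain q p where q: "0 < q" and p: "\<And>a. a < N \<Longrightarrow> \<bar>of_int q * (r a / r b) - of_int (p a)\<bar> < 1 / real K"
    using Dirichlet_approx_simult[OF K(1), of N "\<lambda>a. r a / r b"] by blast
  have M0: "0 \<le> M" by (auto simp: M_def intro: sum_nonneg)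
  let ?y = "\<Sum>a<N. of_int (p a) *\<^sub>R v a"
  have "(\<Sum>a<N. (of_int q * (r a / r b)) *\<^sub>R v a) = (of_int q / r b) *\<^sub>R (\<Sum>a<N. r a *\<^sub>R v a)"
    by (simp add: scaleR_sum_right)
  then have "?y = - (\<Sum>a<N. (of_int q * (r a / r b) - of_int (p a)) *\<^sub>R v a)"
    by (simp add: r scaleR_left_diff_distrib sum_subtractf)
  then have "norm ?y \<le> (\<Sum>a<N. \<bar>of_int q * (r a / r b) - of_int (p a)\<bar> * norm (v a))"
    by (auto intro!: order_trans[OF norm_sum] simp: norm_minus_cancel simp del: norm_scaleR) simp
  also have "\<dots> \<le> (\<Sum>a<N. 1 / real K * norm (v a))"
    by (intro sum_mono mult_right_mono less_imp_le[OF p]) auto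
  also have "\<dots> = M / real K" by (simp add: M_def sum_divide_distrib)
  also have "\<dots> < 1" using K by simp
  finally have "norm ?y < 1" .
  moreover have "?y \<in> zvec" by (intro zvec_sum) (auto intro: v)
  ultimately have "?y = 0" using norm_zvec_ge_1[of ?y] by fastforce
  \<comment> \<open>Dividing by \<open>r b\<close> made the coefficient at \<open>b\<close> equal to
    1, so \<open>p b\<close> approximates \<open>q\<close> itself, a positive integer.\<close>
  moreover have "p b \<noteq> 0"
  proof
    assume "p b = 0"
    with p[OF r(2)] r(3) have "\<bar>of_int q :: real\<bar> < 1 / real K" by simp
    also have "\<dots> \<le> 1" using K by simp
    finally show False using q by simp
  qed
  ultimately show ?thesis using that r(2) by blast
qed

lemma zbasis_mem:
  assumes "zbasis l u \<Gamma>" "a < l"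
  shows "u a \<in> \<Gamma>"
proof -
  have \<Gamma>: "\<Gamma> = {\<Sum>a<l. real_of_int (c a) *\<^sub>R u a | c. True}"
    using assms(1) by (simp add: zbasis_def)
  have "(\<Sum>b<l. real_of_int (if b = a then 1 else 0) *\<^sub>R u b) = (\<Sum>b<l. if b = a then u b else 0)"
    by (rule sum.cong) auto
  also have "\<dots> = u a" using assms(2) by simp
  finally show ?thesis
    unfolding \<Gamma> by (intro CollectI exI[of _ "\<lambda>b. if b = a then 1 else 0"]) simp
qed

lemma zbasis_iff_primitive:
  fixes u :: "nat \<Rightarrow> real^'n::finite"
  assumes L: "L = span (u ` {..<l})"
  shows "zbasis l u (L \<inter> zvec) \<longleftrightarrow> primitive l u"
proof
  assume zb: "zbasis l u (L \<inter> zvec)"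
  then have nz: "wedge l u \<noteq> 0" and \<Gamma>: "L \<inter> zvec = {\<Sum>a<l. real_of_int (c a) *\<^sub>R u a | c. True}"
    by (auto simp: zbasis_def wedge_nonzero_iff)
  have "u a \<in> zvec" if "a < l" for a
    using zbasis_mem[OF zb that] by simp
  moreover have "c a \<in> \<int>" if c: "(\<Sum>a<l. c a *\<^sub>R u a) \<in> zvec" and a: "a < l" for c a
  proof -
    have "(\<Sum>a<l. c a *\<^sub>R u a) \<in> L" unfolding L by (intro span_sum span_scale span_base) auto
    with c obtain c' where "(\<Sum>a<l. c a *\<^sub>R u a) = (\<Sum>a<l. real_of_int (c' a) *\<^sub>R u a)"
      using \<Gamma> by blast
    from wedge_nonzero_coeffs_unique[OF nz this a] show ?thesis by simp
  qed
  ultimately show "primitive l u" using nz by (auto simp: primitive_def)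
next
  assume p: "primitive l u"
  have "L \<inter> zvec = {\<Sum>a<l. real_of_int (c a) *\<^sub>R u a | c. True}"
  proof (intro equalityI subsetI)
    fix x assume x: "x \<in> L \<inter> zvec"
    then obtain c where c: "x = (\<Sum>b<l. c b *\<^sub>R u b)" unfolding L by (auto elim: span_image_lessThan)
    then have "\<forall>a<l. c a \<in> \<int>" using p x by (auto simp: primitive_def)
    then have "x = (\<Sum>b<l. real_of_int \<lfloor>c b\<rfloor> *\<^sub>R u b)"
      unfolding c by (intro sum.cong) (auto simp: Ints_def)
    then show "x \<in> {\<Sum>a<l. real_of_int (c a) *\<^sub>R u a | c. True}"
      by (intro CollectI exI[of _ "\<lambda>b. \<lfloor>c b\<rfloor>"]) simp
  next
    fix x assume "x \<in> {\<Sum>a<l. real_of_int (c a) *\<^sub>R u a | c. True}"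
    then obtain c where c: "x = (\<Sum>a<l. real_of_int (c a) *\<^sub>R u a)" by auto
    have "x \<in> zvec" unfolding c using p by (intro zvec_sum) (auto simp: primitive_def)
    moreover have "x \<in> L" unfolding c L by (intro span_sum span_scale span_base) auto
    ultimately show "x \<in> L \<inter> zvec" by simp
  qed
  then show "zbasis l u (L \<inter> zvec)" using p by (simp add: zbasis_def primitive_def wedge_nonzero_iff)
qed

text \<open>Among the bases of \<open>L\<close> by integer vectors that extend \<open>w\<close>, one whose wedge product is of
  minimal size is primitive: otherwise replacing one of its vectors by a fractional combination
  would make the wedge product smaller.\<close>

lemma primitive_extend:
  fixes L :: "(real^'n::finite) set"
  assumes span: "span (L \<inter> zvec) = L" and w: "primitive i w" and wL: "\<And>a. a < i \<Longrightarrow> w a \<in> L"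
  obtains u where "\<And>a. a < i \<Longrightarrow> u a = w a" "primitive (dim L) u" "span (u ` {..<dim L}) = L"
proof -
  define l where "l = dim L"
  define P where "P u \<longleftrightarrow> (\<forall>a<i. u a = w a) \<and> (\<forall>a<l. u a \<in> L \<inter> zvec) \<and> wedge l u \<noteq> 0" for u
  \<comment> \<open>The l1 norm of the wedge product is a nonnegative integer on integer families,
    so a minimum exists, and it scales by the same factor as the wedge product when a vector is
    replaced.\<close>
  define N :: "(nat \<Rightarrow> real^'n) \<Rightarrow> real" where "N u = (\<Sum>S\<in>UNIV. \<bar>wedge l u $ S\<bar>)" for u
  have L: "subspace L" using span subspace_span[of "L \<inter> zvec"] by simp
  have wi: "inj_on w {..<i}" "independent (w ` {..<i})" "w ` {..<i} \<subseteq> L \<inter> zvec"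
    using w wL by (auto simp: primitive_def wedge_nonzero_iff)
  have ex: "\<exists>u. P u"
  proof -
    obtain B where B: "w ` {..<i} \<subseteq> B" "B \<subseteq> L \<inter> zvec" "independent B" "L \<inter> zvec \<subseteq> span B"
      using maximal_independent_subset_extend[OF wi(3,2)] by auto
    have fin: "finite B" using B(3) by (rule independent_imp_finite)
    have "dim B = l" using B span_mono[OF B(2)] span_mono[OF B(4)] span unfolding l_def
      by (metis dim_span span_span subset_antisym)
    then have card: "card B = l" using B(3) dim_eq_card_independent by metis
    define M where "M = B - w ` {..<i}"
    obtain h where h: "bij_betw h {0..<card M} M" using ex_bij_betw_nat_finite[of M] fin by (auto simp: M_def)
    have cM: "card M = l - i" "i \<le> l"
      using B(1) fin card wi(1) card_mono[OF fin B(1)] by (auto simp: M_def card_Diff_subset card_image finite_subset)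
    define u where "u a = (if a < i then w a else h (a - i))" for a
    have "u ` {..<l} = B"
    proof -
      have "{..<l} = {..<i} \<union> (\<lambda>a. a + i) ` {0..<l-i}"
        using cM(2) by (auto simp: image_iff intro!: bexI[of _ "_ - i"])
      then have "u ` {..<l} = u ` {..<i} \<union> u ` (\<lambda>a. a + i) ` {0..<l-i}"
        by (simp only: image_Un)
      also have "\<dots> = w ` {..<i} \<union> h ` {0..<l-i}"
        unfolding image_image by (intro arg_cong2[of _ _ _ _ "(\<union>)"] image_cong) (auto simp: u_def)
      also have "h ` {0..<l-i} = M" using h cM by (auto simp: bij_betw_def)
      finally show ?thesis using B(1) by (auto simp: M_def)
    qed
    moreover from this have "inj_on u {..<l}" by (intro eq_card_imp_inj_on) (auto simp: card)
    ultimately have "wedge l u \<noteq> 0" "\<forall>a<l. u a \<in> L \<inter> zvec" using B by (auto simp: wedge_nonzero_iff)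
    moreover have "\<forall>a<i. u a = w a" by (simp add: u_def)
    ultimately have "P u" unfolding P_def by blast
    then show ?thesis by (rule exI[of P])
  qed
  have N_int: "real (nat \<lfloor>N u\<rfloor>) = N u" if "P u" for u
  proof -
    have "wedge l u \<in> zvec" using that by (intro wedge_zvec) (auto simp: P_def)
    then have "N u \<in> \<int>" unfolding N_def by (intro Ints_sum) (auto simp: zvec_def)
    moreover have "0 \<le> N u" by (auto simp: N_def intro: sum_nonneg)
    ultimately show ?thesis by (auto simp: Ints_def)
  qed
  obtain u where u: "P u" "\<And>u'. P u' \<Longrightarrow> nat \<lfloor>N u\<rfloor> \<le> nat \<lfloor>N u'\<rfloor>"
    using ex_has_least_nat[of P _ "\<lambda>u. nat \<lfloor>N u\<rfloor>"] ex by metis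
  have min: "N u \<le> N u'" if "P u'" for u'
    using u(2)[OF that] N_int[OF that] N_int[OF u(1)] by linarith
  have il: "i \<le> l"
  proof -
    have "card (w ` {..<i}) \<le> dim (L \<inter> zvec)" using wi by (intro independent_card_le_dim) auto
    then show ?thesis using wi(1) span by (metis card_image card_lessThan dim_span l_def)
  qed
  have nzN: "0 < N u"
  proof -
    obtain S where "wedge l u $ S \<noteq> 0" using u(1) by (auto simp: P_def vec_eq_iff)
    then show ?thesis unfolding N_def by (intro sum_pos2[of _ S]) auto
  qed
  have "c a \<in> \<int>" if c: "(\<Sum>a<l. c a *\<^sub>R u a) \<in> zvec" and a: "a < l" for c a
  proof -
    let ?x = "\<Sum>a<l. frac (c a) *\<^sub>R u a"
    have "?x = (\<Sum>a<l. c a *\<^sub>R u a) - (\<Sum>a<l. of_int \<lfloor>c a\<rfloor> *\<^sub>R u a)"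
      by (simp add: frac_def scaleR_left_diff_distrib sum_subtractf)
    also have "\<dots> \<in> zvec" using u(1) by (intro zvec_diff[OF c] zvec_sum) (auto simp: P_def)
    finally have xz: "?x \<in> zvec" .
    have xL: "?x \<in> L" using u(1) by (intro subspace_sum subspace_scale L) (auto simp: P_def)
    \<comment> \<open>The prefix \<open>w\<close> must stay, so only slots from \<open>i\<close> on
      may be replaced by \<open>?x\<close>; this scales \<open>N\<close> by a fractional part, hence
      by less than 1.\<close>
    have hi: "frac (c j) = 0" if j: "i \<le> j" "j < l" for j
    proof (rule ccontr)
      assume ne: "frac (c j) \<noteq> 0"
      define u' where "u' = u(j := ?x)"
      have wu': "wedge l u' = frac (c j) *\<^sub>R wedge l u"
        unfolding u'_def using j by (intro wedge_replace) auto
      have "P u'" using u(1) xz xL j ne wu' by (auto simp: P_def u'_def)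
      moreover have "N u' = frac (c j) * N u"
        by (simp add: N_def wu' abs_mult sum_distrib_left)
      ultimately have "N u \<le> frac (c j) * N u" using min by metis
      moreover have "frac (c j) * N u < 1 * N u" using nzN by (intro mult_strict_right_mono frac_lt_1)
      ultimately show False by simp
    qed
    \<comment> \<open>What is left is an integral point in the span of \<open>w\<close>, and there
      primitivity of \<open>w\<close> takes over.\<close>
    have "?x = (\<Sum>a<i. frac (c a) *\<^sub>R w a)"
    proof -
      have "?x = (\<Sum>a<i. frac (c a) *\<^sub>R u a)"
        using il hi by (intro sum.mono_neutral_right) auto
      then show ?thesis using u(1) by (simp add: P_def)
    qed
    then have "\<forall>a<i. frac (c a) \<in> \<int>" using w xz by (auto simp: primitive_def)
    then have "frac (c a) \<in> \<int>" using hi[of a] a by (cases "a < i") auto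
    then show ?thesis by (simp add: frac_def)
  qed
  then have prim: "primitive l u" using u(1) by (auto simp: primitive_def P_def)
  moreover have "span (u ` {..<l}) = L"
  proof -
    have s: "span (u ` {..<l}) \<subseteq> L" using u(1) L by (intro span_minimal) (auto simp: P_def)
    have "dim (span (u ` {..<l})) = l" using prim by (intro dim_span_wedge) (simp add: primitive_def)
    then show ?thesis using subspace_dim_equal[OF subspace_span L s] by (simp add: l_def)
  qed
  moreover have "\<forall>a<i. u a = w a" using u(1) by (simp add: P_def)
  ultimately show ?thesis using that unfolding l_def by blast
qed

lemma primitive_0: "primitive 0 w"
  using inj_on_empty independent_empty by (auto simp: primitive_def wedge_nonzero_iff)

text \<open>Replaces the existence of a \<int>-basis by a condition that spans of integer points
  satisfy at once; the basis comes from extending the empty primitive family.\<close>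

lemma rational_zvec_iff: "rational zvec L \<longleftrightarrow> span (L \<inter> zvec) = L"
proof
  assume "rational zvec L"
  then obtain u where u: "subspace L" "zbasis (dim L) u (L \<inter> zvec)" "span (u ` {..<dim L}) = L"
    by (auto simp: rational_def lattice_in_def)
  then have "primitive (dim L) u" using zbasis_iff_primitive[of L u "dim L"] by simp
  then have "u ` {..<dim L} \<subseteq> L \<inter> zvec" using u(3) by (auto simp: primitive_def intro: span_base)
  then have "L \<subseteq> span (L \<inter> zvec)" using u(3) span_mono by metis
  moreover have "span (L \<inter> zvec) \<subseteq> L" using u(1) by (intro span_minimal) auto
  ultimately show "span (L \<inter> zvec) = L" by simp
next
  assume L: "span (L \<inter> zvec) = L"
  obtain u where "primitive (dim L) u" "span (u ` {..<dim L}) = L"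
    using primitive_extend[OF L primitive_0] by auto
  then show "rational zvec L"
    using zbasis_iff_primitive[of L u "dim L"] subspace_span[of "L \<inter> zvec"] L
    by (auto simp: rational_def lattice_in_def)
qed

text \<open>Each wedge product is an integer multiple of the other, so the two integers are mutually
  inverse. This makes the choice by \<open>SOME\<close> harmless up to sign.\<close>

lemma zbasis_wedge_unique:
  fixes u v :: "nat \<Rightarrow> real^'n::finite"
  assumes "zbasis l u \<Gamma>" "zbasis l v \<Gamma>"
  shows "wedge l u = wedge l v \<or> wedge l u = - wedge l v"
proof -
  have *: "\<exists>c::int. wedge l u = real_of_int c *\<^sub>R wedge l v" if "zbasis l u \<Gamma>" "zbasis l v \<Gamma>" for u v :: "nat \<Rightarrow> real^'n"
  proof -
    have "\<exists>C. \<forall>a<l. u a = (\<Sum>b<l. real_of_int (C a b) *\<^sub>R v b)"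
    proof -
      have "u a \<in> \<Gamma>" if "a < l" for a
        using zbasis_mem[OF \<open>zbasis l u \<Gamma>\<close> that] .
      then have "\<forall>a. \<exists>c. a < l \<longrightarrow> u a = (\<Sum>b<l. real_of_int (c b) *\<^sub>R v b)"
        using \<open>zbasis l v \<Gamma>\<close> unfolding zbasis_def by auto
      then show ?thesis by metis
    qed
    then show ?thesis using wedge_int_comb by metis
  qed
  obtain c :: int where c1: "wedge l u = real_of_int c *\<^sub>R wedge l v" using *[OF assms] by blast
  obtain c' :: int where c2: "wedge l v = real_of_int c' *\<^sub>R wedge l u" using *[OF assms(2,1)] by blast
  have nz: "wedge l u \<noteq> 0" using assms by (auto simp: wedge_nonzero_iff zbasis_def)
  have "wedge l u = real_of_int (c * c') *\<^sub>R wedge l u" using c1 c2 by (metis of_int_mult scaleR_scaleR)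
  then have "c * c' = 1" using nz by (metis of_int_eq_1_iff scaleR_cancel_right scaleR_one)
  then have "c = 1 \<or> c = -1" by (metis zmult_eq_1_iff)
  then show ?thesis using c1 by auto
qed

text \<open>The Pluecker vector of \<open>L\<close>, fixed up to sign. For the image of
  \<open>zvec\<close> under a matrix, covolumes become norms of \<open>ext_map\<close> of this one
  integer vector, so moving the lattice is a linear action.\<close>

definition lat_wedge :: "(real^'n::finite) set \<Rightarrow> real^('n set)" where
  "lat_wedge L = wedge (dim L) (SOME u. zbasis (dim L) u (L \<inter> zvec))"

lemma lat_wedge_eq:
  assumes "rational zvec L"
  obtains u where "primitive (dim L) u" "span (u ` {..<dim L}) = L" "lat_wedge L = wedge (dim L) u"
proof -
  obtain u where u: "zbasis (dim L) u (L \<inter> zvec)" using assms by (auto simp: rational_def lattice_in_def)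
  define v where "v = (SOME u. zbasis (dim L) u (L \<inter> zvec))"
  have v: "zbasis (dim L) v (L \<inter> zvec)" unfolding v_def using u by (rule someI[of "\<lambda>u. zbasis (dim L) u (L \<inter> zvec)"])
  then have nz: "wedge (dim L) v \<noteq> 0" by (simp add: zbasis_def wedge_nonzero_iff)
  have "v ` {..<dim L} \<subseteq> L"
    using zbasis_mem[OF v] by auto
  then have "span (v ` {..<dim L}) \<subseteq> L" using assms by (intro span_minimal) (auto simp: rational_def)
  then have s: "span (v ` {..<dim L}) = L"
    using subspace_dim_equal[OF subspace_span, of L "v ` {..<dim L}"] assms dim_span_wedge[OF nz]
    by (auto simp: rational_def)
  then have "primitive (dim L) v" using v zbasis_iff_primitive[of L v "dim L"] by auto
  with s show ?thesis using that[of v] by (simp add: lat_wedge_def v_def)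
qed

lemma rational_span:
  assumes "\<And>a. a < l \<Longrightarrow> u a \<in> zvec"
  shows "rational zvec (span (u ` {..<l}))"
  unfolding rational_zvec_iff
proof (rule antisym)
  show "span (span (u ` {..<l}) \<inter> zvec) \<subseteq> span (u ` {..<l})" by (intro span_minimal) auto
  show "span (u ` {..<l}) \<subseteq> span (span (u ` {..<l}) \<inter> zvec)"
    using assms by (intro span_mono) (auto intro: span_base)
qed

text \<open>The integer is, up to sign, the index of the lattice spanned by \<open>u\<close> in the
  integer points of \<open>L\<close>. Being nonzero it is at least 1 in absolute value, which is
  what the covolume inequality needs.\<close>

lemma wedge_int_multiple:
  fixes u :: "nat \<Rightarrow> real^'n::finite"
  assumes "wedge l u \<noteq> 0" "\<And>a. a < l \<Longrightarrow> u a \<in> zvec" "L = span (u ` {..<l})"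
  obtains c :: int where "wedge l u = of_int c *\<^sub>R lat_wedge L" "c \<noteq> 0"
proof -
  have rat: "rational zvec L" unfolding assms(3) by (rule rational_span) (rule assms)
  have dim: "dim L = l" using dim_span_wedge[OF assms(1)] assms(3) by simp
  obtain v where v: "primitive l v" "span (v ` {..<l}) = L" "lat_wedge L = wedge l v"
    using lat_wedge_eq[OF rat] dim by metis
  have zb: "zbasis l v (L \<inter> zvec)" using v zbasis_iff_primitive[of L v l] by simp
  have "\<exists>c. u a = (\<Sum>b<l. real_of_int (c b) *\<^sub>R v b)" if "a < l" for a
  proof -
    have "u a \<in> L \<inter> zvec" using assms that by (auto intro: span_base)
    then show ?thesis using zb by (auto simp: zbasis_def)
  qed
  then obtain C where C: "\<And>a. a < l \<Longrightarrow> u a = (\<Sum>b<l. real_of_int (C a b) *\<^sub>R v b)" by metis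
  from wedge_int_comb[of l u C v, OF C] obtain c :: int where "wedge l u = real_of_int c *\<^sub>R wedge l v" by auto
  with assms(1) that[of c] v(3) show ?thesis by auto
qed

lemma sum_lessThan_add:
  fixes f :: "nat \<Rightarrow> 'a::comm_monoid_add"
  shows "(\<Sum>a<l+m. f a) = (\<Sum>a<l. f a) + (\<Sum>b<m. f (l + b))"
  by (induction m) (simp_all add: add.assoc)

text \<open>The intersection is replaced by the span \<open>I\<close> of its integer points, so that its rationality
  is for free; that \<open>I\<close> is large enough follows from simultaneous Diophantine approximation, by
  which a real linear relation between integer vectors yields an integral one.\<close>

lemma lat_wedge_submodular:
  fixes L M :: "(real^'n::finite) set"
  assumes L: "rational zvec L" and M: "rational zvec M" and ne: "L \<noteq> M" and dims: "dim L = l" "dim M = l"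
  obtains I U j where "rational zvec I" "rational zvec U" "1 \<le> j" "j \<le> l" "dim I = l - j" "dim U = l + j"
    "\<And>A. norm (ext_map (l + j) A (lat_wedge U)) * norm (ext_map (l - j) A (lat_wedge I))
        \<le> norm (ext_map l A (lat_wedge L)) * norm (ext_map l A (lat_wedge M))"
proof -
  define I where "I = span (L \<inter> M \<inter> zvec)"
  have sub: "subspace L" "subspace M" using L M by (auto simp: rational_def)
  have I_sub: "I \<subseteq> L \<inter> M" unfolding I_def using sub by (intro span_minimal) (auto intro: subspace_inter)
  have ratI: "rational zvec I" unfolding rational_zvec_iff
  proof (rule antisym)
    show "span (I \<inter> zvec) \<subseteq> I" by (intro span_minimal) (auto simp: I_def)
    show "I \<subseteq> span (I \<inter> zvec)" unfolding I_def by (intro span_mono) (auto intro: span_base)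
  qed
  define i where "i = dim I"
  have sI: "subspace I" by (simp add: I_def)
  have il: "i \<le> l" using dim_subset[of I L] I_sub dims by (auto simp: i_def)
  have "i \<noteq> l"
  proof
    assume "i = l"
    then have "I = L" "I = M"
      using subspace_dim_equal[OF sI] sub I_sub dims by (auto simp: i_def)
    with ne show False by simp
  qed
  with il have il': "i < l" by simp
  obtain w where w: "primitive i w" "span (w ` {..<i}) = I" "lat_wedge I = wedge i w"
    using lat_wedge_eq[OF ratI] unfolding i_def by metis
  have wI: "w a \<in> I" if "a < i" for a using that w(2) by (auto intro: span_base)
  have wL: "w a \<in> L" and wM: "w a \<in> M" if "a < i" for a using wI[OF that] I_sub by auto
  \<comment> \<open>Both bases extend one and the same basis of \<open>I\<close>, as the Fischer
    inequality requires a common initial segment.\<close>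
  obtain x where x: "\<And>a. a < i \<Longrightarrow> x a = w a" "primitive l x" "span (x ` {..<l}) = L"
    by (rule primitive_extend[OF L[unfolded rational_zvec_iff] w(1) wL, unfolded dims]) metis+
  obtain y where y: "\<And>a. a < i \<Longrightarrow> y a = w a" "primitive l y" "span (y ` {..<l}) = M"
    by (rule primitive_extend[OF M[unfolded rational_zvec_iff] w(1) wM, unfolded dims]) metis+
  define m where "m = l - i"
  have im: "i + m = l" using il by (simp add: m_def)
  define c where "c a = (if a < l then x a else y (a - l + i))" for a
  have cz: "c a \<in> zvec" if "a < l + m" for a
    using x(2) y(2) that im by (auto simp: c_def primitive_def)
  have nzx: "wedge l x \<noteq> 0" and nzy: "wedge l y \<noteq> 0" using x y by (auto simp: primitive_def)
  have split: "(\<Sum>a<l+m. r a *\<^sub>R c a) = (\<Sum>a<l. r a *\<^sub>R x a) + (\<Sum>b<m. r (l + b) *\<^sub>R y (i + b))" for r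
    by (simp add: sum_lessThan_add c_def add.commute)
  have nz: "wedge (l + m) c \<noteq> 0"
  proof
    assume "wedge (l + m) c = 0"
    then obtain r b where r: "(\<Sum>a<l+m. r a *\<^sub>R c a) = 0" "b < l + m" "r b \<noteq> 0"
      by (rule wedge_zero_dependence)
    obtain p :: "nat \<Rightarrow> int" and b where p: "(\<Sum>a<l+m. of_int (p a) *\<^sub>R c a) = 0" "b < l + m" "p b \<noteq> 0"
      using int_dependence[OF cz r] by metis
    \<comment> \<open>The integral relation is refuted through its \<open>x\<close>-part
      \<open>t\<close>: it is integral and lies in both subspaces, hence in \<open>I\<close>.
      Uniqueness of coordinates over \<open>y\<close>, then over \<open>x\<close>, kills all
      coefficients.\<close>
    define t where "t = (\<Sum>a<l. of_int (p a) *\<^sub>R x a)"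
    have t: "t = - (\<Sum>b<m. of_int (p (l + b)) *\<^sub>R y (i + b))"
      using p(1) unfolding split t_def by (simp add: add_eq_0_iff2)
    have "t \<in> zvec" unfolding t_def using x(2) by (intro zvec_sum) (auto simp: primitive_def)
    moreover have "t \<in> L" unfolding t_def x(3)[symmetric] by (intro span_sum span_scale span_base) auto
    moreover have "t \<in> M" unfolding t y(3)[symmetric]
      by (intro span_neg span_sum span_scale span_base) (use im in auto)
    ultimately have "t \<in> span (w ` {..<i})" unfolding w(2) I_def by (intro span_base) auto
    then obtain s where s: "t = (\<Sum>a<i. s a *\<^sub>R w a)" by (rule span_image_lessThan)
    have yk: "(\<Sum>a<i+m. g a *\<^sub>R y a) = (\<Sum>a<i. g a *\<^sub>R w a) + (\<Sum>b<m. g (i + b) *\<^sub>R y (i + b))" for g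
      by (simp add: sum_lessThan_add y(1))
    have "(\<Sum>a<i+m. (if a < i then s a else 0) *\<^sub>R y a) = (\<Sum>a<i+m. (if a < i then 0 else - of_int (p (l + (a - i)))) *\<^sub>R y a)"
      unfolding yk using s t by (simp add: sum_negf)
    then have "(\<Sum>a<l. (if a < i then s a else 0) *\<^sub>R y a) = (\<Sum>a<l. (if a < i then 0 else - of_int (p (l + (a - i)))) *\<^sub>R y a)"
      unfolding im .
    then have eq: "(if a < i then s a else 0) = (if a < i then 0 else - real_of_int (p (l + (a - i))))" if "a < l" for a
      using wedge_nonzero_coeffs_unique[OF nzy, of "\<lambda>a. if a < i then s a else 0"
          "\<lambda>a. if a < i then 0 else - real_of_int (p (l + (a - i)))" a] that by simp
    have hi: "p (l + b) = 0" if "b < m" for b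
      using eq[of "i + b"] that im by simp
    then have "t = 0" unfolding t by simp
    then have "(\<Sum>a<l. of_int (p a) *\<^sub>R x a) = (\<Sum>a<l. 0 *\<^sub>R x a)" unfolding t_def by simp
    then have lo: "p a = 0" if "a < l" for a using wedge_nonzero_coeffs_unique[OF nzx, of "\<lambda>a. of_int (p a)" "\<lambda>a. 0" a] that by simp
    have "b - l < m" if "\<not> b < l" using p(2) that by linarith
    with lo[of b] hi[of "b - l"] p(3) show False by (cases "b < l") auto
  qed
  define U where "U = span (c ` {..<l+m})"
  have ratU: "rational zvec U" unfolding U_def by (rule rational_span) (rule cz)
  have dimU: "dim U = l + m" unfolding U_def by (rule dim_span_wedge[OF nz])
  obtain n :: int where n: "wedge (l + m) c = of_int n *\<^sub>R lat_wedge U" "n \<noteq> 0"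
    using wedge_int_multiple[OF nz cz U_def] by metis
  have sgn: "norm (ext_map l A (lat_wedge K)) = norm (ext_map l A (wedge l v))"
    if K: "rational zvec K" "dim K = l" "primitive l v" "span (v ` {..<l}) = K"
    for K v and A :: "real^'n^'n"
  proof -
    obtain v' where v': "primitive l v'" "span (v' ` {..<l}) = K" "lat_wedge K = wedge l v'"
      using lat_wedge_eq[OF K(1)] K(2) by metis
    have "zbasis l v' (K \<inter> zvec)" "zbasis l v (K \<inter> zvec)"
      using zbasis_iff_primitive[of K v' l] zbasis_iff_primitive[of K v l] v' K by auto
    then have "wedge l v' = wedge l v \<or> wedge l v' = - wedge l v" by (rule zbasis_wedge_unique)
    then show ?thesis using v'(3) linear_neg[OF linear_ext_map] by (metis norm_minus_cancel)
  qed
  have ineq: "norm (ext_map (l + m) A (lat_wedge U)) * norm (ext_map (l - m) A (lat_wedge I))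
        \<le> norm (ext_map l A (lat_wedge L)) * norm (ext_map l A (lat_wedge M))" for A
  proof -
    have lm: "l - m = i" using im by simp
    \<comment> \<open>The vectors \<open>c\<close> may generate only a finite-index sublattice of
      the integer points of \<open>U\<close>, which makes their wedge product longer, never
      shorter.\<close>
    have "norm (ext_map (l + m) A (lat_wedge U)) \<le> \<bar>real_of_int n\<bar> * norm (ext_map (l + m) A (lat_wedge U))"
      using n(2) by (intro mult_le_cancel_right1[THEN iffD2]) auto
    also have "\<dots> = norm (wedge (l + m) (\<lambda>a. A *v c a))"
      using n(1) by (simp flip: ext_map_wedge add: linear_scale[OF linear_ext_map])
    also have "wedge (l + m) (\<lambda>a. A *v c a) = wedge (l + m) (\<lambda>a. if a < l then A *v x a else A *v y (a - l + i))"
      by (rule wedge_cong) (simp add: c_def)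
    finally have "norm (ext_map (l + m) A (lat_wedge U)) * norm (ext_map (l - m) A (lat_wedge I))
       \<le> norm (wedge (l + m) (\<lambda>a. if a < l then A *v x a else A *v y (a - l + i))) * norm (wedge i (\<lambda>a. A *v x a))"
      unfolding lm w(3) ext_map_wedge
      by (intro mult_mono) (auto simp: x(1) intro!: eq_refl arg_cong[of _ _ norm] wedge_cong)
    also have "\<dots> \<le> norm (wedge l (\<lambda>a. A *v x a)) * norm (wedge (i + m) (\<lambda>a. A *v y a))"
      using il x(1) y(1) by (intro fischer_inequality) auto
    also have "\<dots> = norm (ext_map l A (lat_wedge L)) * norm (ext_map l A (lat_wedge M))"
      unfolding im using sgn[OF L dims(1) x(2,3)] sgn[OF M dims(2) y(2,3)] by (simp add: ext_map_wedge)
    finally show ?thesis .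
  qed
  show ?thesis
    by (rule that[OF ratI ratU _ _ _ _ ineq]) (use il' dimU im in \<open>auto simp: i_def m_def\<close>)
qed

section \<open>Multiscale induction\<close>

text \<open>Cauchy-Schwarz for upper bounds \<open>X\<close> and \<open>Y\<close> of the two
  integrals: in the weighted arithmetic-geometric inequality the weight
  \<open>c = sqrt (Y / X)\<close> makes both terms contribute the same amount.\<close>

lemma nn_integral_geometric_mean:
  assumes u: "u \<in> borel_measurable M" "\<And>x. 0 \<le> u x" and v: "v \<in> borel_measurable M" "\<And>x. 0 \<le> v x"
    and X: "(\<integral>\<^sup>+x. ennreal (u x powr \<beta>) \<partial>M) \<le> ennreal X" "0 < X"
    and Y: "(\<integral>\<^sup>+x. ennreal (v x powr \<beta>) \<partial>M) \<le> ennreal Y" "0 < Y"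
  shows "(\<integral>\<^sup>+x. ennreal ((u x * v x) powr (\<beta>/2)) \<partial>M) \<le> ennreal (sqrt (X * Y))"
proof -
  define c where "c = sqrt (Y / X)"
  have c: "0 < c" using X Y by (simp add: c_def)
  have pw: "(u x * v x) powr (\<beta>/2) \<le> c / 2 * u x powr \<beta> + 1 / (2 * c) * v x powr \<beta>" for x
  proof -
    let ?p = "u x powr (\<beta>/2)" and ?q = "v x powr (\<beta>/2)"
    have sq: "u x powr \<beta> = ?p\<^sup>2" "v x powr \<beta> = ?q\<^sup>2"
      by (simp_all add: power2_eq_square powr_add[symmetric])
    have "0 \<le> (c * ?p - ?q)\<^sup>2" by simp
    then have "2 * c * (?p * ?q) \<le> c\<^sup>2 * ?p\<^sup>2 + ?q\<^sup>2"
      by (simp add: power2_diff power_mult_distrib algebra_simps)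
    then have "?p * ?q \<le> (c\<^sup>2 * ?p\<^sup>2 + ?q\<^sup>2) / (2 * c)" using c by (simp add: field_simps)
    also have "\<dots> = c / 2 * ?p\<^sup>2 + 1 / (2 * c) * ?q\<^sup>2" using c by (simp add: field_simps power2_eq_square)
    finally show ?thesis unfolding sq using u(2) v(2) by (simp add: powr_mult)
  qed
  have "(\<integral>\<^sup>+x. ennreal ((u x * v x) powr (\<beta>/2)) \<partial>M)
      \<le> (\<integral>\<^sup>+x. ennreal (c / 2) * ennreal (u x powr \<beta>) + ennreal (1 / (2 * c)) * ennreal (v x powr \<beta>) \<partial>M)"
    using c pw by (intro nn_integral_mono) (simp flip: ennreal_mult ennreal_plus add: ennreal_leI)
  also have "\<dots> = ennreal (c / 2) * (\<integral>\<^sup>+x. ennreal (u x powr \<beta>) \<partial>M) + ennreal (1 / (2 * c)) * (\<integral>\<^sup>+x. ennreal (v x powr \<beta>) \<partial>M)"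
    using u v by (simp add: nn_integral_add nn_integral_cmult)
  also have "\<dots> \<le> ennreal (c / 2) * ennreal X + ennreal (1 / (2 * c)) * ennreal Y"
    using X Y by (intro add_mono mult_left_mono) auto
  also have "\<dots> = ennreal (c / 2 * X + 1 / (2 * c) * Y)"
    using c X Y by (simp flip: ennreal_mult ennreal_plus)
  also have "c / 2 * X + 1 / (2 * c) * Y = sqrt (X * Y)"
  proof -
    have "c * X = sqrt (X * Y)" "1 / c * Y = sqrt (X * Y)"
      using X Y by (simp_all add: c_def real_sqrt_divide real_sqrt_mult field_simps)
    then show ?thesis by (simp add: field_simps)
  qed
  finally show ?thesis .
qed

text \<open>\<open>f L n x\<close> stands for the inverse covolume of \<open>L\<close> after applying \<open>diag (2^n) (2^-n)\<close> and the
  unipotent with parameter \<open>x\<close>, so that the natural scale in \<open>x\<close> at time \<open>n\<close> is \<open>4^-n\<close>, and \<open>al l\<close>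
  is the supremum over subspaces of dimension \<open>l\<close>.\<close>

locale multiscale =
  fixes d :: nat and \<beta> K a :: real and Rat :: "nat \<Rightarrow> 'i set"
    and f :: "'i \<Rightarrow> nat \<Rightarrow> real \<Rightarrow> real" and al :: "nat \<Rightarrow> nat \<Rightarrow> real \<Rightarrow> real"
  assumes d: "1 \<le> d" and \<beta>: "0 < \<beta>" "2 < \<beta> * real d" and K: "1 \<le> K" and a: "0 < a"
    and pos: "\<And>l L n x. L \<in> Rat l \<Longrightarrow> 0 < f L n x"
    and le: "\<And>l L n x. L \<in> Rat l \<Longrightarrow> f L n x \<le> al l n x"
    and least: "\<And>l n x c. l \<le> 2 * d \<Longrightarrow> (\<And>L. L \<in> Rat l \<Longrightarrow> f L n x \<le> c) \<Longrightarrow> al l n x \<le> c"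
    and nonneg: "\<And>l n x. l \<le> 2 * d \<Longrightarrow> 0 \<le> al l n x"
    and meas_f: "\<And>l L n. L \<in> Rat l \<Longrightarrow> f L n \<in> borel_measurable borel"
    and meas_al: "\<And>l n. l \<le> 2 * d \<Longrightarrow> al l n \<in> borel_measurable borel"
    and distort: "\<And>l L n x x'. L \<in> Rat l \<Longrightarrow> \<bar>x - x'\<bar> \<le> (1/4)^n \<Longrightarrow> f L n x' \<le> K * f L n x"
    and step_up: "\<And>l L n x. L \<in> Rat l \<Longrightarrow> f L (Suc n) x \<le> K * f L n x"
    and single: "\<And>l L s m x. 1 \<le> l \<Longrightarrow> l < 2 * d \<Longrightarrow> L \<in> Rat l \<Longrightarrow>
      (\<integral>\<^sup>+y\<in>{x..<x + (1/4)^s}. ennreal (f L (s + m) y powr \<beta>) \<partial>lborel)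
      \<le> ennreal (K * (1/4)^s * 2 powr ((\<beta> - 2 / d) * (real l * (2 * d - real l) / d) * m) * f L s x powr \<beta>)"
    and sub: "\<And>l L M n x. L \<in> Rat l \<Longrightarrow> M \<in> Rat l \<Longrightarrow> L \<noteq> M \<Longrightarrow>
      \<exists>j. 1 \<le> j \<and> j \<le> l \<and> l + j \<le> 2 * d \<and> f L n x * f M n x \<le> al (l - j) n x * al (l + j) n x"
    and init: "\<And>l x. l \<le> 2 * d \<Longrightarrow> 0 \<le> x \<Longrightarrow> x < 1 \<Longrightarrow> al l 0 x \<le> K * a"
    and ends: "\<And>n x. al 0 n x \<le> K * a" "\<And>n x. al (2 * d) n x \<le> K * a"
begin

text \<open>\<open>born l s i L\<close>: at scale \<open>s\<close>, somewhere on the cell \<open>i\<close>, the subspace \<open>L\<close> starts to dominate the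
  others of its dimension. Isolated subspaces being unique on a cell, the supremum over all \<open>L\<close> is
  bounded by a sum of the functions \<open>T\<close>, each of which comes from a single subspace.\<close>

definition w :: "nat \<Rightarrow> real" where "w l = real l * (2 * d - real l) / d"
definition \<theta> :: real where "\<theta> = \<beta> - 2 / d"
definition js :: "nat \<Rightarrow> nat set" where "js l = {j. 1 \<le> j \<and> j \<le> l \<and> l + j \<le> 2 * d}"
text \<open>What a non-isolated subspace is charged to. The exponent \<beta>/2 turns the products
  from \<open>sub\<close> into geometric means raised to \<beta>, and the sum stands in for a
  maximum over \<open>j\<close>.\<close>

definition H :: "nat \<Rightarrow> nat \<Rightarrow> real \<Rightarrow> real" where
  "H l n x = (\<Sum>j\<in>js l. (al (l - j) n x * al (l + j) n x) powr (\<beta>/2))"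
text \<open>The margin \<open>K\<close> is the distortion constant of a cell, so that isolation at
  one point excludes isolation of another subspace anywhere in the cell.\<close>

definition isolated :: "nat \<Rightarrow> 'i \<Rightarrow> nat \<Rightarrow> real \<Rightarrow> bool" where
  "isolated l L n x \<longleftrightarrow> (\<forall>j\<in>js l. K * (al (l - j) n x * al (l + j) n x) < (f L n x)\<^sup>2)"
definition cell :: "nat \<Rightarrow> nat \<Rightarrow> real set" where
  "cell s i = {real i * (1/4)^s ..< real i * (1/4)^s + (1/4)^s}"
definition born :: "nat \<Rightarrow> nat \<Rightarrow> nat \<Rightarrow> 'i \<Rightarrow> bool" where
  "born l s i L \<longleftrightarrow> L \<in> Rat l \<and> (\<exists>x\<in>cell s i. 0 \<le> x \<and> x < 1 \<and> isolated l L s x \<and> (s = 0 \<or> \<not> isolated l L (s - 1) x))"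
definition T :: "nat \<Rightarrow> nat \<Rightarrow> nat \<Rightarrow> nat \<Rightarrow> real \<Rightarrow> real" where
  "T l s i n x = (if \<exists>L. born l s i L then f (SOME L. born l s i L) n x powr \<beta> else 0)"

lemma fin_js: "finite (js l)" "card (js l) \<le> 2 * d"
proof -
  have "js l \<subseteq> {1..2*d}" by (auto simp: js_def)
  then show "finite (js l)" "card (js l) \<le> 2 * d"
    using card_mono[of "{1..2*d}" "js l"] by (auto intro: finite_subset)
qed

lemma \<theta>: "0 < \<theta>" using \<beta> d by (simp add: \<theta>_def field_simps)

lemma w_nonneg: "l \<le> 2 * d \<Longrightarrow> 0 \<le> w l" by (simp add: w_def)

text \<open>\<open>w\<close> is quadratic with leading coefficient \<open>- 1 / d\<close>, so its
  midpoint defect is \<open>j^2 / d\<close>; this is the whole gain of the induction.\<close>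

lemma w_mid:
  assumes "j \<in> js l" shows "(w (l - j) + w (l + j)) / 2 \<le> w l - 1 / d"
proof -
  have "(w (l - j) + w (l + j)) / 2 = w l - (real j)\<^sup>2 / d"
    using assms d by (simp add: w_def js_def of_nat_diff field_simps power2_eq_square)
  moreover have "1 \<le> (real j)\<^sup>2" using assms by (simp add: js_def)
  ultimately show ?thesis using d by (simp add: divide_right_mono)
qed

lemma al_distort:
  assumes "l \<le> 2 * d" "\<bar>x - x'\<bar> \<le> (1/4)^n"
  shows "al l n x' \<le> K * al l n x"
proof (rule least[OF assms(1)])
  fix L assume L: "L \<in> Rat l"
  have "f L n x' \<le> K * f L n x" using distort[OF L assms(2)] .
  also have "\<dots> \<le> K * al l n x" using le[OF L] K by (intro mult_left_mono) auto
  finally show "f L n x' \<le> K * al l n x" .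
qed

lemma H_distort:
  assumes "\<bar>x - x'\<bar> \<le> (1/4)^n"
  shows "H l n x' \<le> K powr \<beta> * H l n x"
  unfolding H_def sum_distrib_left
proof (rule sum_mono)
  fix j assume j: "j \<in> js l"
  then have j': "l - j \<le> 2 * d" "l + j \<le> 2 * d" by (auto simp: js_def)
  have "al (l - j) n x' * al (l + j) n x' \<le> (K * al (l - j) n x) * (K * al (l + j) n x)"
    using K nonneg[OF j'(1)] nonneg[OF j'(2)] al_distort[OF j'(1) assms] al_distort[OF j'(2) assms]
    by (intro mult_mono) auto
  then have "(al (l - j) n x' * al (l + j) n x') powr (\<beta>/2) \<le> ((K * K) * (al (l - j) n x * al (l + j) n x)) powr (\<beta>/2)"
    using \<beta> nonneg[OF j'(1)] nonneg[OF j'(2)] by (intro powr_mono2) (auto simp: mult_ac)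
  also have "\<dots> = K powr \<beta> * (al (l - j) n x * al (l + j) n x) powr (\<beta>/2)"
    using K nonneg[OF j'(1)] nonneg[OF j'(2)] by (simp add: powr_mult powr_add[symmetric])
  finally show "(al (l - j) n x' * al (l + j) n x') powr (\<beta>/2) \<le> K powr \<beta> * (al (l - j) n x * al (l + j) n x) powr (\<beta>/2)" .
qed

lemma not_isolated_bound:
  assumes L: "L \<in> Rat l" and "\<not> isolated l L n x"
  shows "f L n x powr \<beta> \<le> K powr (\<beta>/2) * H l n x"
proof -
  obtain j where j: "j \<in> js l" "(f L n x)\<^sup>2 \<le> K * (al (l - j) n x * al (l + j) n x)"
    using assms(2) by (auto simp: isolated_def not_less)
  then have j': "l - j \<le> 2 * d" "l + j \<le> 2 * d" by (auto simp: js_def)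
  have "f L n x powr \<beta> = ((f L n x)\<^sup>2) powr (\<beta>/2)"
    using pos[OF L, of n x] by (simp add: powr_powr flip: powr_numeral)
  also have "\<dots> \<le> (K * (al (l - j) n x * al (l + j) n x)) powr (\<beta>/2)"
    using j(2) \<beta> by (intro powr_mono2) auto
  also have "\<dots> = K powr (\<beta>/2) * (al (l - j) n x * al (l + j) n x) powr (\<beta>/2)"
    using K nonneg[OF j'(1)] nonneg[OF j'(2)] by (simp add: powr_mult)
  also have "\<dots> \<le> K powr (\<beta>/2) * H l n x"
    unfolding H_def using j(1) fin_js by (intro mult_left_mono member_le_sum) auto
  finally show ?thesis .
qed

text \<open>Two isolated subspaces would close a strict cycle: \<open>f L\<close> at
  \<open>x\<close> is at most \<open>K\<close> times \<open>f L\<close> at \<open>y\<close>, which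
  is below \<open>f M\<close> at \<open>y\<close>, which is at most \<open>K\<close> times
  \<open>f M\<close> at \<open>x\<close>, which is below \<open>f L\<close> at
  \<open>x\<close>.\<close>

lemma isolated_unique:
  assumes L: "L \<in> Rat l" "isolated l L n x" and M: "M \<in> Rat l" "isolated l M n y"
    and xy: "\<bar>x - y\<bar> \<le> (1/4)^n"
  shows "L = M"
proof (rule ccontr)
  assume ne: "L \<noteq> M"
  have *: "K * f M n x < f L n x" if LM: "L \<in> Rat l" "M \<in> Rat l" "L \<noteq> M" "isolated l L n x" for L M x
  proof -
    obtain j where "j \<in> js l" "f L n x * f M n x \<le> al (l - j) n x * al (l + j) n x"
      using sub[OF LM(1-3), of n x] by (auto simp: js_def)
    then have "K * (f L n x * f M n x) \<le> K * (al (l - j) n x * al (l + j) n x)" "K * (al (l - j) n x * al (l + j) n x) < (f L n x)\<^sup>2"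
      using LM(4) K by (auto simp: isolated_def intro!: mult_left_mono)
    then have "f L n x * (K * f M n x) < f L n x * f L n x" by (simp add: power2_eq_square mult_ac)
    then show ?thesis using pos[OF LM(1), of n x] by simp
  qed
  have "K * f M n x < f L n x" "K * f L n y < f M n y" using * L M ne by auto
  moreover have "f L n x \<le> K * f L n y" "f M n y \<le> K * f M n x"
    using distort[OF L(1), of y x] distort[OF M(1), of x y] xy by (auto simp: abs_minus_commute)
  ultimately show False by linarith
qed

lemma cell_disjoint_cover:
  assumes "0 \<le> x" "x < 1"
  obtains i where "i < 4^s" "x \<in> cell s i"
proof
  let ?i = "nat \<lfloor>x * 4^s\<rfloor>"
  have nn: "0 \<le> x * 4^s" using assms by simp
  have i: "real ?i \<le> x * 4^s" "x * 4^s < real ?i + 1" using nn by (simp, linarith)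
  then show "x \<in> cell s ?i" by (simp add: cell_def power_one_over field_simps)
  have "real ?i < 4^s" by (rule le_less_trans[OF i(1)]) (use mult_strict_right_mono[OF assms(2), of "4^s"] in simp)
  then show "?i < 4^s" by (metis of_nat_less_iff of_nat_numeral of_nat_power)
qed

lemma cell_dist: "x \<in> cell s i \<Longrightarrow> y \<in> cell s i \<Longrightarrow> \<bar>x - y\<bar> \<le> (1/4)^s"
  by (auto simp: cell_def abs_le_iff)

lemma born_SOME: "born l s i L \<Longrightarrow> (SOME L. born l s i L) = L"
  using isolated_unique cell_dist by (intro some_equality) (auto simp: born_def)

lemma T_eq: "born l s i L \<Longrightarrow> T l s i n x = f L n x powr \<beta>"
  using born_SOME[of l s i L] by (auto simp: T_def)

lemma T_nonneg: "0 \<le> T l s i n x" by (simp add: T_def)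

lemma T_meas: "T l s i n \<in> borel_measurable borel"
proof (cases "\<exists>L. born l s i L")
  case True
  then obtain L where L: "born l s i L" by auto
  then have [measurable]: "f L n \<in> borel_measurable borel" using meas_f by (auto simp: born_def)
  have "T l s i n = (\<lambda>x. f L n x powr \<beta>)" using T_eq[OF L] by auto
  then show ?thesis by simp
next
  case False
  then have "T l s i n = (\<lambda>_. 0)" by (auto simp: T_def)
  then show ?thesis by simp
qed

text \<open>A subspace not isolated at scale \<open>n\<close> is charged to \<open>H\<close>.
  Otherwise the run of isolated scales ending at \<open>n\<close> starts at some \<open>s\<close>,
  where the subspace is born on the cell of \<open>x\<close>, and \<open>T\<close> of this cell is
  its own function. As \<open>s\<close> depends on the subspace, all scales and cells are
  summed.\<close>

lemma pointwise:
  assumes L: "L \<in> Rat l" and x: "0 \<le> x" "x < 1"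
  shows "f L (Suc n) x powr \<beta> \<le> (\<Sum>s\<le>n. \<Sum>i<4^s. indicator (cell s i) x * T l s i (Suc n) x)
           + K powr (2 * \<beta>) * H l n x" (is "_ \<le> ?S + _")
proof (cases "isolated l L n x")
  case False
  have "f L (Suc n) x powr \<beta> \<le> (K * f L n x) powr \<beta>"
    using \<beta> less_imp_le[OF pos[OF L]] step_up[OF L] by (intro powr_mono2) auto
  also have "\<dots> = K powr \<beta> * f L n x powr \<beta>" using K less_imp_le[OF pos[OF L]] by (simp add: powr_mult)
  also have "\<dots> \<le> K powr \<beta> * (K powr (\<beta>/2) * H l n x)"
    using not_isolated_bound[OF L False] by (intro mult_left_mono) auto
  also have "\<dots> \<le> K powr (2 * \<beta>) * H l n x"
  proof -
    have "0 \<le> H l n x" by (auto simp: H_def intro: sum_nonneg)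
    moreover have "K powr \<beta> * K powr (\<beta>/2) \<le> K powr (2 * \<beta>)"
      unfolding powr_add[symmetric] using K \<beta> by (intro powr_mono) auto
    ultimately show ?thesis by (metis mult.assoc mult_right_mono)
  qed
  also have "\<dots> \<le> ?S + K powr (2 * \<beta>) * H l n x"
    by (auto intro!: sum_nonneg simp: T_nonneg)
  finally show ?thesis .
next
  case True
  define s where "s = (LEAST s. s \<le> n \<and> (\<forall>r. s \<le> r \<and> r \<le> n \<longrightarrow> isolated l L r x))"
  have s: "s \<le> n \<and> (\<forall>r. s \<le> r \<and> r \<le> n \<longrightarrow> isolated l L r x)"
    unfolding s_def by (rule LeastI[of _ n]) (use True in auto)
  have bd: "s = 0 \<or> \<not> isolated l L (s - 1) x"
  proof (rule ccontr)
    assume "\<not> ?thesis"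
    then have "s - 1 \<le> n \<and> (\<forall>r. s - 1 \<le> r \<and> r \<le> n \<longrightarrow> isolated l L r x)" "s > 0"
    proof -
      from \<open>\<not> _\<close> have ns: "0 < s" "isolated l L (s - 1) x" by auto
      have "isolated l L r x" if "s - 1 \<le> r" "r \<le> n" for r
        using ns s that by (cases "r = s - 1") auto
      then show "s - 1 \<le> n \<and> (\<forall>r. s - 1 \<le> r \<and> r \<le> n \<longrightarrow> isolated l L r x)" "s > 0"
        using s ns by auto
    qed
    then show False using Least_le[of "\<lambda>s. s \<le> n \<and> (\<forall>r. s \<le> r \<and> r \<le> n \<longrightarrow> isolated l L r x)" "s - 1"]
      unfolding s_def[symmetric] by auto
  qed
  obtain i where i: "i < 4^s" "x \<in> cell s i" using cell_disjoint_cover[OF x] .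
  have b: "born l s i L" using L i x s bd by (auto simp: born_def)
  have "f L (Suc n) x powr \<beta> = indicator (cell s i) x * T l s i (Suc n) x" using i T_eq[OF b] by simp
  also have "\<dots> \<le> (\<Sum>i<4^s. indicator (cell s i) x * T l s i (Suc n) x)"
    using i by (intro member_le_sum) (auto simp: T_nonneg)
  also have "\<dots> \<le> ?S" using s
    by (intro member_le_sum[of s "{..n}" "\<lambda>s. \<Sum>i<4^s. indicator (cell s i) x * T l s i (Suc n) x"]) (auto intro!: sum_nonneg simp: T_nonneg)
  also have "\<dots> \<le> ?S + K powr (2 * \<beta>) * H l n x" by (auto simp: H_def intro!: mult_nonneg_nonneg sum_nonneg)
  finally show ?thesis .
qed

text \<open>The bound does not depend on the subspace, so it passes to the supremum; the root
  \<open>1/\<beta>\<close> is taken because \<open>least\<close> speaks of \<open>al\<close>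
  itself.\<close>

lemma al_pointwise:
  assumes l: "l \<le> 2 * d" and x: "0 \<le> x" "x < 1"
  shows "al l (Suc n) x powr \<beta> \<le> (\<Sum>s\<le>n. \<Sum>i<4^s. indicator (cell s i) x * T l s i (Suc n) x)
           + K powr (2 * \<beta>) * H l n x" (is "_ \<le> ?R")
proof -
  have R0: "0 \<le> ?R" by (auto simp: H_def T_nonneg intro!: add_nonneg_nonneg sum_nonneg mult_nonneg_nonneg)
  have "al l (Suc n) x \<le> ?R powr (1/\<beta>)"
  proof (rule least[OF l])
    fix L assume L: "L \<in> Rat l"
    have "f L (Suc n) x = (f L (Suc n) x powr \<beta>) powr (1/\<beta>)"
      using pos[OF L, of "Suc n" x] \<beta> by (simp add: powr_powr)
    also have "\<dots> \<le> ?R powr (1/\<beta>)" using pointwise[OF L x] \<beta> by (intro powr_mono2) auto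
    finally show "f L (Suc n) x \<le> ?R powr (1/\<beta>)" .
  qed
  then have "al l (Suc n) x powr \<beta> \<le> (?R powr (1/\<beta>)) powr \<beta>"
    using nonneg[OF l] \<beta> by (intro powr_mono2) auto
  also have "\<dots> = ?R" using R0 \<beta> by (simp add: powr_powr)
  finally show ?thesis .
qed

lemma cell_iff: "i < 4^s \<Longrightarrow> x \<in> cell s i \<longleftrightarrow> 0 \<le> x \<and> x < 1 \<and> i = nat \<lfloor>x * 4^s\<rfloor>"
proof -
  assume i: "i < 4^s"
  have *: "x \<in> cell s i \<longleftrightarrow> real i \<le> x * 4^s \<and> x * 4^s < real i + 1"
    by (simp add: cell_def power_one_over field_simps)
  show ?thesis
  proof
    assume x: "x \<in> cell s i"
    have "real i + 1 \<le> 4^s" using i by (metis Suc_leI of_nat_Suc of_nat_le_iff of_nat_numeral of_nat_power add.commute)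
    then have "x * 4^s < 1 * 4^s" "0 \<le> x * 4^s" using x unfolding * by linarith+
    moreover have "\<not> (4::real)^s \<le> 0" by (simp add: not_le)
    ultimately have "0 \<le> x" "x < 1" by (simp_all add: zero_le_mult_iff)
    moreover have "\<lfloor>x * 4^s\<rfloor> = int i" using x unfolding * by (intro floor_unique) auto
    ultimately show "0 \<le> x \<and> x < 1 \<and> i = nat \<lfloor>x * 4^s\<rfloor>" by simp
  next
    assume x: "0 \<le> x \<and> x < 1 \<and> i = nat \<lfloor>x * 4^s\<rfloor>"
    then have nn: "0 \<le> x * 4^s" by simp
    have "real (nat \<lfloor>x * 4^s\<rfloor>) \<le> x * 4^s" "x * 4^s < real (nat \<lfloor>x * 4^s\<rfloor>) + 1" using nn by (simp, linarith)
    then show "x \<in> cell s i" unfolding * using x by blast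
  qed
qed

lemma sum_indicator_cell: "(\<Sum>i<4^s. indicator (cell s i) x) = (indicator {0..<1} x :: real)"
proof (cases "0 \<le> x \<and> x < 1")
  case True
  obtain i where i: "i < 4^s" "x \<in> cell s i" using cell_disjoint_cover True by blast
  have "(\<Sum>k<4^s. indicator (cell s k) x) = (\<Sum>k<4^s. if k = i then 1 else 0 :: real)"
    by (rule sum.cong) (use i in \<open>auto simp: cell_iff indicator_def\<close>)
  then show ?thesis using i True by simp
next
  case False
  then have "(\<Sum>k<4^s. indicator (cell s k) x) = (\<Sum>k<(4::nat)^s. 0 :: real)"
    by (intro sum.cong) (auto simp: cell_iff indicator_def)
  then show ?thesis using False by (auto simp: indicator_def)
qed

section \<open>Integrals over cells\<close>

lemma cell_meas [measurable]: "cell s i \<in> sets borel" by (simp add: cell_def)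

lemma emeasure_cell: "emeasure lborel (cell s i) = ennreal ((1/4)^s)"
  by (simp add: cell_def)

lemma H_nonneg: "0 \<le> H l n x" by (auto simp: H_def intro: sum_nonneg)

lemma H_meas: assumes "l \<le> 2 * d" shows "H l n \<in> borel_measurable borel"
proof -
  have "(\<lambda>x. (al (l - j) n x * al (l + j) n x) powr (\<beta>/2)) \<in> borel_measurable borel" if "j \<in> js l" for j
  proof -
    have [measurable]: "al (l - j) n \<in> borel_measurable borel" "al (l + j) n \<in> borel_measurable borel"
      using that assms by (auto simp: js_def intro!: meas_al)
    show ?thesis by measurable
  qed
  then have "(\<lambda>x. \<Sum>j\<in>js l. (al (l - j) n x * al (l + j) n x) powr (\<beta>/2)) \<in> borel_measurable borel"
    by (rule borel_measurable_sum)
  then show ?thesis by (simp add: H_def[abs_def])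
qed

text \<open>\<open>single\<close> starts at the left end of the cell; distortion moves the starting
  value to the point \<open>x\<close>, at the price \<open>K powr \<beta>\<close>.\<close>

lemma T_cell:
  assumes l: "1 \<le> l" "l < 2 * d" and b: "born l s i L" and x: "x \<in> cell s i" "isolated l L s x"
  shows "(\<integral>\<^sup>+y. ennreal (indicator (cell s i) y * T l s i (s + m) y) \<partial>lborel)
    \<le> ennreal (K powr (1 + \<beta>) * 2 powr (\<theta> * w l * m) * ((1/4)^s * f L s x powr \<beta>))"
proof -
  let ?x0 = "real i * (1/4)^s"
  have L: "L \<in> Rat l" using b by (simp add: born_def)
  have "(\<integral>\<^sup>+y. ennreal (indicator (cell s i) y * T l s i (s + m) y) \<partial>lborel)
     = (\<integral>\<^sup>+y\<in>{?x0..<?x0 + (1/4)^s}. ennreal (f L (s + m) y powr \<beta>) \<partial>lborel)"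
    by (intro nn_integral_cong) (auto simp: T_eq[OF b] cell_def split: split_indicator)
  also have "\<dots> \<le> ennreal (K * (1/4)^s * 2 powr (\<theta> * w l * m) * f L s ?x0 powr \<beta>)"
    using single[OF l L, where x = ?x0 and s = s and m = m] by (simp add: \<theta>_def w_def)
  also have "\<dots> \<le> ennreal (K * (1/4)^s * 2 powr (\<theta> * w l * m) * (K powr \<beta> * f L s x powr \<beta>))"
  proof (intro ennreal_leI mult_left_mono)
    have "f L s ?x0 \<le> K * f L s x"
      using x(1) by (intro distort[OF L]) (auto simp: cell_def abs_le_iff)
    then have "f L s ?x0 powr \<beta> \<le> (K * f L s x) powr \<beta>"
      using \<beta> less_imp_le[OF pos[OF L]] by (intro powr_mono2) auto
    then show "f L s ?x0 powr \<beta> \<le> K powr \<beta> * f L s x powr \<beta>"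
      using K less_imp_le[OF pos[OF L]] by (simp add: powr_mult)
    show "0 \<le> K * (1/4)^s * 2 powr (\<theta> * w l * m)" using K by simp
  qed
  also have "\<dots> = ennreal (K powr (1 + \<beta>) * 2 powr (\<theta> * w l * m) * ((1/4)^s * f L s x powr \<beta>))"
    using K by (simp add: powr_add mult_ac)
  finally show ?thesis .
qed

lemma T_integral_0:
  assumes l: "1 \<le> l" "l < 2 * d"
  shows "(\<integral>\<^sup>+y. ennreal (indicator (cell 0 0) y * T l 0 0 m y) \<partial>lborel)
    \<le> ennreal (K powr (1 + 4 * \<beta>) * (a powr \<beta> * 2 powr (\<theta> * w l * m)))"
proof (cases "\<exists>L. born l 0 0 L")
  case False
  then show ?thesis by (simp add: T_def)
next
  case True
  then obtain L x where b: "born l 0 0 L" and x: "x \<in> cell 0 0" "0 \<le> x" "x < 1" "isolated l L 0 x"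
    by (auto simp: born_def)
  then have L: "L \<in> Rat l" by (simp add: born_def)
  have "f L 0 x \<le> K * a" using le[OF L] init[of l x] l x by (metis less_imp_le order_trans)
  then have "f L 0 x powr \<beta> \<le> (K * a) powr \<beta>" using \<beta> less_imp_le[OF pos[OF L]] by (intro powr_mono2) auto
  then have fa: "f L 0 x powr \<beta> \<le> K powr \<beta> * a powr \<beta>" using K a by (simp add: powr_mult)
  have "(\<integral>\<^sup>+y. ennreal (indicator (cell 0 0) y * T l 0 0 m y) \<partial>lborel)
    \<le> ennreal (K powr (1 + \<beta>) * 2 powr (\<theta> * w l * m) * f L 0 x powr \<beta>)"
    using T_cell[OF l b x(1,4), of m] by simp
  also have "\<dots> \<le> ennreal (K powr (1 + \<beta>) * 2 powr (\<theta> * w l * m) * (K powr \<beta> * a powr \<beta>))"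
    using fa by (intro ennreal_leI mult_left_mono) auto
  also have "\<dots> = ennreal (K powr (1 + 2 * \<beta>) * (a powr \<beta> * 2 powr (\<theta> * w l * m)))"
    using K powr_add[of K "1 + \<beta>" \<beta>] by (simp add: mult_ac add_ac)
  also have "\<dots> \<le> ennreal (K powr (1 + 4 * \<beta>) * (a powr \<beta> * 2 powr (\<theta> * w l * m)))"
    using K \<beta> by (intro ennreal_leI mult_right_mono powr_mono) auto
  finally show ?thesis .
qed

text \<open>At birth the subspace is still non-isolated one scale earlier at a point of the cell, so
  its size there is controlled by \<open>H\<close>. Since \<open>H\<close> varies by a bounded
  factor on the cell, its value at the birth point can be replaced by its mean over the
  cell.\<close>

lemma T_integral_Suc:
  assumes l: "1 \<le> l" "l < 2 * d"
  shows "(\<integral>\<^sup>+y. ennreal (indicator (cell (Suc s) i) y * T l (Suc s) i (Suc s + m) y) \<partial>lborel)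
    \<le> ennreal (K powr (1 + 4 * \<beta>) * 2 powr (\<theta> * w l * m)) * (\<integral>\<^sup>+y. ennreal (indicator (cell (Suc s) i) y * H l s y) \<partial>lborel)"
proof (cases "\<exists>L. born l (Suc s) i L")
  case False
  then show ?thesis by (simp add: T_def)
next
  case True
  then obtain L x where b: "born l (Suc s) i L" and x: "x \<in> cell (Suc s) i" "isolated l L (Suc s) x" "\<not> isolated l L s x"
    by (auto simp: born_def)
  then have L: "L \<in> Rat l" by (simp add: born_def)
  let ?F = "f L (Suc s) x powr \<beta>" and ?C = "K powr (1 + \<beta>) * 2 powr (\<theta> * w l * m)"
  have Hm [measurable]: "H l s \<in> borel_measurable borel" using l by (intro H_meas) auto
  have FH: "?F \<le> K powr (2 * \<beta>) * K powr (\<beta>/2) * H l s y" if y: "y \<in> cell (Suc s) i" for y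
  proof -
    have "?F \<le> (K * f L s x) powr \<beta>"
      using \<beta> less_imp_le[OF pos[OF L]] step_up[OF L] by (intro powr_mono2) auto
    also have "\<dots> = K powr \<beta> * f L s x powr \<beta>" using K less_imp_le[OF pos[OF L]] by (simp add: powr_mult)
    also have "\<dots> \<le> K powr \<beta> * (K powr (\<beta>/2) * H l s x)"
      using not_isolated_bound[OF L x(3)] by (intro mult_left_mono) auto
    also have "H l s x \<le> K powr \<beta> * H l s y"
    proof (rule H_distort)
      have "\<bar>y - x\<bar> \<le> (1/4)^Suc s" using cell_dist[OF y x(1)] .
      also have "\<dots> \<le> (1/4)^s" by simp
      finally show "\<bar>y - x\<bar> \<le> (1/4)^s" .
    qed
    finally have "?F \<le> K powr \<beta> * (K powr (\<beta>/2) * (K powr \<beta> * H l s y))" by (simp add: mult_left_mono)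
    also have "\<dots> = K powr (2 * \<beta>) * K powr (\<beta>/2) * H l s y"
      using powr_add[of K \<beta> \<beta>] by (simp add: mult_ac)
    finally show ?thesis .
  qed
  have "(\<integral>\<^sup>+y. ennreal (indicator (cell (Suc s) i) y * T l (Suc s) i (Suc s + m) y) \<partial>lborel)
    \<le> ennreal (?C * ((1/4)^(Suc s) * ?F))"
    by (rule T_cell[OF l b x(1,2)])
  also have "\<dots> = ennreal ?C * (ennreal ?F * emeasure lborel (cell (Suc s) i))"
    unfolding emeasure_cell by (simp flip: ennreal_mult add: mult_ac)
  also have "ennreal ?F * emeasure lborel (cell (Suc s) i) = (\<integral>\<^sup>+y. ennreal ?F * indicator (cell (Suc s) i) y \<partial>lborel)"
    by (simp add: nn_integral_cmult_indicator)
  also have "\<dots> \<le> (\<integral>\<^sup>+y. ennreal (K powr (2 * \<beta>) * K powr (\<beta>/2)) * ennreal (indicator (cell (Suc s) i) y * H l s y) \<partial>lborel)"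
    using FH H_nonneg by (intro nn_integral_mono) (auto simp flip: ennreal_mult split: split_indicator intro!: ennreal_leI)
  also have "\<dots> = ennreal (K powr (2 * \<beta>) * K powr (\<beta>/2)) * (\<integral>\<^sup>+y. ennreal (indicator (cell (Suc s) i) y * H l s y) \<partial>lborel)"
    by (intro nn_integral_cmult) measurable
  also have "ennreal ?C * (ennreal (K powr (2 * \<beta>) * K powr (\<beta>/2)) * (\<integral>\<^sup>+y. ennreal (indicator (cell (Suc s) i) y * H l s y) \<partial>lborel))
     = ennreal (?C * (K powr (2 * \<beta>) * K powr (\<beta>/2))) * (\<integral>\<^sup>+y. ennreal (indicator (cell (Suc s) i) y * H l s y) \<partial>lborel)"
    by (simp add: ennreal_mult mult_ac)
  also have "\<dots> \<le> ennreal (K powr (1 + 4 * \<beta>) * 2 powr (\<theta> * w l * m)) * (\<integral>\<^sup>+y. ennreal (indicator (cell (Suc s) i) y * H l s y) \<partial>lborel)"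
  proof (intro mult_right_mono ennreal_leI)
    \<comment> \<open>Growth by \<open>single\<close> and its starting point cost
      \<open>1 + \<beta>\<close>, one step in scale \<beta>, non-isolation \<beta>/2, and moving
      \<open>H\<close> within the cell \<beta>; the exponent \<open>1 + 4 * \<beta>\<close> rounds
      the total up.\<close>
    have "K powr (1 + \<beta>) * (K powr (2 * \<beta>) * K powr (\<beta>/2)) \<le> K powr (1 + 4 * \<beta>)"
      unfolding powr_add[symmetric] using K \<beta> by (intro powr_mono) auto
    from mult_right_mono[OF this, of "2 powr (\<theta> * w l * m)"]
    show "?C * (K powr (2 * \<beta>) * K powr (\<beta>/2)) \<le> K powr (1 + 4 * \<beta>) * 2 powr (\<theta> * w l * m)"
      by (simp add: mult_ac)
  qed simp
  finally show ?thesis by (simp add: mult_left_mono)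
qed

section \<open>Averages over the unit interval and the induction on the scale\<close>

definition avg :: "(real \<Rightarrow> real) \<Rightarrow> ennreal" where
  "avg g = (\<integral>\<^sup>+x. ennreal (indicator {0..<1} x * g x) \<partial>lborel)"

lemma T_integral_Suc_sum:
  assumes l: "1 \<le> l" "l < 2 * d"
  shows "(\<Sum>i<4^Suc s. \<integral>\<^sup>+y. ennreal (indicator (cell (Suc s) i) y * T l (Suc s) i (Suc s + m) y) \<partial>lborel)
    \<le> ennreal (K powr (1 + 4 * \<beta>) * 2 powr (\<theta> * w l * m)) * avg (H l s)"
proof -
  have [measurable]: "H l s \<in> borel_measurable borel" using l by (intro H_meas) auto
  have "avg (H l s) = (\<integral>\<^sup>+y. (\<Sum>i<4^Suc s. ennreal (indicator (cell (Suc s) i) y * H l s y)) \<partial>lborel)"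
    unfolding avg_def sum_indicator_cell[of "Suc s", symmetric] sum_distrib_right
    by (intro nn_integral_cong sum_ennreal[symmetric]) (auto simp: H_nonneg)
  also have "\<dots> = (\<Sum>i<4^Suc s. \<integral>\<^sup>+y. ennreal (indicator (cell (Suc s) i) y * H l s y) \<partial>lborel)"
    by (intro nn_integral_sum) measurable
  finally show ?thesis
    using T_integral_Suc[OF l] by (simp add: sum_distrib_left sum_mono del: power_Suc)
qed

text \<open>Cauchy-Schwarz on each pair of dimensions yields the geometric mean of the inductive
  bounds, and concavity of \<open>w\<close> then saves \<open>1/d\<close> in the exponent of
  \<open>B\<close> as well as in the growth rate in \<open>n\<close>.\<close>

lemma avg_H:
  assumes l: "l \<le> 2 * d" and B: "1 \<le> B"
    and IH: "\<And>k. k \<le> 2 * d \<Longrightarrow> avg (\<lambda>x. al k n x powr \<beta>) \<le> ennreal (B powr (1 + w k) * a powr \<beta> * 2 powr (\<theta> * w k * n))"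
  shows "avg (H l n) \<le> ennreal (real (2 * d) * (B powr (1 + w l - 1/d) * a powr \<beta> * 2 powr (\<theta> * (w l - 1/d) * n)))"
    (is "_ \<le> ennreal (_ * ?Z)")
proof -
  have each: "avg (\<lambda>x. (al (l - j) n x * al (l + j) n x) powr (\<beta>/2)) \<le> ennreal ?Z" if j: "j \<in> js l" for j
  proof -
    let ?i = "indicator {0..<1} :: real \<Rightarrow> real"
    have k: "l - j \<le> 2 * d" "l + j \<le> 2 * d" using j by (auto simp: js_def)
    let ?X = "\<lambda>k. B powr (1 + w k) * a powr \<beta> * 2 powr (\<theta> * w k * n)"
    have X0: "0 < ?X k" for k using B a by simp
    have av: "avg (\<lambda>x. al k n x powr \<beta>) = (\<integral>\<^sup>+x. ennreal ((?i x * al k n x) powr \<beta>) \<partial>lborel)" for k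
      unfolding avg_def by (intro nn_integral_cong) (auto split: split_indicator)
    have m [measurable]: "al k n \<in> borel_measurable borel" if "k \<le> 2 * d" for k using that by (rule meas_al)
    have "avg (\<lambda>x. (al (l - j) n x * al (l + j) n x) powr (\<beta>/2))
      = (\<integral>\<^sup>+x. ennreal (((?i x * al (l - j) n x) * (?i x * al (l + j) n x)) powr (\<beta>/2)) \<partial>lborel)"
      unfolding avg_def by (intro nn_integral_cong) (auto split: split_indicator)
    also have "\<dots> \<le> ennreal (sqrt (?X (l - j) * ?X (l + j)))"
      using IH[OF k(1)] IH[OF k(2)] k X0 unfolding av
      by (intro nn_integral_geometric_mean) (auto intro!: borel_measurable_times mult_nonneg_nonneg m nonneg)
    also have "\<dots> \<le> ennreal ?Z"
    proof (rule ennreal_leI)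
      let ?e = "(w (l - j) + w (l + j)) / 2"
      have B0: "B > 0" using B by simp
      have "?X (l - j) * ?X (l + j) = (B powr (1 + ?e) * a powr \<beta> * 2 powr (\<theta> * ?e * n))\<^sup>2"
      proof -
        have "B powr (1 + w (l - j)) * B powr (1 + w (l + j)) = (B powr (1 + ?e))\<^sup>2"
          "2 powr (\<theta> * w (l - j) * n) * 2 powr (\<theta> * w (l + j) * n) = (2 powr (\<theta> * ?e * n))\<^sup>2"
          unfolding power2_eq_square powr_add[symmetric]
          by (rule arg_cong[of _ _ "(powr) _"], simp add: field_simps)+
        then show ?thesis by (simp only: power_mult_distrib) (simp add: mult_ac power2_eq_square)
      qed
      then have "sqrt (?X (l - j) * ?X (l + j)) = B powr (1 + ?e) * a powr \<beta> * 2 powr (\<theta> * ?e * n)" by simp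
      also have "\<dots> \<le> ?Z"
        using B \<theta> w_mid[OF j] by (intro mult_mono powr_mono mult_left_mono mult_right_mono) auto
      finally show "sqrt (?X (l - j) * ?X (l + j)) \<le> ?Z" .
    qed
    finally show ?thesis .
  qed
  have "avg (H l n) = (\<integral>\<^sup>+x. (\<Sum>j\<in>js l. ennreal (indicator {0..<1} x * (al (l - j) n x * al (l + j) n x) powr (\<beta>/2))) \<partial>lborel)"
    unfolding avg_def H_def sum_distrib_left
    by (intro nn_integral_cong sum_ennreal[symmetric]) (auto simp: indicator_def)
  also have "\<dots> = (\<Sum>j\<in>js l. avg (\<lambda>x. (al (l - j) n x * al (l + j) n x) powr (\<beta>/2)))"
    unfolding avg_def
  proof (rule nn_integral_sum)
    fix j assume j: "j \<in> js l"
    have [measurable]: "al (l - j) n \<in> borel_measurable borel" "al (l + j) n \<in> borel_measurable borel"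
      using j by (auto simp: js_def intro!: meas_al)
    show "(\<lambda>x. ennreal (indicator {0..<1} x * (al (l - j) n x * al (l + j) n x) powr (\<beta>/2))) \<in> borel_measurable lborel"
      by measurable
  qed
  also have "\<dots> \<le> (\<Sum>j\<in>js l. ennreal ?Z)" by (intro sum_mono each)
  also have "\<dots> \<le> of_nat (2 * d) * ennreal ?Z"
    unfolding sum_constant by (intro mult_right_mono of_nat_mono fin_js) simp
  also have "\<dots> = ennreal (2 * d * ?Z)"
    using a B by (simp add: ennreal_mult flip: ennreal_of_nat_eq_real_of_nat)
  finally show ?thesis .
qed

text \<open>Births at scale 0 cost the initial value; births at scale \<open>s + 1\<close> cost the
  average of \<open>H\<close> at scale \<open>s\<close>, which the induction hypothesis bounds with
  a saving. The saving in the growth rate makes the sum over \<open>s\<close> geometric. The second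
  condition on \<open>B\<close> fits the initial term into one half of the bound, the third uses the
  saving in \<open>B\<close> to fit everything else into the other half.\<close>

theorem avg_al_bound:
  assumes B: "1 \<le> B" "2 * K powr (1 + 4 * \<beta>) \<le> B"
      "8 * real d * K powr (1 + 4 * \<beta>) / (1 - 2 powr (- \<theta> / d)) \<le> B powr (1/d)"
    and l: "l \<le> 2 * d"
  shows "avg (\<lambda>x. al l n x powr \<beta>) \<le> ennreal (B powr (1 + w l) * a powr \<beta> * 2 powr (\<theta> * w l * n))"
  using l
proof (induction n arbitrary: l rule: less_induct)
  case (less n)
  define E where "E = K powr (1 + 4 * \<beta>)"
  have E: "1 \<le> E" using K \<beta> by (simp add: E_def ge_one_powr_ge_zero)
  have Kb: "K powr \<beta> \<le> E" unfolding E_def using K \<beta> by (intro powr_mono) auto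
  have wl: "0 \<le> w l" using less.prems by (rule w_nonneg)
  have triv: "avg (\<lambda>x. al l n x powr \<beta>) \<le> ennreal (B powr (1 + w l) * a powr \<beta> * 2 powr (\<theta> * w l * n))"
    if "\<And>x. 0 \<le> x \<Longrightarrow> x < 1 \<Longrightarrow> al l n x \<le> K * a"
  proof -
    have "avg (\<lambda>x. al l n x powr \<beta>) \<le> (\<integral>\<^sup>+x. ennreal (K powr \<beta> * a powr \<beta>) * indicator {0..<1::real} x \<partial>lborel)"
      unfolding avg_def
    proof (intro nn_integral_mono)
      fix x :: real
      have "al l n x powr \<beta> \<le> (K * a) powr \<beta>" if "0 \<le> x" "x < 1"
        using \<open>\<And>x. 0 \<le> x \<Longrightarrow> x < 1 \<Longrightarrow> al l n x \<le> K * a\<close>[OF that] \<beta> nonneg[OF less.prems] by (intro powr_mono2) auto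
      then show "ennreal (indicator {0..<1} x * al l n x powr \<beta>) \<le> ennreal (K powr \<beta> * a powr \<beta>) * indicator {0..<1} x"
        using K a by (auto simp: powr_mult intro!: ennreal_leI split: split_indicator)
    qed
    also have "\<dots> = ennreal (K powr \<beta> * a powr \<beta> * 1)" by (simp add: nn_integral_cmult_indicator)
    also have "\<dots> \<le> ennreal (B powr (1 + w l) * a powr \<beta> * 2 powr (\<theta> * w l * n))"
    proof (intro ennreal_leI mult_mono)
      have "K powr \<beta> \<le> B powr 1" using Kb B E by (simp add: E_def)
      also have "\<dots> \<le> B powr (1 + w l)" using B wl by (intro powr_mono) auto
      finally show "K powr \<beta> \<le> B powr (1 + w l)" .
      show "1 \<le> 2 powr (\<theta> * w l * n)" using \<theta> wl by (intro ge_one_powr_ge_zero) auto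
    qed auto
    finally show ?thesis .
  qed
  show ?case
  proof (cases "n = 0 \<or> l = 0 \<or> l = 2 * d")
    case True
    then show ?thesis using triv init[OF less.prems] ends by auto
  next
    case False
    then obtain n' where n: "n = Suc n'" and l: "1 \<le> l" "l < 2 * d"
      using less.prems by (cases n) auto
    \<comment> \<open>The factor saved by each scale that precedes a birth.\<close>
    define \<rho> :: real where "\<rho> = 2 powr (- \<theta> / d)"
    have \<rho>: "0 < \<rho>" "\<rho> < 1" using \<theta> d by (auto simp: \<rho>_def powr_less_one)
    define D where "D = real (2 * d) * B powr (1 + w l - 1/d) * a powr \<beta>"
    have D: "0 \<le> D" by (simp add: D_def)
    have Hs: "avg (H l s) \<le> ennreal (D * 2 powr (\<theta> * w l * s) * \<rho>^s)" if "s \<le> n'" for s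
    proof -
      have "avg (H l s) \<le> ennreal (real (2 * d) * (B powr (1 + w l - 1/d) * a powr \<beta> * 2 powr (\<theta> * (w l - 1/d) * s)))"
        using less.IH[of s] that n by (intro avg_H B less.prems) auto
      also have "2 powr (\<theta> * (w l - 1/d) * s) = 2 powr (\<theta> * w l * s) * \<rho>^s"
      proof -
        have "\<rho>^s = 2 powr (- \<theta> / d * s)" unfolding \<rho>_def by (simp add: powr_powr flip: powr_realpow)
        then show ?thesis by (simp flip: powr_add add: algebra_simps)
      qed
      finally show ?thesis by (simp add: D_def mult_ac)
    qed
    have [measurable]: "H l n' \<in> borel_measurable borel" "\<And>s i n. T l s i n \<in> borel_measurable borel"
      using less.prems by (auto intro: H_meas T_meas)
    have "avg (\<lambda>x. al l n x powr \<beta>) \<le>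
      (\<integral>\<^sup>+x. (\<Sum>s\<le>n'. \<Sum>i<4^s. ennreal (indicator (cell s i) x * T l s i n x)) + ennreal (K powr (2 * \<beta>)) * ennreal (indicator {0..<1} x * H l n' x) \<partial>lborel)"
      unfolding avg_def n
    proof (intro nn_integral_mono)
      fix x :: real
      show "ennreal (indicator {0..<1} x * al l (Suc n') x powr \<beta>) \<le>
       (\<Sum>s\<le>n'. \<Sum>i<4^s. ennreal (indicator (cell s i) x * T l s i (Suc n') x)) + ennreal (K powr (2 * \<beta>)) * ennreal (indicator {0..<1} x * H l n' x)"
      proof (cases "0 \<le> x \<and> x < 1")
        case True
        then have "ennreal (indicator {0..<1} x * al l (Suc n') x powr \<beta>)
          \<le> ennreal ((\<Sum>s\<le>n'. \<Sum>i<4^s. indicator (cell s i) x * T l s i (Suc n') x) + K powr (2 * \<beta>) * (indicator {0..<1} x * H l n' x))"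
          using al_pointwise[OF less.prems, of x n'] by (intro ennreal_leI) auto
        also have "\<dots> = (\<Sum>s\<le>n'. \<Sum>i<4^s. ennreal (indicator (cell s i) x * T l s i (Suc n') x)) + ennreal (K powr (2 * \<beta>)) * ennreal (indicator {0..<1} x * H l n' x)"
        proof -
          define g where "g s i = indicator (cell s i) x * T l s i (Suc n') x" for s i
          have g: "0 \<le> g s i" for s i by (simp add: g_def T_nonneg)
          define y where "y = indicator {0..<1} x * H l n' x"
          have y: "0 \<le> y" by (simp add: y_def H_nonneg)
          show ?thesis unfolding g_def[symmetric] y_def[symmetric]
            using g y by (simp add: ennreal_plus ennreal_mult sum_nonneg)
        qed
        finally show ?thesis .
      qed auto
    qed
    also have "\<dots> = (\<Sum>s\<le>n'. \<Sum>i<4^s. \<integral>\<^sup>+x. ennreal (indicator (cell s i) x * T l s i n x) \<partial>lborel) + ennreal (K powr (2 * \<beta>)) * avg (H l n')"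
      by (simp add: nn_integral_add nn_integral_sum nn_integral_cmult avg_def)
    also have "\<dots> \<le> ennreal (E * (a powr \<beta> * 2 powr (\<theta> * w l * n))) + (\<Sum>s<n'. ennreal (E * (D * 2 powr (\<theta> * w l * n) * \<rho>^s)))
        + ennreal (E * (D * 2 powr (\<theta> * w l * n)))"
    proof (intro add_mono)
      have "(\<Sum>s\<le>n'. \<Sum>i<4^s. \<integral>\<^sup>+x. ennreal (indicator (cell s i) x * T l s i n x) \<partial>lborel)
        = (\<integral>\<^sup>+x. ennreal (indicator (cell 0 0) x * T l 0 0 n x) \<partial>lborel)
         + (\<Sum>s<n'. \<Sum>i<4^Suc s. \<integral>\<^sup>+x. ennreal (indicator (cell (Suc s) i) x * T l (Suc s) i n x) \<partial>lborel)"
        by (simp add: lessThan_Suc_atMost[symmetric] sum.lessThan_Suc_shift del: sum.lessThan_Suc power_Suc)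
      also have "\<dots> \<le> ennreal (E * (a powr \<beta> * 2 powr (\<theta> * w l * n))) + (\<Sum>s<n'. ennreal (E * (D * 2 powr (\<theta> * w l * n) * \<rho>^s)))"
      proof (intro add_mono sum_mono)
        show "(\<integral>\<^sup>+x. ennreal (indicator (cell 0 0) x * T l 0 0 n x) \<partial>lborel) \<le> ennreal (E * (a powr \<beta> * 2 powr (\<theta> * w l * n)))"
          unfolding E_def by (rule T_integral_0[OF l])
        fix s assume "s \<in> {..<n'}"
        then have s: "s < n'" by simp
        then obtain m where m: "n = Suc s + m" unfolding n by (metis Suc_leI add_Suc le_Suc_ex less_imp_le_nat)
        have "(\<Sum>i<4^Suc s. \<integral>\<^sup>+x. ennreal (indicator (cell (Suc s) i) x * T l (Suc s) i n x) \<partial>lborel)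
          \<le> ennreal (E * 2 powr (\<theta> * w l * m)) * avg (H l s)"
          unfolding m E_def by (rule T_integral_Suc_sum[OF l])
        also have "\<dots> \<le> ennreal (E * 2 powr (\<theta> * w l * m)) * ennreal (D * 2 powr (\<theta> * w l * s) * \<rho>^s)"
          using Hs[of s] s by (intro mult_left_mono) auto
        also have "\<dots> = ennreal (E * (D * (2 powr (\<theta> * w l * m) * 2 powr (\<theta> * w l * s)) * \<rho>^s))"
          using E D \<rho> by (simp flip: ennreal_mult add: mult_ac)
        also have "\<dots> \<le> ennreal (E * (D * 2 powr (\<theta> * w l * n) * \<rho>^s))"
        proof (intro ennreal_leI mult_left_mono mult_right_mono)
          \<comment> \<open>The scales up to \<open>s\<close> and the \<open>m\<close> scales after
            the birth together number \<open>n - 1\<close>.\<close>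
          show "2 powr (\<theta> * w l * m) * 2 powr (\<theta> * w l * s) \<le> 2 powr (\<theta> * w l * n)"
            unfolding powr_add[symmetric] m using \<theta> wl by (intro powr_mono) (auto simp: algebra_simps)
        qed (use E D \<rho> in auto)
        finally show "(\<Sum>i<4^Suc s. \<integral>\<^sup>+x. ennreal (indicator (cell (Suc s) i) x * T l (Suc s) i n x) \<partial>lborel)
          \<le> ennreal (E * (D * 2 powr (\<theta> * w l * n) * \<rho>^s))" .
      qed
      finally show "(\<Sum>s\<le>n'. \<Sum>i<4^s. \<integral>\<^sup>+x. ennreal (indicator (cell s i) x * T l s i n x) \<partial>lborel)
        \<le> ennreal (E * (a powr \<beta> * 2 powr (\<theta> * w l * n))) + (\<Sum>s<n'. ennreal (E * (D * 2 powr (\<theta> * w l * n) * \<rho>^s)))" .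
      have "ennreal (K powr (2 * \<beta>)) * avg (H l n') \<le> ennreal E * ennreal (D * 2 powr (\<theta> * w l * n))"
      proof (intro mult_mono ennreal_leI)
        show "K powr (2 * \<beta>) \<le> E" unfolding E_def using K \<beta> by (intro powr_mono) auto
        have "avg (H l n') \<le> ennreal (D * 2 powr (\<theta> * w l * n') * \<rho>^n')" by (rule Hs) simp
        also have "\<dots> \<le> ennreal (D * 2 powr (\<theta> * w l * n) * 1)"
          using \<rho> D \<theta> wl by (intro ennreal_leI mult_mono mult_left_mono powr_mono power_le_one) (auto simp: n)
        finally show "avg (H l n') \<le> ennreal (D * 2 powr (\<theta> * w l * n))" by simp
      qed auto
      then show "ennreal (K powr (2 * \<beta>)) * avg (H l n') \<le> ennreal (E * (D * 2 powr (\<theta> * w l * n)))"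
        using E D by (simp add: ennreal_mult)
    qed
    also have "\<dots> = ennreal (E * (a powr \<beta> * 2 powr (\<theta> * w l * n)) + (\<Sum>s<n'. E * (D * 2 powr (\<theta> * w l * n) * \<rho>^s))
        + E * (D * 2 powr (\<theta> * w l * n)))"
      using E D \<rho> by (simp add: ennreal_plus sum_nonneg)
    also have "\<dots> \<le> ennreal (B powr (1 + w l) * a powr \<beta> * 2 powr (\<theta> * w l * n))"
    proof (rule ennreal_leI)
      let ?P = "2 powr (\<theta> * w l * n)"
      have geo: "(\<Sum>s<n'. \<rho>^s) + 1 \<le> 2 / (1 - \<rho>)"
      proof -
        have "(\<Sum>s<n'. \<rho>^s) = (1 - \<rho>^n') / (1 - \<rho>)" using \<rho> by (simp add: sum_gp_strict)
        also have "\<dots> \<le> 1 / (1 - \<rho>)" using \<rho> by (intro divide_right_mono) auto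
        moreover have "1 \<le> 1 / (1 - \<rho>)" using \<rho> by simp
        ultimately show ?thesis by simp
      qed
      have "(\<Sum>s<n'. E * (D * ?P * \<rho>^s)) + E * (D * ?P) = E * D * ?P * ((\<Sum>s<n'. \<rho>^s) + 1)"
      proof -
        have "(\<Sum>s<n'. E * (D * ?P * \<rho>^s)) = E * D * ?P * (\<Sum>s<n'. \<rho>^s)"
          unfolding sum_distrib_left by (rule sum.cong) (auto simp: mult_ac)
        then show ?thesis by (simp only: distrib_left)
      qed
      also have "\<dots> \<le> E * D * ?P * (2 / (1 - \<rho>))" using geo E D by (intro mult_left_mono) auto
      \<comment> \<open>The 8d is made of at most 2d values of \<open>j\<close>, a 2 from
        \<open>geo\<close>, and a 2 because only half of the bound is available here.\<close>
      also have "\<dots> = (8 * real d * E / (1 - \<rho>)) * (B powr (1 + w l - 1/d) * a powr \<beta> * ?P) / 2"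
        using \<rho> by (simp add: D_def divide_simps)
      also have "\<dots> \<le> B powr (1/d) * (B powr (1 + w l - 1/d) * a powr \<beta> * ?P) / 2"
        using B(3) unfolding E_def \<rho>_def by (intro divide_right_mono mult_right_mono) auto
      also have "\<dots> = B powr (1 + w l) * a powr \<beta> * ?P / 2"
        by (simp flip: powr_add mult.assoc)
      finally have 1: "(\<Sum>s<n'. E * (D * ?P * \<rho>^s)) + E * (D * ?P) \<le> B powr (1 + w l) * a powr \<beta> * ?P / 2" .
      have "E \<le> B powr 1 / 2" using B by (simp add: E_def)
      also have "\<dots> \<le> B powr (1 + w l) / 2" using B wl by (intro divide_right_mono powr_mono) auto
      finally have "E * (a powr \<beta> * ?P) \<le> B powr (1 + w l) / 2 * (a powr \<beta> * ?P)" by (rule mult_right_mono) auto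
      with 1 show "E * (a powr \<beta> * ?P) + (\<Sum>s<n'. E * (D * ?P * \<rho>^s)) + E * (D * ?P) \<le> B powr (1 + w l) * a powr \<beta> * ?P"
        by (simp add: algebra_simps)
    qed
    finally show ?thesis .
  qed
qed

end

section \<open>Sublevel sets of polynomials\<close>

lemma lagrange_interpolation:
  fixes p :: "real poly"
  assumes "degree p \<le> r" "finite F" "card F = Suc r"
  shows "poly p y = (\<Sum>i\<in>F. poly p i * (\<Prod>j\<in>F - {i}. (y - j) / (i - j)))"
proof -
  define Q where "Q i = (\<Prod>j\<in>F - {i}. smult (1 / (i - j)) [:-j, 1:])" for i
  define q where "q = p - (\<Sum>i\<in>F. smult (poly p i) (Q i))"
  have Q: "poly (Q i) y = (\<Prod>j\<in>F - {i}. (y - j) / (i - j))" for i y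
    unfolding Q_def poly_prod by (rule prod.cong) (simp_all add: diff_divide_distrib)
  have degQ: "degree (Q i) \<le> r" if "i \<in> F" for i
  proof -
    have "degree (Q i) \<le> sum (degree \<circ> (\<lambda>j. smult (1 / (i - j)) [:-j, 1:])) (F - {i})"
      unfolding Q_def using assms(2) by (intro degree_prod_sum_le) auto
    also have "\<dots> \<le> (\<Sum>j\<in>F - {i}. 1)" by (intro sum_mono) (auto intro!: order_trans[OF degree_smult_le])
    also have "\<dots> = r" using assms that by simp
    finally show ?thesis .
  qed
  have "degree q \<le> r"
    unfolding q_def using assms degQ by (intro degree_diff_le degree_sum_le) (auto intro: order_trans[OF degree_smult_le])
  moreover have "poly q k = 0" if k: "k \<in> F" for k
  proof -
    have "poly (Q i) k = (if i = k then 1 else 0)" if "i \<in> F" for i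
    proof (cases "i = k")
      case True
      then show ?thesis unfolding Q by (auto intro!: prod.neutral)
    next
      case False
      then show ?thesis unfolding Q using k assms(2) by (auto intro!: prod_zero bexI[of _ k])
    qed
    then have "(\<Sum>i\<in>F. poly p i * poly (Q i) k) = (\<Sum>i\<in>F. if i = k then poly p k else 0)"
      by (intro sum.cong) auto
    then show ?thesis using k assms(2) by (simp add: q_def poly_sum)
  qed
  ultimately have "q = 0"
  proof -
    assume deg: "degree q \<le> r" and z: "\<And>k. k \<in> F \<Longrightarrow> poly q k = 0"
    show "q = 0"
    proof (rule ccontr)
      assume "q \<noteq> 0"
      then have "finite {x. poly q x = 0}" "card {x. poly q x = 0} \<le> degree q"
        by (auto intro: poly_roots_finite card_poly_roots_bound)
      moreover have "card F \<le> card {x. poly q x = 0}" using calculation z by (intro card_mono) auto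
      ultimately show False using deg assms(3) by simp
    qed
  qed
  then have "poly p y = poly (\<Sum>i\<in>F. smult (poly p i) (Q i)) y" by (simp add: q_def)
  then show ?thesis by (simp add: poly_sum Q)
qed

text \<open>Greedy choice: intervals of radius \<open>\<mu> / (4 * Suc r)\<close> around at most
  \<open>r\<close> points cover measure at most \<open>\<mu> / 2\<close>, so a further point of
  \<open>B\<close> remains.\<close>

lemma separated_points:
  fixes B :: "real set"
  assumes B: "B \<in> sets lborel" "emeasure lborel B = ennreal \<mu>" "0 < \<mu>" and "k \<le> Suc r"
  shows "\<exists>F\<subseteq>B. finite F \<and> card F = k \<and> (\<forall>i\<in>F. \<forall>j\<in>F. i \<noteq> j \<longrightarrow> \<mu> / (4 * Suc r) \<le> \<bar>i - j\<bar>)"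
  using \<open>k \<le> Suc r\<close>
proof (induction k)
  case 0
  then show ?case by (intro exI[of _ "{}"]) auto
next
  case (Suc k)
  let ?\<delta> = "\<mu> / (4 * Suc r)"
  obtain F where F: "F \<subseteq> B" "finite F" "card F = k" "\<forall>i\<in>F. \<forall>j\<in>F. i \<noteq> j \<longrightarrow> ?\<delta> \<le> \<bar>i - j\<bar>"
    using Suc by auto
  have "\<not> B \<subseteq> (\<Union>i\<in>F. {i - ?\<delta>..i + ?\<delta>})"
  proof
    assume sub: "B \<subseteq> (\<Union>i\<in>F. {i - ?\<delta>..i + ?\<delta>})"
    have "ennreal \<mu> \<le> emeasure lborel (\<Union>i\<in>F. {i - ?\<delta>..i + ?\<delta>})"
      unfolding B(2)[symmetric] using sub F(2) by (intro emeasure_mono) auto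
    also have "\<dots> \<le> (\<Sum>i\<in>F. emeasure lborel {i - ?\<delta>..i + ?\<delta>})"
      using F(2) by (intro emeasure_subadditive_finite) auto
    also have "\<dots> = (\<Sum>i\<in>F. ennreal (2 * ?\<delta>))"
    proof (rule sum.cong[OF refl])
      fix i
      have "i - ?\<delta> \<le> i + ?\<delta>" "i + ?\<delta> - (i - ?\<delta>) = 2 * ?\<delta>" using B(3) by simp_all
      then show "emeasure lborel {i - ?\<delta>..i + ?\<delta>} = ennreal (2 * ?\<delta>)" by (simp only: emeasure_lborel_Icc)
    qed
    also have "\<dots> = ennreal (\<Sum>i\<in>F. 2 * ?\<delta>)" using B(3) by (intro sum_ennreal) auto
    finally have "\<mu> \<le> real k * (2 * ?\<delta>)" using B(3) F(3) by (simp add: ennreal_le_iff)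
    also have "\<dots> \<le> real (Suc r) * (2 * ?\<delta>)" using Suc.prems B(3) by (intro mult_right_mono) auto
    also have "\<dots> = \<mu> / 2" by (simp add: field_simps)
    finally show False using B(3) by simp
  qed
  then obtain x where x: "x \<in> B" "\<And>i. i \<in> F \<Longrightarrow> x \<notin> {i - ?\<delta>..i + ?\<delta>}" by blast
  have far: "?\<delta> \<le> \<bar>x - i\<bar>" if "i \<in> F" for i using x(2)[OF that] by auto
  have "x \<notin> F"
  proof
    assume "x \<in> F"
    then have "x \<notin> {x - ?\<delta>..x + ?\<delta>}" by (rule x(2))
    then show False using B(3) by auto
  qed
  then show ?case using F x(1) far
    by (intro exI[of _ "insert x F"]) (auto simp: abs_minus_commute)
qed

text \<open>A crude Remez inequality: Lagrange interpolation at \<open>r + 1\<close> separated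
  points of \<open>B\<close> gives the right power of \<open>\<mu>\<close>, and later only this
  power matters, not the constant.\<close>

lemma remez:
  fixes p :: "real poly"
  assumes "degree p \<le> r" and B: "B \<in> sets lborel" "B \<subseteq> {0..1}" "emeasure lborel B = ennreal \<mu>" "0 < \<mu>"
    and \<epsilon>: "\<And>y. y \<in> B \<Longrightarrow> \<bar>poly p y\<bar> \<le> \<epsilon>" and y: "y \<in> {0..1}"
  shows "\<bar>poly p y\<bar> * \<mu>^r \<le> real (Suc r) * (4 * real (Suc r))^r * \<epsilon>"
proof -
  let ?\<delta> = "\<mu> / (4 * Suc r)"
  have \<delta>: "0 < ?\<delta>" using B(4) by simp
  obtain F where F: "F \<subseteq> B" "finite F" "card F = Suc r" "\<And>i j. i \<in> F \<Longrightarrow> j \<in> F \<Longrightarrow> i \<noteq> j \<Longrightarrow> ?\<delta> \<le> \<bar>i - j\<bar>"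
    using separated_points[OF B(1,3,4), of "Suc r" r] by auto
  have each: "\<bar>poly p i * (\<Prod>j\<in>F - {i}. (y - j) / (i - j))\<bar> \<le> \<epsilon> * (1 / ?\<delta>)^r" if i: "i \<in> F" for i
  proof -
    have "\<bar>\<Prod>j\<in>F - {i}. (y - j) / (i - j)\<bar> = (\<Prod>j\<in>F - {i}. \<bar>(y - j) / (i - j)\<bar>)" by (simp add: abs_prod)
    also have "\<dots> \<le> (\<Prod>j\<in>F - {i}. 1 / ?\<delta>)"
    proof (rule prod_mono, intro conjI)
      fix j assume j: "j \<in> F - {i}"
      have "\<bar>y - j\<bar> \<le> 1" using j F(1) B(2) y by (force simp: abs_le_iff)
      moreover have "?\<delta> \<le> \<bar>i - j\<bar>" using F(4)[of i j] i j by auto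
      ultimately show "\<bar>(y - j) / (i - j)\<bar> \<le> 1 / ?\<delta>"
        unfolding abs_divide using \<delta> by (intro frac_le) auto
    qed auto
    also have "\<dots> = (1 / ?\<delta>)^r" using F(2,3) i by simp
    finally show ?thesis unfolding abs_mult using \<epsilon>[of i] i F(1) by (intro mult_mono) auto
  qed
  have "\<bar>poly p y\<bar> \<le> (\<Sum>i\<in>F. \<epsilon> * (1 / ?\<delta>)^r)"
    unfolding lagrange_interpolation[OF assms(1) F(2,3), of y]
    by (rule order_trans[OF sum_abs]) (intro sum_mono each)
  also have "\<dots> = Suc r * \<epsilon> * (1 / ?\<delta>)^r" using F by simp
  finally have "\<bar>poly p y\<bar> * \<mu>^r \<le> (Suc r * \<epsilon> * (1 / ?\<delta>)^r) * \<mu>^r" using B(4) by (intro mult_right_mono) auto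
  also have "\<dots> = Suc r * \<epsilon> * (1 / ?\<delta> * \<mu>)^r" by (simp only: power_mult_distrib mult.assoc)
  also have "1 / ?\<delta> * \<mu> = 4 * Suc r" using B(4) by simp
  finally show ?thesis by (simp add: mult_ac)
qed

text \<open>Growth is tested at \<open>t^2\<close> because conjugation by \<open>diag2 t\<close>
  multiplies the unipotent parameter by \<open>t^2\<close>; comparison with the leading term gives
  the degree.\<close>

lemma degree_le_of_growth:
  fixes p :: "real poly"
  assumes "p \<noteq> 0" and growth: "\<And>t. 1 \<le> t \<Longrightarrow> \<bar>poly p (t\<^sup>2)\<bar> \<le> C * t powr e"
  shows "2 * real (degree p) \<le> e"
proof (rule ccontr)
  assume e: "\<not> ?thesis"
  have sq: "filterlim (\<lambda>t::real. t\<^sup>2) at_infinity at_top"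
    by (intro filterlim_at_top_imp_at_infinity filterlim_pow_at_top filterlim_ident) auto
  have lim1: "((\<lambda>t. \<bar>poly p (t\<^sup>2) / (t\<^sup>2)^degree p\<bar>) \<longlongrightarrow> \<bar>lead_coeff p\<bar>) at_top"
    by (intro tendsto_rabs filterlim_compose[OF poly_divide_tendsto_aux sq])
  have lim2: "((\<lambda>t. C * t powr (e - 2 * real (degree p))) \<longlongrightarrow> C * 0) at_top"
    using e by (intro tendsto_mult tendsto_const tendsto_neg_powr filterlim_ident) auto
  have "\<bar>lead_coeff p\<bar> \<le> C * 0"
  proof (rule tendsto_le[OF _ lim2 lim1])
    show "\<forall>\<^sub>F t in at_top. \<bar>poly p (t\<^sup>2) / (t\<^sup>2)^degree p\<bar> \<le> C * t powr (e - 2 * real (degree p))"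
      using eventually_ge_at_top[of 1]
    proof eventually_elim
      fix t :: real assume t: "1 \<le> t"
      have "(t\<^sup>2)^degree p = t powr (2 * real (degree p))"
        using powr_realpow[of t "2 * degree p"] t by (simp add: power_mult)
      then show "\<bar>poly p (t\<^sup>2) / (t\<^sup>2)^degree p\<bar> \<le> C * t powr (e - 2 * real (degree p))"
        using growth[OF t] t by (simp add: abs_divide powr_diff divide_right_mono)
    qed
  qed simp
  then show False using assms(1) by simp
qed

section \<open>The action of \<open>SL2\<close> on exterior powers\<close>

definition unip :: "real \<Rightarrow> real^2^2" where
  "unip y = vector [vector [1, y], vector [0, 1]]"

definition diag2 :: "real \<Rightarrow> real^2^2" where
  "diag2 t = vector [vector [t, 0], vector [0, 1/t]]"

abbreviation act :: "nat \<Rightarrow> real^2^2 \<Rightarrow> real^(('d::finite \<times> 2) set) \<Rightarrow> real^(('d \<times> 2) set)" where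
  "act l g \<equiv> ext_map l (rho g)"

text \<open>The exponent of \<open>t\<close> by which \<open>diag2 t\<close> acts on
  \<open>axis S 1\<close>.\<close>

definition weight :: "('d::finite \<times> 2) set \<Rightarrow> real" where
  "weight S = real (card {p\<in>S. snd p = 1}) - real (card {p\<in>S. snd p = 2})"

lemma unip_nth [simp]: "unip y $ 1 $ 1 = 1" "unip y $ 1 $ 2 = y" "unip y $ 2 $ 1 = 0" "unip y $ 2 $ 2 = 1"
  by (simp_all add: unip_def vector_def)

lemma diag2_nth [simp]: "diag2 t $ 1 $ 1 = t" "diag2 t $ 1 $ 2 = 0" "diag2 t $ 2 $ 1 = 0" "diag2 t $ 2 $ 2 = 1/t"
  by (simp_all add: diag2_def vector_def)

lemma mat2_eq_iff: "A = B \<longleftrightarrow> A $ 1 $ 1 = B $ 1 $ 1 \<and> A $ 1 $ 2 = B $ 1 $ 2 \<and> A $ 2 $ 1 = B $ 2 $ 1 \<and> A $ 2 $ 2 = B $ 2 $ 2"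
  for A B :: "real^2^2"
  by (auto simp: vec_eq_iff forall_2)

lemma mat2_mult_nth: "(A ** B) $ i $ j = A $ i $ 1 * B $ 1 $ j + A $ i $ 2 * B $ 2 $ j" for A B :: "real^2^2"
  by (simp add: matrix_matrix_mult_def sum_2)

lemma rho_mult: "rho (A ** B) = (rho A ** rho B :: real^('d::finite \<times> 2)^('d \<times> 2))"
proof (simp only: vec_eq_iff, intro allI)
  fix p q :: "'d \<times> 2"
  have "(rho A ** rho B :: real^('d \<times> 2)^('d \<times> 2)) $ p $ q
     = (\<Sum>r\<in>UNIV \<times> UNIV. (if fst p = fst r then A $ snd p $ snd r else 0) * (if fst r = fst q then B $ snd r $ snd q else 0))"
    by (simp add: matrix_matrix_mult_def rho_def)
  also have "\<dots> = (\<Sum>i\<in>UNIV. \<Sum>b\<in>UNIV. if i = fst p then (if fst p = fst q then A $ snd p $ b * B $ b $ snd q else 0) else 0)"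
    unfolding sum.cartesian_product by (intro sum.cong) auto
  also have "\<dots> = (\<Sum>i\<in>UNIV. if i = fst p then (\<Sum>b\<in>UNIV. if fst p = fst q then A $ snd p $ b * B $ b $ snd q else 0) else 0)"
    by (intro sum.cong) auto
  also have "\<dots> = rho (A ** B) $ p $ q"
    by (simp add: rho_def matrix_matrix_mult_def)
  finally show "rho (A ** B) $ p $ q = (rho A ** rho B) $ p $ q" ..
qed

lemma rho_one: "rho (mat 1) = mat 1"
  by (auto simp: rho_def mat_def vec_eq_iff prod_eq_iff)

lemma rho_transpose: "rho (transpose A) = transpose (rho A)"
  by (auto simp: rho_def transpose_def vec_eq_iff)

lemma act_mult: "act l (A ** B) x = act l A (act l B x)"
  by (simp add: rho_mult ext_map_mult)

lemma act_one: "x \<in> ext_pow l \<Longrightarrow> act l (mat 1) x = x"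
  by (simp add: rho_one ext_map_one)

lemma act_transpose: "x \<in> ext_pow l \<Longrightarrow> y \<in> ext_pow l \<Longrightarrow> act l A x \<bullet> y = x \<bullet> act l (transpose A) y"
  by (simp add: ext_map_transpose rho_transpose)

lemma ext_pow_iff:
  fixes x :: "real^('n::finite set)"
  shows "x \<in> ext_pow l \<longleftrightarrow> (\<forall>S. card S \<noteq> l \<longrightarrow> x $ S = 0)"
proof
  assume x: "\<forall>S. card S \<noteq> l \<longrightarrow> x $ S = 0"
  have "x = (\<Sum>S\<in>UNIV. x $ S *\<^sub>R axis S 1)" by (simp add: basis_expansion flip: scalar_mult_eq_scaleR)
  also have "\<dots> \<in> ext_pow l"
    unfolding ext_pow_def
  proof (intro span_sum)
    fix S show "x $ S *\<^sub>R axis S 1 \<in> span (range (wedge l))"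
      using x axis_in_ext_pow[of S] by (cases "card S = l") (auto simp: ext_pow_def intro: span_scale span_zero)
  qed
  finally show "x \<in> ext_pow l" .
qed (auto intro: ext_pow_nth)

lemma wedge_scale: "wedge l (\<lambda>a. c a *\<^sub>R u a) = (\<Prod>a<l. c a) *\<^sub>R wedge l u"
  by (simp add: vec_eq_iff wedge_def prod.distrib sum_distrib_left mult_ac)

lemma act_diag_axis:
  fixes S :: "('d::finite \<times> 2) set"
  assumes t: "0 < t"
  shows "act (card S) (diag2 t) (axis S 1) = t powr weight S *\<^sub>R axis S 1"
proof -
  let ?c = "\<lambda>p :: 'd \<times> 2. if snd p = 1 then t else 1 / t"
  have b: "bij_betw (from_nat_into S) {..<card S} S" by (rule bij_betw_from_nat_into_finite) simp
  have nb: "diag2 t $ b $ b' = (if b = b' then if b = 1 then t else 1 / t else 0)" for b b' :: 2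
    using exhaust_2[of b] exhaust_2[of b'] by auto
  have "rho (diag2 t) *v axis p 1 = ?c p *\<^sub>R axis p 1" for p :: "'d \<times> 2"
    unfolding matrix_vector_mult_basis by (auto simp: vec_eq_iff column_def rho_def nb axis_def prod_eq_iff)
  then have "act (card S) (diag2 t) (axis S 1) = wedge (card S) (\<lambda>a. ?c (from_nat_into S a) *\<^sub>R axis (from_nat_into S a) 1)"
    by (simp add: ext_map_axis)
  also have "\<dots> = (\<Prod>a<card S. ?c (from_nat_into S a)) *\<^sub>R axis S 1"
    by (simp add: wedge_scale wedge_axis)
  also have "(\<Prod>a<card S. ?c (from_nat_into S a)) = (\<Prod>p\<in>S. ?c p)"
    by (rule prod.reindex_bij_betw[OF b])
  also have "\<dots> = (\<Prod>p\<in>{p\<in>S. snd p = 1}. t) * (\<Prod>p\<in>{p\<in>S. snd p = 2}. 1 / t)"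
  proof -
    have "S = {p\<in>S. snd p = 1} \<union> {p\<in>S. snd p = 2}" using exhaust_2 by auto
    then have "(\<Prod>p\<in>S. ?c p) = (\<Prod>p\<in>{p\<in>S. snd p = 1} \<union> {p\<in>S. snd p = 2}. ?c p)" by simp
    also have "\<dots> = (\<Prod>p\<in>{p\<in>S. snd p = 1}. ?c p) * (\<Prod>p\<in>{p\<in>S. snd p = 2}. ?c p)"
      by (rule prod.union_disjoint) auto
    also have "(\<Prod>p\<in>{p\<in>S. snd p = 1}. ?c p) = (\<Prod>p\<in>{p\<in>S. snd p = 1}. t)" by (rule prod.cong) auto
    also have "(\<Prod>p\<in>{p\<in>S. snd p = 2}. ?c p) = (\<Prod>p\<in>{p\<in>S. snd p = 2}. 1 / t)" by (rule prod.cong) auto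
    finally show ?thesis .
  qed
  also have "\<dots> = t powr weight S"
    using t by (simp add: weight_def powr_diff powr_realpow power_one_over divide_inverse power_inverse)
  finally show ?thesis .
qed

lemma act_eq_sum: "act l g x = (\<Sum>S | card S = l. x $ S *\<^sub>R act l g (axis S 1))"
  unfolding ext_map_def[of l "rho g" x] by (rule sum.cong) (auto simp: ext_map_axis)

lemma act_diag:
  fixes x :: "real^(('d::finite \<times> 2) set)"
  assumes "x \<in> ext_pow l" "0 < t"
  shows "act l (diag2 t) x $ S = t powr weight S * x $ S"
proof -
  have "act l (diag2 t) x = (\<Sum>S | card S = l. x $ S *\<^sub>R (t powr weight S *\<^sub>R axis S 1))"
    unfolding act_eq_sum[of l _ x] by (rule sum.cong) (auto simp: act_diag_axis[OF assms(2)])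
  then have "act l (diag2 t) x $ S = (\<Sum>T | card T = l. if T = S then t powr weight S * x $ S else 0)"
    by (simp add: axis_def if_distrib mult_ac cong: if_cong sum.cong)
  then show ?thesis using ext_pow_nth[OF assms(1), of S] by auto
qed

text \<open>The indices of the two kinds number \<open>l\<close> in total and at most
  \<open>d\<close> each.\<close>

lemma weight_bounds:
  fixes S :: "('d::finite \<times> 2) set"
  assumes S: "card S = l"
  shows "\<bar>weight S\<bar> \<le> min l (2 * CARD('d) - l)"
proof -
  let ?A = "\<lambda>b::2. {p\<in>S. snd p = b}"
  have "S = ?A 1 \<union> ?A 2" using exhaust_2 by auto
  then have l: "l = card (?A 1) + card (?A 2)"
    unfolding S[symmetric] by (subst card_Un_disjoint[symmetric]) auto
  have "card (?A b) \<le> CARD('d)" for b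
  proof -
    have "card (?A b) \<le> card ((\<lambda>i::'d. (i, b)) ` UNIV)" by (rule card_mono) (auto simp: image_iff)
    also have "\<dots> \<le> CARD('d)" by (rule card_image_le) simp
    finally show ?thesis .
  qed
  from this[of 1] this[of 2] l show ?thesis unfolding weight_def by linarith
qed

lemma diag2_inverse: "t \<noteq> 0 \<Longrightarrow> diag2 (1/t) ** diag2 t = mat 1"
  by (simp add: mat2_eq_iff mat2_mult_nth mat_def)

lemma norm_diag_bounds:
  fixes x :: "real^(('d::finite \<times> 2) set)"
  assumes x: "x \<in> ext_pow l" and t: "1 \<le> t" and m: "m = min l (2 * CARD('d) - l)"
  shows "norm (act l (diag2 t) x) \<le> t powr m * norm x" "norm (act l (diag2 (1/t)) x) \<le> t powr m * norm x"
    "norm x \<le> t powr m * norm (act l (diag2 t) x)"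
proof -
  have *: "norm (act l (diag2 s) z) \<le> t powr m * norm z"
    if s: "0 < s" "\<And>S :: ('d \<times> 2) set. card S = l \<Longrightarrow> s powr weight S \<le> t powr m" and z: "z \<in> ext_pow l"
    for s and z :: "real^(('d \<times> 2) set)"
  proof -
    have "norm (act l (diag2 s) z) \<le> norm (t powr m *\<^sub>R z)"
    proof (rule norm_le_componentwise_cart)
      fix S
      show "norm (act l (diag2 s) z $ S) \<le> norm ((t powr m *\<^sub>R z) $ S)"
        using s(2)[of S] ext_pow_nth[OF z, of S]
        by (cases "card S = l") (auto simp: act_diag[OF z s(1)] abs_mult intro!: mult_right_mono)
    qed
    then show ?thesis by simp
  qed
  have up: "t powr weight S \<le> t powr m" "(1/t) powr weight S \<le> t powr m" if "card S = l" for S :: "('d \<times> 2) set"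
  proof -
    have "\<bar>weight S\<bar> \<le> m" using weight_bounds[OF that] m by simp
    then show "t powr weight S \<le> t powr m" using t by (intro powr_mono) auto
    have "(1/t) powr weight S = t powr (- weight S)" using t by (simp add: powr_divide powr_minus_divide)
    also have "\<dots> \<le> t powr m" using t \<open>\<bar>weight S\<bar> \<le> m\<close> by (intro powr_mono) auto
    finally show "(1/t) powr weight S \<le> t powr m" .
  qed
  show "norm (act l (diag2 t) x) \<le> t powr m * norm x" using t up x by (intro *) auto
  have inv: "norm (act l (diag2 (1/t)) z) \<le> t powr m * norm z" if "z \<in> ext_pow l" for z :: "real^(('d \<times> 2) set)"
    using t up that by (intro *) auto
  show "norm (act l (diag2 (1/t)) x) \<le> t powr m * norm x" using inv x by simp
  have "x = act l (diag2 (1/t)) (act l (diag2 t) x)"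
    using t x by (simp add: act_one diag2_inverse flip: act_mult)
  then show "norm x \<le> t powr m * norm (act l (diag2 t) x)"
    using inv[of "act l (diag2 t) x"] ext_map_in_ext_pow by metis
qed

text \<open>Lets bounded group elements be traded for a constant; the Leibniz formula bounds every
  entry of the exterior power by \<open>fact l * R ^ l\<close>.\<close>

lemma act_bounded:
  fixes R :: real
  assumes R: "1 \<le> R"
  obtains C where "1 \<le> C"
    "\<And>l g x. l \<le> 2 * CARD('d) \<Longrightarrow> norm g \<le> R \<Longrightarrow> norm (act l g (x :: real^(('d::finite \<times> 2) set))) \<le> C * norm x"
proof
  let ?N = "CARD(('d \<times> 2) set)" and ?F = "fact (2 * CARD('d)) * R ^ (2 * CARD('d))"
  define C :: real where "C = real ?N * (real ?N * ?F)"
  have F: "1 \<le> ?F"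
    using mult_mono[of 1 "fact (2 * CARD('d))" 1 "R ^ (2 * CARD('d))"] R by (simp add: fact_ge_1 one_le_power)
  show "1 \<le> C"
  proof -
    have N: "1 \<le> real ?N" by (metis One_nat_def Suc_leI of_nat_1 of_nat_le_iff zero_less_card_finite)
    have "1 * (1 * 1) \<le> C" unfolding C_def using N F by (intro mult_mono) auto
    then show ?thesis by simp
  qed
  fix l :: nat and g :: "real^2^2" and x :: "real^(('d \<times> 2) set)"
  assume l: "l \<le> 2 * CARD('d)" and g: "norm g \<le> R"
  have entry: "\<bar>(rho g :: real^('d \<times> 2)^('d \<times> 2)) $ p $ q\<bar> \<le> R" for p q
  proof -
    have "\<bar>g $ i $ j\<bar> \<le> R" for i j
      using component_le_norm_cart[of "g $ i" j] Finite_Cartesian_Product.norm_nth_le[of g i] g by linarith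
    then show ?thesis using R by (auto simp: rho_def)
  qed
  have ax: "\<bar>act l g (axis T 1) $ S\<bar> \<le> ?F" if T: "card T = l" for S T :: "('d \<times> 2) set"
  proof (cases "card S = l")
    case False
    then have "act l g (axis T 1) $ S = 0" using ext_pow_nth[OF ext_map_in_ext_pow] by blast
    then show ?thesis using F by simp
  next
    case True
    have "\<bar>act l g (axis T 1) $ S\<bar> \<le> (\<Sum>p | p permutes {..<l}. \<bar>of_int (sign p) * (\<Prod>a<l. rho g $ from_nat_into S (p a) $ from_nat_into T a)\<bar>)"
      unfolding ext_map_nth_axis[OF True T] by (rule sum_abs)
    also have "\<dots> \<le> (\<Sum>p | p permutes {..<l}. R ^ l)"
    proof (rule sum_mono)
      fix p
      have "(\<Prod>a<l. \<bar>rho g $ from_nat_into S (p a) $ from_nat_into T a\<bar>) \<le> (\<Prod>a<l. R)"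
        using entry by (intro prod_mono) auto
      then show "\<bar>of_int (sign p) * (\<Prod>a<l. rho g $ from_nat_into S (p a) $ from_nat_into T a)\<bar> \<le> R ^ l"
        by (simp add: abs_mult abs_prod sign_def)
    qed
    also have "\<dots> = fact l * R ^ l" using card_permutations[of "{..<l}" l] by simp
    also have "\<dots> \<le> ?F" using l R by (intro mult_mono fact_mono power_increasing) auto
    finally show ?thesis .
  qed
  have cN: "real (card {T :: ('d \<times> 2) set. card T = l}) \<le> real ?N" by (intro of_nat_mono card_mono) auto
  have "norm (act l g x) \<le> (\<Sum>S\<in>UNIV. \<bar>act l g x $ S\<bar>)" by (rule norm_le_l1_cart)
  also have "\<dots> \<le> (\<Sum>S\<in>(UNIV :: ('d \<times> 2) set set). real ?N * (?F * norm x))"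
  proof (rule sum_mono)
    fix S
    have "\<bar>act l g x $ S\<bar> = \<bar>\<Sum>T | card T = l. x $ T * act l g (axis T 1) $ S\<bar>"
      by (subst act_eq_sum) simp
    also have "\<dots> \<le> (\<Sum>T | card T = l. \<bar>x $ T * act l g (axis T 1) $ S\<bar>)" by (rule sum_abs)
    also have "\<dots> \<le> (\<Sum>T\<in>{T :: ('d \<times> 2) set. card T = l}. norm x * ?F)"
      unfolding abs_mult by (intro sum_mono mult_mono) (simp_all add: ax component_le_norm_cart)
    also have "\<dots> \<le> real ?N * (norm x * ?F)"
      unfolding sum_constant by (rule mult_right_mono[OF cN]) (use F in simp)
    finally show "\<bar>act l g x $ S\<bar> \<le> real ?N * (?F * norm x)" by (simp add: mult_ac)
  qed
  also have "\<dots> = C * norm x" by (simp add: C_def)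
  finally show "norm (act l g x) \<le> C * norm x" .
qed

text \<open>Coordinate \<open>S\<close> along the unipotent orbit of \<open>x\<close>, as a
  polynomial in the parameter: the Leibniz formula for \<open>rho (unip y)\<close> with the
  indeterminate in place of \<open>y\<close>. Roots and degrees then become available.\<close>

definition upoly :: "nat \<Rightarrow> real^(('d::finite \<times> 2) set) \<Rightarrow> ('d \<times> 2) set \<Rightarrow> real poly" where
  "upoly l x S = (\<Sum>T | card T = l. smult (x $ T) (if card S = l then
     \<Sum>p | p permutes {..<l}. smult (of_int (sign p)) (\<Prod>a<l.
       let s = from_nat_into S (p a); q = from_nat_into T a
       in if fst s = fst q then if snd s = snd q then 1 else if snd s = 1 then [:0, 1:] else 0 else 0) else 0))"

lemma poly_upoly: "poly (upoly l x S) y = act l (unip y) x $ S"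
proof -
  have ent: "poly (if fst s = fst q then if snd s = snd q then 1 else if snd s = 1 then [:0, 1:] else 0 else 0) y
      = rho (unip y) $ s $ q" for s q :: "'d::finite \<times> 2"
    using exhaust_2[of "snd s"] exhaust_2[of "snd q"] by (auto simp: rho_def)
  have ax: "act l (unip y) (axis T 1) $ S = (if card S = l then
      \<Sum>p | p permutes {..<l}. of_int (sign p) * (\<Prod>a<l. rho (unip y) $ from_nat_into S (p a) $ from_nat_into T a) else 0)"
    if "card T = l" for T
    using ext_map_nth_axis[OF _ that, of S] ext_pow_nth[OF ext_map_in_ext_pow, of S l] by auto
  have "act l (unip y) x $ S = (\<Sum>T | card T = l. x $ T * act l (unip y) (axis T 1) $ S)"
    by (subst act_eq_sum) simp
  also have "\<dots> = poly (upoly l x S) y"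
    unfolding upoly_def poly_sum poly_smult
    by (intro sum.cong refl arg_cong2[of _ _ _ _ "(*)"]) (auto simp: ax poly_sum poly_prod Let_def ent)
  finally show ?thesis ..
qed

lemma unip_conj: "t \<noteq> 0 \<Longrightarrow> unip (t\<^sup>2 * y) = diag2 t ** unip y ** diag2 (1/t)"
  by (simp add: mat2_eq_iff mat2_mult_nth power2_eq_square)

lemma unip_add: "unip (y + z) = unip y ** unip z"
  by (simp add: mat2_eq_iff mat2_mult_nth add.commute)

lemma unip_zero: "unip 0 = mat 1"
  by (simp add: mat2_eq_iff mat_def)

text \<open>When \<open>unip (t^2)\<close> is written as a conjugate of \<open>unip 1\<close> by
  \<open>diag2 t\<close>, the right factor inflates the vector by at most \<open>t powr m\<close>
  and the left one scales coordinate \<open>S\<close> by \<open>t powr weight S\<close>. So the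
  value at \<open>t^2\<close> has order at most \<open>t powr (weight S + m)\<close>.\<close>

lemma degree_upoly:
  fixes x :: "real^(('d::finite \<times> 2) set)"
  assumes l: "l \<le> 2 * CARD('d)" and x: "x \<in> ext_pow l" and S: "card S = l" and m: "m = min l (2 * CARD('d) - l)"
  shows "2 * real (degree (upoly l x S)) \<le> weight S + m"
proof (cases "upoly l x S = 0")
  case True
  then show ?thesis using weight_bounds[OF S] m by auto
next
  case False
  obtain C where C: "1 \<le> C" "\<And>l g x. l \<le> 2 * CARD('d) \<Longrightarrow> norm g \<le> max 1 (norm (unip 1)) \<Longrightarrow>
      norm (act l g (x :: real^(('d \<times> 2) set))) \<le> C * norm x"
    using act_bounded[of "max 1 (norm (unip 1))"] by auto
  show ?thesis
  proof (rule degree_le_of_growth[OF False])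
    fix t :: real assume t: "1 \<le> t"
    let ?z = "act l (unip 1) (act l (diag2 (1/t)) x)"
    have "act l (unip (t\<^sup>2)) x = act l (diag2 t) ?z"
      using unip_conj[of t 1] t by (simp add: act_mult)
    then have "\<bar>poly (upoly l x S) (t\<^sup>2)\<bar> = t powr weight S * \<bar>?z $ S\<bar>"
      using t by (simp add: poly_upoly act_diag ext_map_in_ext_pow abs_mult)
    also have "\<dots> \<le> t powr weight S * (C * (t powr m * norm x))"
    proof (rule mult_left_mono)
      have "\<bar>?z $ S\<bar> \<le> norm ?z" by (rule component_le_norm_cart)
      also have "\<dots> \<le> C * norm (act l (diag2 (1/t)) x)" by (rule C(2)[OF l]) simp
      also have "\<dots> \<le> C * (t powr m * norm x)" using C(1) norm_diag_bounds(2)[OF x t m] by (intro mult_left_mono) auto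
      finally show "\<bar>?z $ S\<bar> \<le> C * (t powr m * norm x)" .
    qed simp
    also have "\<dots> = (C * norm x) * t powr (weight S + m)" by (simp add: powr_add)
    finally show "\<bar>poly (upoly l x S) (t\<^sup>2)\<bar> \<le> (C * norm x) * t powr (weight S + m)" .
  qed
qed

text \<open>An elementary substitute for the fact that highest weight vectors have nonnegative
  weight. Invariance gives \<open>norm v \<le> norm ?w\<close>; the factorisation \<open>dec\<close>
  expresses the squared norm of \<open>?w\<close> as the pairing of \<open>v\<close> with
  \<open>diag2 2\<close> applied to \<open>v\<close>, which is smaller than that of \<open>v\<close>
  if only negative weights occur.\<close>

lemma unip_invariant_negative_zero:
  fixes v :: "real^(('d::finite \<times> 2) set)"
  assumes v: "v \<in> ext_pow l" and fixed: "act l (unip 1) v = v" "act l (unip (1/2)) v = v"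
    and neg: "\<And>S. card S = l \<Longrightarrow> 0 \<le> weight S \<Longrightarrow> v $ S = 0"
  shows "v = 0"
proof (rule ccontr)
  assume nz: "v \<noteq> 0"
  let ?w = "act l (transpose (unip 1)) v"
  have w: "?w \<in> ext_pow l" by (rule ext_map_in_ext_pow)
  have "v \<bullet> v = v \<bullet> ?w" using act_transpose[OF v v, of "unip 1"] fixed(1) by simp
  also have "\<dots> \<le> norm v * norm ?w" by (rule norm_cauchy_schwarz)
  finally have "norm v * norm v \<le> norm v * norm ?w" by (simp add: dot_square_norm power2_eq_square)
  then have le: "norm v \<le> norm ?w" using nz by simp
  \<comment> \<open>Triangular decomposition of the symmetric matrix with rows (2, 1) and (1, 1).
    The outer factors are a unipotent and its transpose, both absorbed by the invariance of
    \<open>v\<close>.\<close>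
  have dec: "unip 1 ** transpose (unip 1) = transpose (unip (1/2)) ** (diag2 2 ** unip (1/2))"
    by (simp add: mat2_eq_iff mat2_mult_nth transpose_def)
  have "?w \<bullet> ?w = act l (unip 1) ?w \<bullet> v"
    using act_transpose[OF w v, of "unip 1"] by simp
  also have "act l (unip 1) ?w = act l (transpose (unip (1/2))) (act l (diag2 2) (act l (unip (1/2)) v))"
    by (simp flip: act_mult add: dec)
  also have "\<dots> \<bullet> v = v \<bullet> act l (diag2 2) v"
  proof -
    have d: "act l (diag2 2) v \<in> ext_pow l" by (rule ext_map_in_ext_pow)
    show ?thesis using act_transpose[OF v d, of "unip (1/2)"] fixed(2) by (simp add: inner_commute)
  qed
  also have "\<dots> = (\<Sum>S\<in>UNIV. v $ S * (2 powr weight S * v $ S))"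
    by (simp add: inner_vec_def act_diag[OF v])
  also have "\<dots> < (\<Sum>S\<in>UNIV. v $ S * v $ S)"
  proof (rule sum_strict_mono_ex1)
    have *: "v $ S * (2 powr weight S * v $ S) < v $ S * v $ S" if S: "v $ S \<noteq> 0" for S
    proof -
      have "card S = l" using ext_pow_nth[OF v] S by blast
      then have "weight S < 0" using neg[of S] S by (cases "0 \<le> weight S") auto
      then have "2 powr weight S < (1::real)" using powr_less_mono[of "weight S" 0 2] by simp
      then have "2 powr weight S * (v $ S * v $ S) < 1 * (v $ S * v $ S)"
        using S by (intro mult_strict_right_mono) (auto simp: zero_less_mult_iff)
      then show ?thesis by (simp add: mult_ac)
    qed
    then show "\<forall>S\<in>UNIV. v $ S * (2 powr weight S * v $ S) \<le> v $ S * v $ S"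
      by (metis less_imp_le mult_zero_left order_refl)
    obtain S where "v $ S \<noteq> 0" using nz by (auto simp: vec_eq_iff)
    then show "\<exists>S\<in>UNIV. v $ S * (2 powr weight S * v $ S) < v $ S * v $ S" using * by blast
  qed simp
  also have "\<dots> = v \<bullet> v" by (simp add: inner_vec_def)
  finally have "norm ?w < norm v" by (simp add: norm_eq_sqrt_inner)
  with le show False by simp
qed

text \<open>The coefficients of top degree in \<open>y\<close> form a vector that is invariant under
  unipotents, because a shift of \<open>y\<close> does not change leading coefficients. Such a
  vector cannot live in negative weights alone.\<close>

lemma upoly_nonzero:
  fixes x :: "real^(('d::finite \<times> 2) set)"
  assumes x: "x \<in> ext_pow l" "x \<noteq> 0"
  shows "\<exists>S. card S = l \<and> 0 \<le> weight S \<and> upoly l x S \<noteq> 0"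
proof (rule ccontr)
  assume "\<not> ?thesis"
  then have zero: "upoly l x S = 0" if "card S = l" "0 \<le> weight S" for S using that by blast
  define D where "D = Max (range (\<lambda>S. degree (upoly l x S)))"
  have deg: "degree (upoly l x S) \<le> D" for S unfolding D_def by (rule Max_ge) auto
  define v where "v = (\<chi> S. coeff (upoly l x S) D)"
  have off: "upoly l x S = 0" if "card S \<noteq> l" for S using that by (simp add: upoly_def)
  have v: "v \<in> ext_pow l" unfolding ext_pow_iff by (simp add: v_def off)
  have "v \<noteq> 0"
  proof -
    obtain S1 where S1: "upoly l x S1 \<noteq> 0"
    proof -
      obtain S1 where "x $ S1 \<noteq> 0" using x(2) by (auto simp: vec_eq_iff)
      then have "poly (upoly l x S1) 0 \<noteq> 0" using x(1) by (simp add: poly_upoly unip_zero act_one)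
      then show ?thesis using that by force
    qed
    have "D \<in> range (\<lambda>S. degree (upoly l x S))" unfolding D_def by (rule Max_in) auto
    then obtain S0 where S0: "D = degree (upoly l x S0)" by auto
    show ?thesis
    proof (cases "upoly l x S0 = 0")
      \<comment> \<open>Then \<open>D\<close> is 0, so all coordinates are constant and the one at
        \<open>S1\<close> serves.\<close>
      case True
      then have "degree (upoly l x S1) = D" using S0 deg[of S1] by simp
      then have "v $ S1 \<noteq> 0" using S1 by (auto simp: v_def)
      then show ?thesis by auto
    next
      case False
      then have "v $ S0 \<noteq> 0" using S0 by (simp add: v_def)
      then show ?thesis by auto
    qed
  qed
  have fixed: "act l (unip z) v = v" for z
  proof (subst vec_eq_iff, rule allI)
    fix S
    \<comment> \<open>At \<open>y\<close> both sides are coordinate \<open>S\<close> of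
      \<open>unip (z + y)\<close> applied to \<open>x\<close>; comparing coefficients of degree
      \<open>D\<close> gives the invariance.\<close>
    have "(\<Sum>T | card T = l. smult (act l (unip z) (axis T 1) $ S) (upoly l x T)) = pcompose (upoly l x S) [:z, 1:]"
    proof (subst poly_eq_poly_eq_iff[symmetric], rule ext)
      fix y
      have "act l (unip (z + y)) x $ S = (\<Sum>T | card T = l. act l (unip y) x $ T * act l (unip z) (axis T 1) $ S)"
        unfolding unip_add act_mult by (subst act_eq_sum) simp
      then show "poly (\<Sum>T | card T = l. smult (act l (unip z) (axis T 1) $ S) (upoly l x T)) y
          = poly (pcompose (upoly l x S) [:z, 1:]) y"
        by (simp add: poly_sum poly_upoly poly_pcompose mult_ac)
    qed
    then have "(\<Sum>T | card T = l. act l (unip z) (axis T 1) $ S * v $ T) = coeff (pcompose (upoly l x S) [:z, 1:]) D"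
      by (simp add: v_def coeff_sum[symmetric] flip: coeff_smult) 
    also have "\<dots> = coeff (upoly l x S) D"
    proof (cases "degree (upoly l x S) = D")
      case True
      then show ?thesis using lead_coeff_comp[of "[:z, 1:]" "upoly l x S"] by (simp add: degree_pcompose)
    next
      case False
      then have "degree (upoly l x S) < D" using deg[of S] by simp
      then show ?thesis by (simp add: coeff_eq_0 degree_pcompose)
    qed
    also have "(\<Sum>T | card T = l. act l (unip z) (axis T 1) $ S * v $ T) = act l (unip z) v $ S"
      by (subst (2) act_eq_sum) (simp add: mult_ac)
    finally show "act l (unip z) v $ S = v $ S" by (simp add: v_def)
  qed
  have "v = 0" by (rule unip_invariant_negative_zero[OF v fixed fixed]) (simp add: v_def zero)
  with \<open>v \<noteq> 0\<close> show False by simp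
qed

text \<open>Compactness of the unit sphere turns nonvanishing into a uniform lower bound. Sampling
  \<open>y\<close> at finitely many points makes the quantity a finite sum, visibly continuous in
  \<open>x\<close>.\<close>

lemma nondegenerate:
  assumes l: "l \<le> 2 * CARD('d::finite)"
  obtains c where "0 < c"
    "\<And>x :: real^(('d \<times> 2) set). x \<in> ext_pow l \<Longrightarrow> x \<noteq> 0 \<Longrightarrow>
       \<exists>S y. card S = l \<and> 0 \<le> weight S \<and> y \<in> {0..1} \<and> c * norm x \<le> \<bar>act l (unip y) x $ S\<bar>"
proof -
  let ?d = "CARD('d)"
  define A where "A = {S :: ('d \<times> 2) set. card S = l \<and> 0 \<le> weight S}"
  \<comment> \<open>One sample point more than the degree bound 2d.\<close>
  define Y where "Y = (\<lambda>i. real i / real (2 * ?d)) ` {..2 * ?d}"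
  define \<Phi> where "\<Phi> x = (\<Sum>S\<in>A. \<Sum>y\<in>Y. \<bar>act l (unip y) x $ S\<bar>)" for x :: "real^(('d \<times> 2) set)"
  have dpos: "0 < real (2 * ?d)" by simp
  have Y: "finite Y" "card Y = Suc (2 * ?d)" "Y \<subseteq> {0..1}"
    unfolding Y_def by (auto simp: card_image inj_on_def divide_simps)
  have pos: "0 < \<Phi> x" if x: "x \<in> ext_pow l" "x \<noteq> 0" for x
  proof -
    obtain S where S: "card S = l" "0 \<le> weight S" "upoly l x S \<noteq> 0" using upoly_nonzero[OF x] by auto
    have "2 * real (degree (upoly l x S)) \<le> weight S + real (min l (2 * ?d - l))"
      by (rule degree_upoly[OF l x(1) S(1) refl])
    moreover have "\<bar>weight S\<bar> \<le> real (min l (2 * ?d - l))" using weight_bounds[OF S(1)] .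
    ultimately have "real (degree (upoly l x S)) \<le> real (min l (2 * ?d - l))" by linarith
    then have deg: "degree (upoly l x S) \<le> 2 * ?d" using l by simp
    have "\<exists>y\<in>Y. poly (upoly l x S) y \<noteq> 0"
    proof (rule ccontr)
      assume "\<not> ?thesis"
      then have "Y \<subseteq> {y. poly (upoly l x S) y = 0}" by auto
      then have "card Y \<le> card {y. poly (upoly l x S) y = 0}"
        using S(3) by (intro card_mono poly_roots_finite)
      also have "\<dots> \<le> degree (upoly l x S)" using S(3) by (rule card_poly_roots_bound)
      finally show False using deg Y(2) by simp
    qed
    then obtain y where y: "y \<in> Y" "act l (unip y) x $ S \<noteq> 0" by (auto simp: poly_upoly)
    have "0 < (\<Sum>y\<in>Y. \<bar>act l (unip y) x $ S\<bar>)" using y Y(1) by (intro sum_pos2[of _ y]) auto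
    then show ?thesis unfolding \<Phi>_def using S by (intro sum_pos2[of _ S]) (auto simp: A_def intro: sum_nonneg)
  qed
  have "continuous_on UNIV \<Phi>"
    unfolding \<Phi>_def
    by (intro continuous_on_sum continuous_on_rabs continuous_on_component linear_continuous_on linear_linear[THEN iffD2] linear_ext_map)
  then have cont: "continuous_on (sphere 0 1 \<inter> ext_pow l) \<Phi>" by (rule continuous_on_subset) auto
  have comp: "compact (sphere 0 1 \<inter> ext_pow l :: (real^(('d \<times> 2) set)) set)"
    by (intro compact_Int_closed compact_sphere closed_subspace) (simp add: ext_pow_def)
  obtain c0 where c0: "0 < c0" "\<And>x. x \<in> sphere 0 1 \<inter> ext_pow l \<Longrightarrow> c0 \<le> \<Phi> x"
  proof (cases "sphere 0 1 \<inter> ext_pow l = ({} :: (real^(('d \<times> 2) set)) set)")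
    case True
    then show ?thesis using that[of 1] by auto
  next
    case False
    then obtain x where x: "x \<in> sphere 0 1 \<inter> ext_pow l" "\<And>y. y \<in> sphere 0 1 \<inter> ext_pow l \<Longrightarrow> \<Phi> x \<le> \<Phi> y"
      using continuous_attains_inf[OF comp _ cont] by blast
    then have "0 < \<Phi> x" by (intro pos) auto
    with x(2) show ?thesis using that by blast
  qed
  \<comment> \<open>Strictly smaller than \<open>c0\<close> divided by the number of terms of
    \<open>\<Phi>\<close>, and meaningful also when there are none.\<close>
  define c where "c = c0 / (2 * (real (card A) * real (card Y) + 1))"
  have cpos: "0 < c" unfolding c_def using c0 by (intro divide_pos_pos mult_pos_pos add_nonneg_pos) auto
  show ?thesis
  proof (rule that[OF cpos])
    fix x :: "real^(('d \<times> 2) set)" assume x: "x \<in> ext_pow l" "x \<noteq> 0"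
    show "\<exists>S y. card S = l \<and> 0 \<le> weight S \<and> y \<in> {0..1} \<and> c * norm x \<le> \<bar>act l (unip y) x $ S\<bar>"
    proof (rule ccontr)
      assume no: "\<not> ?thesis"
      have small: "\<bar>act l (unip y) x $ S\<bar> \<le> c * norm x" if "S \<in> A" "y \<in> Y" for S y
      proof (rule ccontr)
        assume "\<not> \<bar>act l (unip y) x $ S\<bar> \<le> c * norm x"
        then have "c * norm x \<le> \<bar>act l (unip y) x $ S\<bar>" by simp
        moreover have "card S = l" "0 \<le> weight S" "y \<in> {0..1}" using that Y(3) by (auto simp: A_def)
        ultimately show False using no by blast
      qed
      let ?u = "(1 / norm x) *\<^sub>R x"
      have "?u \<in> sphere 0 1 \<inter> ext_pow l" using x by (auto simp: ext_pow_def intro: span_scale)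
      then have "c0 \<le> \<Phi> ?u" by (rule c0(2))
      also have "\<Phi> ?u = (1 / norm x) * \<Phi> x"
        by (simp add: \<Phi>_def linear_scale[OF linear_ext_map] abs_mult sum_distrib_left)
      also have "\<dots> \<le> (1 / norm x) * (\<Sum>S\<in>A. \<Sum>y\<in>Y. c * norm x)"
        unfolding \<Phi>_def using small by (intro mult_left_mono sum_mono) auto
      also have "\<dots> = c * (real (card A) * real (card Y))" using x(2) by simp
      also have "\<dots> < c0"
      proof -
        have *: "c0 / (2 * (P + 1)) * P < c0" if "0 \<le> P" for P
        proof -
          have "P / (2 * (P + 1)) < 1" using that by (simp add: divide_simps)
          then have "c0 * (P / (2 * (P + 1))) < c0 * 1" using c0(1) by (intro mult_strict_left_mono)
          then show ?thesis by simp
        qed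
        show ?thesis unfolding c_def by (rule *) simp
      qed
      finally show False by simp
    qed
  qed
qed

section \<open>Averages of a single vector\<close>

text \<open>All weights are at least \<open>- m\<close>, which limits how far a vector can shrink;
  this caps the ratios that occur in the averages.\<close>

lemma norm_act_lower:
  assumes l: "l \<le> 2 * CARD('d::finite)" and m: "m = min l (2 * CARD('d) - l)"
  obtains C where "1 \<le> C"
    "\<And>n y x. x \<in> ext_pow l \<Longrightarrow> y \<in> {0..1} \<Longrightarrow>
       norm (x :: real^(('d \<times> 2) set)) \<le> C * 2 powr (real m * real n) * norm (act l (diag2 (2^n) ** unip y) x)"
proof -
  obtain C where C: "1 \<le> C" "\<And>l g x. l \<le> 2 * CARD('d) \<Longrightarrow> norm g \<le> 4 \<Longrightarrow>
      norm (act l g (x :: real^(('d \<times> 2) set))) \<le> C * norm x"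
    using act_bounded[of 4] by auto
  show ?thesis
  proof (rule that[OF C(1)])
    fix n y and x :: "real^(('d \<times> 2) set)" assume x: "x \<in> ext_pow l" and y: "y \<in> {0..1::real}"
    have "norm (unip (-y)) \<le> norm (unip (-y) $ 1) + norm (unip (-y) $ 2)"
      using L2_set_le_sum[of UNIV "\<lambda>i. norm (unip (-y) $ i)"] by (simp add: norm_vec_def sum_2)
    also have "\<dots> \<le> (\<bar>1\<bar> + \<bar>-y\<bar>) + (\<bar>0\<bar> + \<bar>1\<bar>)"
      using norm_le_l1_cart[of "unip (-y) $ 1"] norm_le_l1_cart[of "unip (-y) $ 2"] by (simp add: sum_2)
    also have "\<dots> \<le> 4" using y by simp
    finally have u: "norm (unip (-y)) \<le> 4" .
    have "unip (-y) ** unip y = mat 1" using unip_add[of "-y" y] by (simp add: unip_zero)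
    then have "x = act l (unip (-y)) (act l (unip y) x)"
      using x by (simp add: act_one flip: act_mult)
    then have "norm x \<le> C * norm (act l (unip y) x)" using C(2)[OF l u] by metis
    also have "norm (act l (unip y) x) \<le> (2^n) powr m * norm (act l (diag2 (2^n)) (act l (unip y) x))"
      by (rule norm_diag_bounds(3)[OF ext_map_in_ext_pow _ m]) (simp add: one_le_power)
    also have "(2^n) powr m = 2 powr (real m * real n)"
      by (simp add: powr_realpow[symmetric] powr_powr mult.commute)
    finally show "norm x \<le> C * 2 powr (real m * real n) * norm (act l (diag2 (2^n) ** unip y) x)"
      using C(1) by (simp add: act_mult mult.assoc mult_left_mono)
  qed
qed

lemma act_unip_continuous: "continuous_on UNIV (\<lambda>y. act l (A ** unip y) x)"
proof -
  have "continuous_on UNIV (\<lambda>y. act l (unip y) x)"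
  proof -
    have eq: "(\<lambda>y. act l (unip y) x) = (\<lambda>y. \<chi> S. poly (upoly l x S) y)"
      by (simp add: poly_upoly fun_eq_iff)
    show ?thesis unfolding eq by (intro continuous_on_vec_lambda continuous_intros)
  qed
  moreover have "continuous_on ((\<lambda>y. act l (unip y) x) ` UNIV) (act l A)"
    by (intro linear_continuous_on linear_linear[THEN iffD2] linear_ext_map)
  ultimately have "continuous_on UNIV (act l A \<circ> (\<lambda>y. act l (unip y) x))"
    by (rule continuous_on_compose)
  then show ?thesis by (simp add: comp_def act_mult)
qed

text \<open>Before \<open>diag2 (2^n)\<close> acts, a coordinate of weight \<open>W\<close> is on
  this set at most \<open>2 powr (- (W * n)) / lam\<close> times \<open>norm x\<close>, yet it is of
  order \<open>norm x\<close> somewhere on the unit interval. The Remez bound then limits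
  \<open>\<mu>^r\<close>. If the set is nonempty, \<open>lam\<close> is at most about
  \<open>2 powr (m * n)\<close>, which converts the scale \<open>n\<close> into a power of
  \<open>lam\<close>.\<close>

lemma sublevel_measure:
  assumes l: "1 \<le> l" "l < 2 * CARD('d::finite)" and m: "m = min l (2 * CARD('d) - l)"
  obtains C where "1 \<le> C"
    "\<And>n x lam. (x :: real^(('d \<times> 2) set)) \<in> ext_pow l \<Longrightarrow> x \<noteq> 0 \<Longrightarrow> 1 \<le> lam \<Longrightarrow>
       emeasure lborel {y\<in>{0..<1}. lam * norm (act l (diag2 (2^n) ** unip y) x) \<le> norm x}
       \<le> ennreal (C * lam powr (- 2 / CARD('d)))"
proof -
  let ?d = "CARD('d)"
  have l': "l \<le> 2 * ?d" using l by simp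
  have m1: "1 \<le> m" "m \<le> ?d" using l m by auto
  obtain C1 where C1: "1 \<le> C1" "\<And>n y x. x \<in> ext_pow l \<Longrightarrow> y \<in> {0..1} \<Longrightarrow>
       norm (x :: real^(('d \<times> 2) set)) \<le> C1 * 2 powr (real m * real n) * norm (act l (diag2 (2^n) ** unip y) x)"
    using norm_act_lower[OF l' m] by metis
  obtain c where c: "0 < c" "\<And>x :: real^(('d \<times> 2) set). x \<in> ext_pow l \<Longrightarrow> x \<noteq> 0 \<Longrightarrow>
       \<exists>S y. card S = l \<and> 0 \<le> weight S \<and> y \<in> {0..1} \<and> c * norm x \<le> \<bar>act l (unip y) x $ S\<bar>"
    using nondegenerate[OF l'] by metis
  define G where "G = real (Suc (2 * ?d)) * (4 * real (Suc (2 * ?d)))^(2 * ?d)"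
  define C2 where "C2 = max 1 (G / c) * C1"
  have C2: "1 \<le> C2" unfolding C2_def using C1(1) mult_mono[of 1 "max 1 (G / c)" 1 C1] by simp
  show ?thesis
  proof (rule that[of "C2\<^sup>2"])
    show "1 \<le> C2\<^sup>2" using C2 by (simp add: one_le_power)
    fix n and x :: "real^(('d \<times> 2) set)" and lam :: real
    assume x: "x \<in> ext_pow l" "x \<noteq> 0" and lam: "1 \<le> lam"
    let ?a = "\<lambda>y. act l (diag2 (2^n) ** unip y) x"
    define B where "B = {y\<in>{0..<1}. lam * norm (?a y) \<le> norm x}"
    have Bm: "B \<in> sets lborel"
    proof -
      have [measurable]: "(\<lambda>y. norm (?a y)) \<in> borel_measurable borel"
        using act_unip_continuous by (intro borel_measurable_continuous_onI continuous_on_norm)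
      show ?thesis unfolding B_def by measurable
    qed
    have B1: "emeasure lborel B \<le> ennreal 1"
    proof -
      have "emeasure lborel B \<le> emeasure lborel {0..<1::real}" by (rule emeasure_mono) (auto simp: B_def)
      then show ?thesis by simp
    qed
    define \<mu> where "\<mu> = measure lborel B"
    have Be: "emeasure lborel B = ennreal \<mu>"
      unfolding \<mu>_def using B1 by (intro emeasure_eq_ennreal_measure) (auto simp: top_unique)
    have \<mu>1: "\<mu> \<le> 1" using B1 unfolding Be by simp
    have "\<mu> \<le> C2\<^sup>2 * lam powr (- 2 / ?d)"
    proof (cases "\<mu> \<le> 0")
      case True
      then show ?thesis using order_trans[OF True, of "C2\<^sup>2 * lam powr (- 2 / ?d)"] by simp
    next
      case False
      then have \<mu>: "0 < \<mu>" by simp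
      then obtain y0 where y0: "y0 \<in> B" using Be by (cases "B = {}") auto
      have nx: "0 < norm x" using x by simp
      have lamC: "lam \<le> C1 * 2 powr (real m * real n)"
      proof -
        have "lam * norm x \<le> lam * (C1 * 2 powr (real m * real n) * norm (?a y0))"
          using C1(2)[OF x(1), of y0 n] y0 lam by (intro mult_left_mono) (auto simp: B_def)
        also have "\<dots> \<le> C1 * 2 powr (real m * real n) * norm x"
          using mult_left_mono[of "lam * norm (?a y0)" "norm x" "C1 * 2 powr (real m * real n)"] y0 C1(1)
          by (auto simp: B_def mult_ac)
        finally show ?thesis using nx by simp
      qed
      obtain S y where S: "card S = l" "0 \<le> weight S" "y \<in> {0..1}" "c * norm x \<le> \<bar>act l (unip y) x $ S\<bar>"
        using c(2)[OF x] by auto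
      define W where "W = weight S"
      define r where "r = degree (upoly l x S)"
      have r: "2 * real r \<le> W + m" unfolding r_def W_def by (rule degree_upoly[OF l' x(1) S(1) m])
      have W: "0 \<le> W" "W \<le> m" using S(2) weight_bounds[OF S(1)] m by (auto simp: W_def)
      have rd: "r \<le> 2 * ?d" using r W m1 by linarith
      let ?\<epsilon> = "2 powr (- (W * n)) * norm x / lam"
      have eps: "\<bar>poly (upoly l x S) z\<bar> \<le> ?\<epsilon>" if z: "z \<in> B" for z
      proof -
        have "?a z $ S = (2^n) powr W * (act l (unip z) x $ S)"
          unfolding act_mult W_def by (rule act_diag) (auto simp: ext_map_in_ext_pow)
        also have "(2^n) powr W = 2 powr (W * n)"
          by (simp add: powr_realpow[symmetric] powr_powr mult.commute)
        finally have "2 powr (W * n) * \<bar>act l (unip z) x $ S\<bar> = \<bar>?a z $ S\<bar>" by (simp add: abs_mult)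
        also have "\<dots> \<le> norm (?a z)" by (rule component_le_norm_cart)
        also have "\<dots> \<le> norm x / lam" using z lam by (simp add: B_def field_simps)
        finally have "\<bar>act l (unip z) x $ S\<bar> \<le> norm x / lam / 2 powr (W * n)"
          by (subst pos_le_divide_eq) (simp_all add: mult.commute)
        then show ?thesis unfolding poly_upoly by (simp add: powr_minus divide_inverse mult_ac)
      qed
      have "c * norm x * \<mu>^r \<le> \<bar>poly (upoly l x S) y\<bar> * \<mu>^r"
        using S(4) \<mu> by (intro mult_right_mono) (auto simp: poly_upoly)
      also have "\<dots> \<le> real (Suc r) * (4 * real (Suc r))^r * ?\<epsilon>"
        by (rule remez[OF _ Bm _ Be \<mu> eps S(3)]) (auto simp: r_def B_def)
      also have "\<dots> \<le> G * ?\<epsilon>"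
      proof (rule mult_right_mono)
        have "(4 * real (Suc r))^r \<le> (4 * real (Suc (2 * ?d)))^r" using rd by (intro power_mono) auto
        also have "\<dots> \<le> (4 * real (Suc (2 * ?d)))^(2 * ?d)" using rd by (intro power_increasing) auto
        finally show "real (Suc r) * (4 * real (Suc r))^r \<le> G"
          unfolding G_def using rd by (intro mult_mono) auto
      qed (use lam in auto)
      finally have "c * (\<mu>^r * norm x) \<le> c * ((G / c * (2 powr (- (W * n)) / lam)) * norm x)"
        using c(1) by (simp add: mult_ac)
      then have "\<mu>^r * norm x \<le> (G / c * (2 powr (- (W * n)) / lam)) * norm x" using c(1) by (rule mult_left_le_imp_le)
      then have "\<mu>^r \<le> G / c * (2 powr (- (W * n)) / lam)" using nx by (rule mult_right_le_imp_le)
      also have "\<dots> \<le> max 1 (G / c) * (2 powr (- (W * n)) / lam)" using lam by (intro mult_right_mono) auto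
      finally have 1: "\<mu>^r \<le> max 1 (G / c) * (2 powr (- (W * n)) / lam)" .
      \<comment> \<open>Raising \<open>lamC\<close> to the power \<open>W / m\<close> trades the
        scale \<open>n\<close> for \<open>lam\<close>, so that the final bound is uniform in
        \<open>n\<close>.\<close>
      have 2: "2 powr (- (W * n)) \<le> C1 * lam powr (- (W / m))"
      proof -
        have "(lam / C1) powr (W / m) \<le> (2 powr (real m * real n)) powr (W / m)"
          using lamC C1(1) lam W by (intro powr_mono2) (auto simp: field_simps)
        also have "\<dots> = 2 powr (W * n)" using m1 by (simp add: powr_powr mult.commute)
        finally have "2 powr (- (W * n)) \<le> 1 / (lam / C1) powr (W / m)"
          using lam C1(1) by (simp add: powr_minus_divide frac_le)
        also have "\<dots> = C1 powr (W / m) * lam powr (- (W / m))"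
          using lam C1(1) by (simp add: powr_divide powr_minus_divide)
        also have "\<dots> \<le> C1 powr 1 * lam powr (- (W / m))"
          using C1(1) W m1 by (intro mult_right_mono powr_mono) (auto simp: divide_le_eq)
        finally show ?thesis using C1(1) by simp
      qed
      \<comment> \<open>An upper bound for the degree \<open>r\<close> that stays positive even for
        \<open>r = 0\<close>. As \<open>\<mu> \<le> 1\<close>, the exponent may be raised to
        \<open>h\<close>; the exponent of \<open>lam\<close> is then a multiple of \<open>h\<close>
        too, so \<open>W\<close> cancels.\<close>
      define h where "h = (W + m) / 2"
      have h: "real r \<le> h" "real m / 2 \<le> h" "0 < h" using r W m1 by (auto simp: h_def)
      have "\<mu> powr h \<le> \<mu> powr (real r)" using \<mu> \<mu>1 h(1) by (intro powr_mono') auto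
      also have "\<dots> = \<mu>^r" using \<mu> by (simp add: powr_realpow)
      also have "\<dots> \<le> max 1 (G / c) * (C1 * lam powr (- (W / m)) / lam)"
        using 1 2 lam by (elim order_trans) (intro mult_left_mono divide_right_mono, auto)
      also have "\<dots> = C2 * (lam powr (- (W / m)) * lam powr (-1))"
        using lam by (simp add: C2_def powr_minus_divide)
      also have "lam powr (- (W / m)) * lam powr (-1) = lam powr (- 2 * h / m)"
        unfolding powr_add[symmetric] using m1 by (intro arg_cong[of _ _ "(powr) lam"]) (simp add: h_def field_simps)
      finally have "(\<mu> powr h) powr (1/h) \<le> (C2 * lam powr (- 2 * h / m)) powr (1/h)"
        using h(3) by (intro powr_mono2) auto
      then have "\<mu> \<le> C2 powr (1/h) * lam powr (- 2 / m)"
        using h(3) \<mu> C2 by (simp add: powr_powr powr_mult)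
      also have "\<dots> \<le> C2 powr 2 * lam powr (- 2 / ?d)"
      proof (intro mult_mono powr_mono)
        have "1 / h \<le> 1 / (real m / 2)" using h m1 by (intro divide_left_mono) auto
        also have "\<dots> \<le> 2" using m1 by (simp add: divide_le_eq)
        finally show "1 / h \<le> 2" .
        show "- 2 / real m \<le> - 2 / real ?d" using m1 by (simp add: frac_le)
      qed (use C2 lam in auto)
      also have "C2 powr 2 = C2\<^sup>2" using C2 by (simp add: powr_numeral)
      finally show ?thesis .
    qed
    then show "emeasure lborel {y\<in>{0..<1}. lam * norm (?a y) \<le> norm x} \<le> ennreal (C2\<^sup>2 * lam powr (- 2 / ?d))"
      unfolding B_def[symmetric] Be by (rule ennreal_leI)
  qed
qed

text \<open>Dyadic layers: the ratio exceeds \<open>2 powr i\<close> on a set of measure at most a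
  constant times \<open>2 powr (- 2 * i / d)\<close>, so layer \<open>i\<close> contributes about
  \<open>2 powr (\<theta> * i)\<close>. As \<theta> is positive the last layer dominates, and the
  ratio is at most about \<open>2 powr (m * n)\<close>.\<close>

lemma single_vector_average:
  assumes l: "1 \<le> l" "l < 2 * CARD('d::finite)" and m: "m = min l (2 * CARD('d) - l)"
    and \<theta>: "\<theta> = \<beta> - 2 / CARD('d)" "0 < \<theta>" and \<beta>: "0 < \<beta>"
  obtains C where "1 \<le> C"
    "\<And>n x. (x :: real^(('d \<times> 2) set)) \<in> ext_pow l \<Longrightarrow> x \<noteq> 0 \<Longrightarrow>
       (\<integral>\<^sup>+y\<in>{0..<1}. ennreal ((norm x / norm (act l (diag2 (2^n) ** unip y) x)) powr \<beta>) \<partial>lborel)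
       \<le> ennreal (C * 2 powr (\<theta> * real m * real n))"
proof -
  obtain C1 where C1: "1 \<le> C1" "\<And>n y x. x \<in> ext_pow l \<Longrightarrow> y \<in> {0..1} \<Longrightarrow>
       norm (x :: real^(('d \<times> 2) set)) \<le> C1 * 2 powr (real m * real n) * norm (act l (diag2 (2^n) ** unip y) x)"
    using norm_act_lower[OF less_imp_le[OF l(2)] m] by metis
  obtain C2 where C2: "1 \<le> C2" "\<And>n x lam. (x :: real^(('d \<times> 2) set)) \<in> ext_pow l \<Longrightarrow> x \<noteq> 0 \<Longrightarrow> 1 \<le> lam \<Longrightarrow>
       emeasure lborel {y\<in>{0..<1}. lam * norm (act l (diag2 (2^n) ** unip y) x) \<le> norm x}
       \<le> ennreal (C2 * lam powr (- 2 / CARD('d)))"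
    by (rule sublevel_measure[OF l m]) (erule that, blast)
  define q :: real where "q = 2 powr \<theta>"
  have q: "1 < q" using \<theta> by (simp add: q_def gr_one_powr)
  define D where "D = 1 + C2 * 2 powr \<beta> * (q / (q - 1))"
  have D: "1 \<le> D" unfolding D_def using C2(1) q by simp
  have E: "1 \<le> (2 * C1) powr \<theta>" using C1(1) \<theta> by (intro ge_one_powr_ge_zero) auto
  show ?thesis
  proof (rule that[of "D * (2 * C1) powr \<theta>"])
    show "1 \<le> D * (2 * C1) powr \<theta>" using mult_mono[OF D E] D by simp
    fix n and x :: "real^(('d \<times> 2) set)"
    assume x: "x \<in> ext_pow l" "x \<noteq> 0"
    let ?a = "\<lambda>y. act l (diag2 (2^n) ** unip y) x"
    define X where "X y = norm x / norm (?a y)" for y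
    define P where "P = C1 * 2 powr (real m * real n)"
    have P1: "1 \<le> P"
      unfolding P_def using C1(1) mult_mono[of 1 C1 1 "2 powr (real m * real n)"] by (simp add: ge_one_powr_ge_zero)
    have nx: "0 < norm x" using x by simp
    have apos: "0 < norm (?a y)" if "y \<in> {0..<1}" for y
    proof -
      have "0 < C1 * 2 powr (real m * real n) * norm (?a y)" by (rule less_le_trans[OF nx C1(2)[OF x(1)]]) (use that in auto)
      then show ?thesis by (auto simp: zero_less_mult_iff)
    qed
    have XP: "X y \<le> P" if "y \<in> {0..<1}" for y
      using C1(2)[OF x(1), of y n] apos[OF that] that by (simp add: X_def P_def pos_divide_le_eq)
    \<comment> \<open>The last layer; rounding up costs the 2 inside
      \<open>(2 * C1) powr \<theta>\<close>.\<close>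
    define N where "N = nat \<lceil>log 2 P\<rceil>"
    have lP: "0 \<le> log 2 P" using P1 by simp
    have N: "P \<le> 2 powr N" "2 powr N \<le> 2 * P"
    proof -
      have N': "log 2 P \<le> real N" "real N \<le> log 2 P + 1" using lP unfolding N_def by linarith+
      have "P = 2 powr (log 2 P)" using P1 by simp
      also have "\<dots> \<le> 2 powr N" using N'(1) by (intro powr_mono) auto
      finally show "P \<le> 2 powr N" .
      have "2 powr N \<le> 2 powr (log 2 P + 1)" using N'(2) by (intro powr_mono) auto
      also have "\<dots> = 2 * P" using P1 by (simp add: powr_add)
      finally show "2 powr N \<le> 2 * P" .
    qed
    define B where "B i = {y\<in>{0..<1}. 2 powr real i * norm (?a y) \<le> norm x}" for i :: nat
    have Bm [measurable]: "B i \<in> sets lborel" for i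
    proof -
      have [measurable]: "(\<lambda>y. norm (?a y)) \<in> borel_measurable borel"
        using act_unip_continuous by (intro borel_measurable_continuous_onI continuous_on_norm)
      show ?thesis unfolding B_def by measurable
    qed
    have pw: "X y powr \<beta> \<le> 1 + (\<Sum>i\<le>N. 2 powr (\<beta> * (real i + 1)) * indicator (B i) y)" if y: "y \<in> {0..<1}" for y
    proof (cases "X y \<le> 1")
      case True
      have "X y powr \<beta> \<le> 1 powr \<beta>" using True \<beta> by (intro powr_mono2) (auto simp: X_def)
      also have "\<dots> \<le> 1 + (\<Sum>i\<le>N. 2 powr (\<beta> * (real i + 1)) * indicator (B i) y)" by (simp add: sum_nonneg)
      finally show ?thesis .
    next
      case False
      define i where "i = nat \<lfloor>log 2 (X y)\<rfloor>"
      have lX: "0 \<le> log 2 (X y)" using False by simp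
      have i: "real i \<le> log 2 (X y)" "log 2 (X y) \<le> real i + 1" using lX unfolding i_def by linarith+
      have iX: "2 powr real i \<le> X y" using i(1) False by (simp add: le_log_iff)
      have Xi: "X y \<le> 2 powr (real i + 1)" using i(2) False by (simp add: log_le_iff)
      have "2 powr real i \<le> 2 powr real N" using iX XP[OF y] N(1) by linarith
      then have iN: "i \<le> N" by simp
      have yB: "y \<in> B i" using iX y apos[OF y] by (simp add: B_def X_def pos_le_divide_eq)
      have "X y powr \<beta> \<le> (2 powr (real i + 1)) powr \<beta>" using Xi False \<beta> by (intro powr_mono2) auto
      also have "\<dots> = 2 powr (\<beta> * (real i + 1)) * indicator (B i) y" using yB by (simp add: powr_powr mult.commute)
      also have "\<dots> \<le> (\<Sum>i\<le>N. 2 powr (\<beta> * (real i + 1)) * indicator (B i) y)" using iN by (intro member_le_sum) auto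
      finally show ?thesis by simp
    qed
    have "(\<integral>\<^sup>+y\<in>{0..<1}. ennreal (X y powr \<beta>) \<partial>lborel)
      \<le> (\<integral>\<^sup>+y. indicator {0..<1} y + (\<Sum>i\<le>N. ennreal (2 powr (\<beta> * (real i + 1))) * indicator (B i) y) \<partial>lborel)"
    proof (rule nn_integral_mono)
      fix y :: real
      show "ennreal (X y powr \<beta>) * indicator {0..<1} y
         \<le> indicator {0..<1} y + (\<Sum>i\<le>N. ennreal (2 powr (\<beta> * (real i + 1))) * indicator (B i) y)"
      proof (cases "y \<in> {0..<1}")
        case True
        have "ennreal (X y powr \<beta>) \<le> ennreal (1 + (\<Sum>i\<le>N. 2 powr (\<beta> * (real i + 1)) * indicator (B i) y))"
          by (rule ennreal_leI[OF pw[OF True]])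
        also have "\<dots> = 1 + (\<Sum>i\<le>N. ennreal (2 powr (\<beta> * (real i + 1)) * indicator (B i) y))"
          by (subst sum_ennreal) (simp_all add: ennreal_plus sum_nonneg)
        also have "(\<Sum>i\<le>N. ennreal (2 powr (\<beta> * (real i + 1)) * indicator (B i) y))
            = (\<Sum>i\<le>N. ennreal (2 powr (\<beta> * (real i + 1))) * indicator (B i) y)"
          by (intro sum.cong) (auto split: split_indicator)
        finally show ?thesis using True by simp
      qed simp
    qed
    also have "\<dots> = 1 + (\<Sum>i\<le>N. ennreal (2 powr (\<beta> * (real i + 1))) * emeasure lborel (B i))"
    proof -
      have "(\<integral>\<^sup>+y. indicator {0..<1} y + (\<Sum>i\<le>N. ennreal (2 powr (\<beta> * (real i + 1))) * indicator (B i) y) \<partial>lborel)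
        = (\<integral>\<^sup>+y. indicator {0..<1::real} y \<partial>lborel) + (\<integral>\<^sup>+y. (\<Sum>i\<le>N. ennreal (2 powr (\<beta> * (real i + 1))) * indicator (B i) y) \<partial>lborel)"
        by (rule nn_integral_add) measurable
      also have "(\<integral>\<^sup>+y. indicator {0..<1::real} y \<partial>lborel) = 1" by simp
      also have "(\<integral>\<^sup>+y. (\<Sum>i\<le>N. ennreal (2 powr (\<beta> * (real i + 1))) * indicator (B i) y) \<partial>lborel)
        = (\<Sum>i\<le>N. \<integral>\<^sup>+y. ennreal (2 powr (\<beta> * (real i + 1))) * indicator (B i) y \<partial>lborel)"
        by (rule nn_integral_sum) measurable
      also have "\<dots> = (\<Sum>i\<le>N. ennreal (2 powr (\<beta> * (real i + 1))) * emeasure lborel (B i))"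
        by (intro sum.cong refl nn_integral_cmult_indicator Bm)
      finally show ?thesis .
    qed
    also have "\<dots> \<le> 1 + (\<Sum>i\<le>N. ennreal (C2 * 2 powr \<beta> * q ^ i))"
    proof (intro add_left_mono sum_mono)
      fix i
      have "emeasure lborel (B i) \<le> ennreal (C2 * (2 powr real i) powr (- 2 / CARD('d)))"
        unfolding B_def by (rule C2(2)[OF x]) (simp add: ge_one_powr_ge_zero)
      then have "ennreal (2 powr (\<beta> * (real i + 1))) * emeasure lborel (B i)
        \<le> ennreal (2 powr (\<beta> * (real i + 1))) * ennreal (C2 * (2 powr real i) powr (- 2 / CARD('d)))"
        by (rule mult_left_mono) simp
      also have "\<dots> = ennreal (2 powr (\<beta> * (real i + 1)) * (C2 * (2 powr real i) powr (- 2 / CARD('d))))"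
        using C2(1) by (simp add: ennreal_mult)
      also have "2 powr (\<beta> * (real i + 1)) * (C2 * (2 powr real i) powr (- 2 / CARD('d))) = C2 * 2 powr \<beta> * q ^ i"
      proof -
        have "q ^ i = 2 powr (\<theta> * i)" by (simp add: q_def powr_realpow[symmetric] powr_powr)
        then show ?thesis unfolding \<theta>(1) by (simp add: powr_powr algebra_simps flip: powr_add)
      qed
      finally show "ennreal (2 powr (\<beta> * (real i + 1))) * emeasure lborel (B i) \<le> ennreal (C2 * 2 powr \<beta> * q ^ i)" .
    qed
    also have "\<dots> = ennreal (1 + (\<Sum>i\<le>N. C2 * 2 powr \<beta> * q ^ i))"
      using C2(1) q by (simp add: ennreal_plus sum_nonneg)
    also have "\<dots> \<le> ennreal (D * (2 * C1) powr \<theta> * 2 powr (\<theta> * real m * real n))"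
    proof (rule ennreal_leI)
      have "(\<Sum>i\<le>N. q ^ i) = (q ^ Suc N - 1) / (q - 1)"
        using q by (simp add: sum_gp0 field_simps)
      also have "\<dots> \<le> q ^ Suc N / (q - 1)" using q by (intro divide_right_mono) auto
      finally have "(\<Sum>i\<le>N. q ^ i) \<le> q ^ N * (q / (q - 1))" by (simp add: mult.commute)
      then have "1 + (\<Sum>i\<le>N. C2 * 2 powr \<beta> * q ^ i) \<le> q ^ N + C2 * 2 powr \<beta> * (q ^ N * (q / (q - 1)))"
        unfolding sum_distrib_left[symmetric] using q C2(1) by (intro add_mono mult_left_mono one_le_power) auto
      also have "\<dots> = D * q ^ N" by (simp add: D_def algebra_simps)
      also have "q ^ N = (2 powr N) powr \<theta>" by (simp add: q_def powr_realpow[symmetric] powr_powr mult.commute)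
      also have "\<dots> \<le> (2 * P) powr \<theta>" using N(2) \<theta> by (intro powr_mono2) auto
      also have "\<dots> = (2 * C1) powr \<theta> * 2 powr (\<theta> * real m * real n)"
        using C1(1) by (simp add: P_def powr_mult powr_powr mult_ac)
      finally show "1 + (\<Sum>i\<le>N. C2 * 2 powr \<beta> * q ^ i) \<le> D * (2 * C1) powr \<theta> * 2 powr (\<theta> * real m * real n)"
        using D by (simp add: mult_left_mono mult.assoc)
    qed
    finally show "(\<integral>\<^sup>+y\<in>{0..<1}. ennreal ((norm x / norm (?a y)) powr \<beta>) \<partial>lborel)
       \<le> ennreal (D * (2 * C1) powr \<theta> * 2 powr (\<theta> * real m * real n))" unfolding X_def .
  qed
qed

section \<open>Lattices in the standard position\<close>

definition Rat :: "nat \<Rightarrow> (real^'n::finite) set set" where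
  "Rat l = {L. rational zvec L \<and> dim L = l}"

text \<open>\<open>L\<close> is meant to range over rational subspaces of the fixed lattice
  \<open>zvec\<close> while \<open>A\<close> moves; this keeps the index set independent of the
  group element.\<close>

definition inv_covol :: "real^'n::finite^'n \<Rightarrow> (real^'n) set \<Rightarrow> real" where
  "inv_covol A L = 1 / norm (ext_map (dim L) A (lat_wedge L))"

definition ealpha_l :: "nat \<Rightarrow> real^'n::finite^'n \<Rightarrow> real" where
  "ealpha_l l A = Sup (inv_covol A ` Rat l)"

definition ealpha :: "real^'n::finite^'n \<Rightarrow> real" where
  "ealpha A = Max ((\<lambda>l. ealpha_l l A) ` {0..CARD('n)})"

lemma lat_wedge_props:
  assumes "L \<in> Rat l"
  shows "lat_wedge L \<in> ext_pow l" "lat_wedge L \<in> zvec" "lat_wedge L \<noteq> 0"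
proof -
  obtain u where "primitive (dim L) u" "lat_wedge L = wedge (dim L) u"
    using lat_wedge_eq[of L] assms by (auto simp: Rat_def)
  then show "lat_wedge L \<in> ext_pow l" "lat_wedge L \<in> zvec" "lat_wedge L \<noteq> 0"
    using assms by (auto simp: Rat_def primitive_def wedge_in_ext_pow intro: wedge_zvec)
qed

lemma Rat_nonempty:
  assumes "l \<le> CARD('n)" shows "Rat l \<noteq> ({} :: (real^'n::finite) set set)"
proof -
  obtain S :: "'n set" where S: "card S = l" using obtain_subset_with_card_n[of l UNIV] assms by auto
  let ?u = "\<lambda>a. axis (from_nat_into S a) (1::real)"
  have "wedge l ?u = axis S 1" using wedge_axis[of S] S by simp
  then have "wedge l ?u \<noteq> 0" by (simp add: axis_eq_0_iff)
  then have "dim (span (?u ` {..<l})) = l" by (rule dim_span_wedge)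
  moreover have "rational zvec (span (?u ` {..<l}))" by (rule rational_span) (rule axis_in_zvec)
  ultimately show ?thesis by (auto simp: Rat_def)
qed

lemma norm_ext_map_lower:
  fixes A :: "real^'n::finite^'n"
  assumes "invertible A"
  obtains C where "0 < C" "\<And>x. x \<in> ext_pow l \<Longrightarrow> norm x \<le> C * norm (ext_map l A x)"
proof -
  obtain A' where A': "A' ** A = mat 1" using assms by (auto simp: invertible_def)
  have "bounded_linear (ext_map l A')" using linear_ext_map by (simp add: linear_conv_bounded_linear)
  then obtain C where C: "0 < C" "\<And>x. norm (ext_map l A' x) \<le> norm x * C" using bounded_linear.pos_bounded by blast
  show ?thesis
  proof (rule that[OF C(1)])
    fix x :: "real^('n set)" assume "x \<in> ext_pow l"
    then have "x = ext_map l A' (ext_map l A x)" by (simp add: A' ext_map_one flip: ext_map_mult)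
    then show "norm x \<le> C * norm (ext_map l A x)" using C(2)[of "ext_map l A x"] by (simp add: mult.commute)
  qed
qed

lemma ext_map_nonzero:
  fixes A :: "real^'n::finite^'n"
  assumes "invertible A" "x \<in> ext_pow l" "x \<noteq> 0"
  shows "0 < norm (ext_map l A x)"
proof -
  obtain C where "0 < C" "norm x \<le> C * norm (ext_map l A x)" using norm_ext_map_lower[OF assms(1), of l] assms(2) by metis
  with assms(3) show ?thesis by (metis less_le_trans mult_zero_right norm_ge_zero not_le zero_less_norm_iff order_le_less)
qed

lemma inv_covol_eq: "L \<in> Rat l \<Longrightarrow> inv_covol A L = 1 / norm (ext_map l A (lat_wedge L))"
  by (auto simp: inv_covol_def Rat_def)

lemma inv_covol_pos: "invertible A \<Longrightarrow> L \<in> Rat l \<Longrightarrow> 0 < inv_covol A L"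
  using lat_wedge_props ext_map_nonzero by (force simp: inv_covol_eq)

text \<open>A nonzero integer vector has norm at least 1, and an invertible matrix shrinks it by a
  bounded factor.\<close>

lemma inv_covol_bdd:
  assumes "invertible A" shows "bdd_above (inv_covol A ` Rat l)"
proof -
  obtain C where C: "0 < C" "\<And>x. x \<in> ext_pow l \<Longrightarrow> norm x \<le> C * norm (ext_map l A x)"
    using norm_ext_map_lower[OF assms, of l] by blast
  have "inv_covol A L \<le> C" if L: "L \<in> Rat l" for L
  proof -
    have "1 \<le> norm (lat_wedge L)" using lat_wedge_props[OF L] by (intro norm_zvec_ge_1) auto
    also have "\<dots> \<le> C * norm (ext_map l A (lat_wedge L))" using C(2) lat_wedge_props[OF L] by blast
    finally show ?thesis
      using ext_map_nonzero[OF assms lat_wedge_props(1,3)[OF L]] by (simp add: inv_covol_eq[OF L] divide_le_eq)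
  qed
  then show ?thesis by (rule bdd_aboveI2)
qed

lemma inv_covol_le: "invertible A \<Longrightarrow> L \<in> Rat l \<Longrightarrow> inv_covol A L \<le> ealpha_l l A"
  unfolding ealpha_l_def using inv_covol_bdd by (intro cSup_upper) auto

lemma ealpha_l_least:
  assumes "l \<le> CARD('n::finite)" "\<And>L. L \<in> Rat l \<Longrightarrow> inv_covol A L \<le> c"
  shows "ealpha_l l (A :: real^'n^'n) \<le> c"
  unfolding ealpha_l_def using Rat_nonempty[OF assms(1)] assms(2) by (intro cSup_least) auto

lemma ealpha_l_pos:
  assumes "l \<le> CARD('n::finite)" "invertible A"
  shows "0 < ealpha_l l (A :: real^'n^'n)"
proof -
  obtain L :: "(real^'n) set" where L: "L \<in> Rat l" using Rat_nonempty[OF assms(1)] by auto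
  show ?thesis using inv_covol_pos[OF assms(2) L] inv_covol_le[OF assms(2) L] by simp
qed

lemma ealpha_l_le: "l \<le> CARD('n::finite) \<Longrightarrow> ealpha_l l (A :: real^'n^'n) \<le> ealpha A"
  unfolding ealpha_def by (intro Max_ge) auto

lemma ealpha_pos: "invertible A \<Longrightarrow> 0 < ealpha A"
  using ealpha_l_pos[of 0 A] ealpha_l_le[of 0 A] by simp

text \<open>For measurability of the supremum: it sees \<open>L\<close> only through an integer
  vector, and these are countably many.\<close>

lemma countable_lat_wedge: "countable (lat_wedge ` (Rat l :: (real^'n::finite) set set))"
proof -
  have "(zvec :: (real^('n set)) set) \<subseteq> range (\<lambda>g :: 'n set \<Rightarrow> int. \<chi> S. of_int (g S))"
  proof
    fix x :: "real^('n set)" assume "x \<in> zvec"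
    then have "x = (\<chi> S. of_int \<lfloor>x $ S\<rfloor>)" by (auto simp: zvec_def vec_eq_iff Ints_def)
    then show "x \<in> range (\<lambda>g :: 'n set \<Rightarrow> int. \<chi> S. of_int (g S))" by (intro range_eqI[of _ _ "\<lambda>S. \<lfloor>x $ S\<rfloor>"])
  qed
  then have "countable (zvec :: (real^('n set)) set)" by (rule countable_subset) simp
  moreover have "lat_wedge ` (Rat l :: (real^'n) set set) \<subseteq> zvec" using lat_wedge_props(2) by blast
  ultimately show ?thesis by (rule countable_subset[rotated])
qed

lemma ealpha_l_measurable:
  fixes A :: "'a \<Rightarrow> real^'n::finite^'n"
  assumes meas: "\<And>w. w \<in> ext_pow l \<Longrightarrow> (\<lambda>x. norm (ext_map l (A x) w)) \<in> borel_measurable M"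
    and inv: "\<And>x. x \<in> space M \<Longrightarrow> invertible (A x)"
  shows "(\<lambda>x. ealpha_l l (A x)) \<in> borel_measurable M"
proof -
  have eq: "inv_covol B ` Rat l = (\<lambda>w. 1 / norm (ext_map l B w)) ` lat_wedge ` Rat l" for B :: "real^'n^'n"
    unfolding image_image by (intro image_cong refl inv_covol_eq)
  have "(\<lambda>x. SUP w\<in>lat_wedge ` Rat l. 1 / norm (ext_map l (A x) w)) \<in> borel_measurable M"
  proof (rule borel_measurable_cSUP[OF countable_lat_wedge])
    fix w :: "real^('n set)" assume "w \<in> lat_wedge ` Rat l"
    then have [measurable]: "(\<lambda>x. norm (ext_map l (A x) w)) \<in> borel_measurable M"
      using lat_wedge_props(1) by (auto intro!: meas)
    show "(\<lambda>x. 1 / norm (ext_map l (A x) w)) \<in> borel_measurable M" by measurable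
  next
    fix x assume "x \<in> space M"
    from inv_covol_bdd[OF inv[OF this], of l]
    show "bdd_above ((\<lambda>w. 1 / norm (ext_map l (A x) w)) ` lat_wedge ` Rat l)" unfolding eq .
  qed
  then show ?thesis unfolding ealpha_l_def eq .
qed

lemma inv_covol_submodular:
  fixes A :: "real^'n::finite^'n"
  assumes A: "invertible A" and L: "L \<in> Rat l" and M: "M \<in> Rat l" and ne: "L \<noteq> M"
  shows "\<exists>j. 1 \<le> j \<and> j \<le> l \<and> l + j \<le> CARD('n) \<and>
    inv_covol A L * inv_covol A M \<le> ealpha_l (l - j) A * ealpha_l (l + j) A"
proof -
  obtain I U j where j: "rational zvec I" "rational zvec U" "1 \<le> j" "j \<le> l" "dim I = l - j" "dim U = l + j"
    and "\<And>A. norm (ext_map (l + j) A (lat_wedge U)) * norm (ext_map (l - j) A (lat_wedge I))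
        \<le> norm (ext_map l A (lat_wedge L)) * norm (ext_map l A (lat_wedge M))"
    using lat_wedge_submodular[of L M l] L M ne by (auto simp: Rat_def)
  then have ineq: "norm (ext_map (l + j) A (lat_wedge U)) * norm (ext_map (l - j) A (lat_wedge I))
        \<le> norm (ext_map l A (lat_wedge L)) * norm (ext_map l A (lat_wedge M))" by blast
  have I: "I \<in> Rat (l - j)" and U: "U \<in> Rat (l + j)" using j by (auto simp: Rat_def)
  have "l + j \<le> CARD('n)" using dim_subset_UNIV[of U] j(6) by simp
  moreover have "inv_covol A L * inv_covol A M \<le> inv_covol A I * inv_covol A U"
    using inv_covol_pos[OF A I] inv_covol_pos[OF A U] ineq
    unfolding inv_covol_eq[OF L] inv_covol_eq[OF M] inv_covol_eq[OF I] inv_covol_eq[OF U]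
    by (simp add: frac_le mult.commute zero_less_mult_iff)
  moreover have "\<dots> \<le> ealpha_l (l - j) A * ealpha_l (l + j) A"
    using inv_covol_le[OF A I] inv_covol_le[OF A U] inv_covol_pos[OF A I] inv_covol_pos[OF A U] by (intro mult_mono) auto
  ultimately show ?thesis using j by (intro exI[of _ j]) auto
qed

section \<open>Averages over a unipotent arc\<close>

lemma norm_mat2_le: "norm A \<le> \<bar>A$1$1\<bar> + \<bar>A$1$2\<bar> + \<bar>A$2$1\<bar> + \<bar>A$2$2\<bar>" for A :: "real^2^2"
proof -
  have "norm A \<le> norm (A $ 1) + norm (A $ 2)"
    using L2_set_le_sum[of UNIV "\<lambda>i. norm (A $ i)"] by (simp add: norm_vec_def sum_2)
  then show ?thesis using norm_le_l1_cart[of "A $ 1"] norm_le_l1_cart[of "A $ 2"] by (simp add: sum_2)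
qed

lemma invertible_rho:
  assumes "det g \<noteq> 0" shows "invertible (rho g)"
proof -
  obtain g' where "g ** g' = mat 1" "g' ** g = mat 1"
    using assms by (auto simp: invertible_det_nz[symmetric] invertible_def)
  then show ?thesis unfolding invertible_def by (metis rho_mult rho_one)
qed

lemma det_unip [simp]: "det (unip y) = 1" by (simp add: det_2)

lemma det_diag2 [simp]: "t \<noteq> 0 \<Longrightarrow> det (diag2 t) = 1" by (simp add: det_2)

lemma diag2_mult: "diag2 s ** diag2 t = diag2 (s * t)"
  by (simp add: mat2_eq_iff mat2_mult_nth)

lemma diag_unip_add: "t \<noteq> 0 \<Longrightarrow> diag2 t ** unip (z + x) = unip (t\<^sup>2 * z) ** (diag2 t ** unip x)"
  by (simp add: mat2_eq_iff mat2_mult_nth power2_eq_square algebra_simps)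

text \<open>Bottom and top exterior power: here \<open>min l (2d - l)\<close> is 0, so all weights
  are 0 and the coordinates along unipotents have degree 0.\<close>

lemma act_extreme:
  fixes x :: "real^(('d::finite \<times> 2) set)"
  assumes l: "l = 0 \<or> l = 2 * CARD('d)" and x: "x \<in> ext_pow l" and t: "0 < t"
  shows "act l (diag2 t ** unip y) x = x"
proof -
  have l': "l \<le> 2 * CARD('d)" and m: "min l (2 * CARD('d) - l) = 0" using l by auto
  have w: "weight S = 0" if "card S = l" for S :: "('d \<times> 2) set"
    using weight_bounds[OF that] m by simp
  have u: "act l (unip y) x = x"
  proof (subst vec_eq_iff, rule allI)
    fix S
    show "act l (unip y) x $ S = x $ S"
    proof (cases "card S = l")
      case True
      then have "degree (upoly l x S) = 0" using degree_upoly[OF l' x True m[symmetric]] w by simp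
      then have "poly (upoly l x S) y = poly (upoly l x S) 0" by (auto elim: degree_eq_zeroE)
      then show ?thesis using x by (simp add: poly_upoly unip_zero act_one)
    next
      case False
      then show ?thesis using ext_pow_nth[OF x] ext_pow_nth[OF ext_map_in_ext_pow] by metis
    qed
  qed
  show ?thesis unfolding act_mult u
  proof (subst vec_eq_iff, rule allI)
    fix S show "act l (diag2 t) x $ S = x $ S"
      using act_diag[OF x t, of S] ext_pow_nth[OF x, of S] w[of S] t by (cases "card S = l") auto
  qed
qed

theorem unipotent_average:
  assumes \<beta>: "0 < \<beta>" "2 < \<beta> * real CARD('d::finite)"
  shows "\<exists>R. \<forall>B :: real^('d \<times> 2)^('d \<times> 2). invertible B \<longrightarrow> (\<forall>n.
    (\<integral>\<^sup>+x\<in>{0..<1}. ennreal (ealpha (rho (diag2 (2^n) ** unip x) ** B) powr \<beta>) \<partial>lborel)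
    \<le> ennreal (R * ealpha B powr \<beta> * 2 powr ((\<beta> * real CARD('d) - 2) * real n)))"
proof -
  let ?d = "CARD('d)"
  have card: "CARD('d \<times> 2) = 2 * ?d" by simp
  define \<theta> where "\<theta> = \<beta> - 2 / ?d"
  have d: "1 \<le> ?d" by (simp add: Suc_leI)
  have \<theta>: "0 < \<theta>" using \<beta> d by (simp add: \<theta>_def field_simps)
  obtain Ca where Ca: "1 \<le> Ca" "\<And>l g x. l \<le> 2 * ?d \<Longrightarrow> norm g \<le> 4 \<Longrightarrow>
      norm (act l g (x :: real^(('d \<times> 2) set))) \<le> Ca * norm x"
    by (rule act_bounded[of 4]) (simp, blast)
  have "\<forall>l. \<exists>C. 1 \<le> l \<longrightarrow> l < 2 * ?d \<longrightarrow> 1 \<le> C \<and>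
    (\<forall>n x. (x :: real^(('d \<times> 2) set)) \<in> ext_pow l \<longrightarrow> x \<noteq> 0 \<longrightarrow>
       (\<integral>\<^sup>+y\<in>{0..<1}. ennreal ((norm x / norm (act l (diag2 (2^n) ** unip y) x)) powr \<beta>) \<partial>lborel)
       \<le> ennreal (C * 2 powr (\<theta> * real (min l (2 * ?d - l)) * real n)))"
  proof (intro allI)
    fix l
    show "\<exists>C. 1 \<le> l \<longrightarrow> l < 2 * ?d \<longrightarrow> 1 \<le> C \<and>
      (\<forall>n x. (x :: real^(('d \<times> 2) set)) \<in> ext_pow l \<longrightarrow> x \<noteq> 0 \<longrightarrow>
       (\<integral>\<^sup>+y\<in>{0..<1}. ennreal ((norm x / norm (act l (diag2 (2^n) ** unip y) x)) powr \<beta>) \<partial>lborel)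
       \<le> ennreal (C * 2 powr (\<theta> * real (min l (2 * ?d - l)) * real n)))"
    proof (cases "1 \<le> l \<and> l < 2 * ?d")
      case True
      then have l: "1 \<le> l" "l < 2 * ?d" by auto
      show ?thesis
        by (rule single_vector_average[OF l refl \<theta>_def \<theta> \<beta>(1)], rule exI) blast
    qed auto
  qed
  then obtain Cs where Cs: "\<And>l. 1 \<le> l \<Longrightarrow> l < 2 * ?d \<Longrightarrow> 1 \<le> Cs l"
    "\<And>l n x. 1 \<le> l \<Longrightarrow> l < 2 * ?d \<Longrightarrow> (x :: real^(('d \<times> 2) set)) \<in> ext_pow l \<Longrightarrow> x \<noteq> 0 \<Longrightarrow>
       (\<integral>\<^sup>+y\<in>{0..<1}. ennreal ((norm x / norm (act l (diag2 (2^n) ** unip y) x)) powr \<beta>) \<partial>lborel)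
       \<le> ennreal (Cs l * 2 powr (\<theta> * real (min l (2 * ?d - l)) * real n))"
    unfolding choice_iff by blast
  \<comment> \<open>One constant serves as distortion bound and as constant of the single-vector
    estimate in every dimension.\<close>
  define K where "K = Ca + (\<Sum>l\<in>{1..<2 * ?d}. Cs l)"
  have Csum: "0 \<le> (\<Sum>l\<in>{1..<2 * ?d}. Cs l)" by (intro sum_nonneg) (use Cs(1) in force)
  have K: "1 \<le> K" "Ca \<le> K" unfolding K_def using Ca(1) Csum by auto
  have KCs: "Cs l \<le> K" if "1 \<le> l" "l < 2 * ?d" for l
  proof -
    have "Cs l \<le> (\<Sum>l\<in>{1..<2 * ?d}. Cs l)"
      using that by (intro member_le_sum) (use Cs(1) in force)+
    then show ?thesis unfolding K_def using Ca(1) by simp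
  qed
  define Q where "Q = 8 * real ?d * K powr (1 + 4 * \<beta>) / (1 - 2 powr (- \<theta> / ?d))"
  \<comment> \<open>The \<open>d\<close>-th power of \<open>Q\<close> makes the \<open>d\<close>-th
    root of \<open>Bc\<close> at least \<open>Q\<close>.\<close>
  define Bc where "Bc = max (max 1 (2 * K powr (1 + 4 * \<beta>))) (Q ^ ?d)"
  have Q0: "0 \<le> Q"
  proof -
    have "2 powr (- \<theta> / ?d) \<le> (1::real)" using \<theta> powr_mono[of "- \<theta> / ?d" 0 2] by simp
    then show ?thesis unfolding Q_def by simp
  qed
  have Bc: "1 \<le> Bc" "2 * K powr (1 + 4 * \<beta>) \<le> Bc" "Q \<le> Bc powr (1 / ?d)"
  proof -
    show "1 \<le> Bc" "2 * K powr (1 + 4 * \<beta>) \<le> Bc" by (auto simp: Bc_def)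
    have "Q = (Q ^ ?d) powr (1 / ?d)"
    proof (cases "Q = 0")
      case False
      then show ?thesis using Q0 by (simp add: powr_realpow[symmetric] powr_powr)
    qed simp
    also have "\<dots> \<le> Bc powr (1 / ?d)" using Q0 by (intro powr_mono2) (auto simp: Bc_def)
    finally show "Q \<le> Bc powr (1 / ?d)" .
  qed
  define R where "R = real (Suc (2 * ?d)) * Bc powr (1 + real ?d)"
  show ?thesis
  proof (intro exI[of _ R] allI impI)
    fix B :: "real^('d \<times> 2)^('d \<times> 2)" and n :: nat
    assume B: "invertible B"
    let ?g = "\<lambda>n x. diag2 (2^n) ** unip x"
    let ?A = "\<lambda>n x. rho (?g n x) ** B"
    define b where "b L = ext_map (dim L) B (lat_wedge L)" for L :: "(real^('d \<times> 2)) set"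
    have inv: "invertible (?A n x)" for n x
      by (intro invertible_mult invertible_rho B) (simp add: det_mul)
    have b: "b L \<in> ext_pow l" "b L \<noteq> 0" if "L \<in> Rat l" for L l
      using ext_map_nonzero[OF B lat_wedge_props(1,3)[OF that]] that
      by (auto simp: b_def Rat_def ext_map_in_ext_pow)
    have f_eq: "inv_covol (rho g ** B) L = 1 / norm (act l g (b L))" if "L \<in> Rat l" for g L l
      using that by (auto simp: inv_covol_def Rat_def b_def ext_map_mult)
    have act_pos: "0 < norm (act l g z)" if "z \<in> ext_pow l" "z \<noteq> 0" "det g \<noteq> 0"
      for l g and z :: "real^(('d \<times> 2) set)"
      using ext_map_nonzero[OF invertible_rho[OF that(3)] that(1,2)] .
    have dg: "det (?g n x) \<noteq> 0" for n x by (simp add: det_mul)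
    have Rat_le: "l \<le> 2 * ?d" if "L \<in> Rat l" for L :: "(real^('d \<times> 2)) set" and l
      using that dim_subset_UNIV[of L] by (auto simp: Rat_def)
    have comp: "inv_covol (rho g2 ** B) L \<le> K * inv_covol (rho g1 ** B) L"
      if L: "L \<in> Rat l" and k: "g1 = k ** g2" "norm k \<le> 4" and det: "det g1 \<noteq> 0" "det g2 \<noteq> 0" for L l g1 g2 k
    proof -
      have "norm (act l g1 (b L)) \<le> Ca * norm (act l g2 (b L))"
        unfolding k(1) act_mult by (rule Ca(2)[OF Rat_le[OF L] k(2)])
      also have "\<dots> \<le> K * norm (act l g2 (b L))" using K by (intro mult_right_mono) auto
      finally show ?thesis
        using act_pos[OF b[OF L] det(1)] act_pos[OF b[OF L] det(2)] unfolding f_eq[OF L] by (simp add: field_simps)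
    qed
    interpret ms: multiscale ?d \<beta> K "ealpha B" Rat "\<lambda>L n x. inv_covol (?A n x) L" "\<lambda>l n x. ealpha_l l (?A n x)"
    proof
      show "1 \<le> ?d" "0 < \<beta>" "2 < \<beta> * real ?d" "1 \<le> K" using d \<beta> K by auto
      show "0 < ealpha B" by (rule ealpha_pos[OF B])
      show "0 < inv_covol (?A n x) L" if "L \<in> Rat l" for l L n x by (rule inv_covol_pos[OF inv that])
      show "inv_covol (?A n x) L \<le> ealpha_l l (?A n x)" if "L \<in> Rat l" for l L n x by (rule inv_covol_le[OF inv that])
      show "ealpha_l l (?A n x) \<le> c" if "l \<le> 2 * ?d" "\<And>L. L \<in> Rat l \<Longrightarrow> inv_covol (?A n x) L \<le> c" for l n x c
        using that by (intro ealpha_l_least) auto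
      show "0 \<le> ealpha_l l (?A n x)" if "l \<le> 2 * ?d" for l n x
        using that by (intro less_imp_le[OF ealpha_l_pos] inv) auto
      show "(\<lambda>x. inv_covol (?A n x) L) \<in> borel_measurable borel" if "L \<in> Rat l" for l L n
      proof -
        have [measurable]: "(\<lambda>x. norm (act l (?g n x) (b L))) \<in> borel_measurable borel"
          by (intro borel_measurable_continuous_onI continuous_on_norm act_unip_continuous)
        show ?thesis unfolding f_eq[OF that] by measurable
      qed
      show "(\<lambda>x. ealpha_l l (?A n x)) \<in> borel_measurable borel" if "l \<le> 2 * ?d" for l n
        by (intro ealpha_l_measurable inv)
          (auto simp: ext_map_mult intro!: borel_measurable_continuous_onI continuous_on_norm act_unip_continuous)
      show "inv_covol (?A n x') L \<le> K * inv_covol (?A n x) L" if L: "L \<in> Rat l" and xx: "\<bar>x - x'\<bar> \<le> (1/4)^n" for l L n x x'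
      proof (rule comp[OF L _ _ dg dg])
        \<comment> \<open>Conjugation by \<open>diag2 (2^n)\<close> stretches parameters by
          \<open>4^n\<close>, so a distance within one cell becomes a displacement of at most
          1.\<close>
        let ?z = "(2^n)\<^sup>2 * (x - x')"
        show "?g n x = unip ?z ** ?g n x'" using diag_unip_add[of "2^n" "x - x'" x'] by simp
        have "\<bar>?z\<bar> = 4^n * \<bar>x - x'\<bar>" by (simp add: abs_mult power_mult[symmetric] power2_eq_square flip: power_mult_distrib)
        also have "\<dots> \<le> 4^n * (1/4)^n" using xx by (intro mult_left_mono) auto
        also have "\<dots> = 1" by (simp flip: power_mult_distrib)
        finally show "norm (unip ?z) \<le> 4" using norm_mat2_le[of "unip ?z"] by simp
      qed
      show "inv_covol (?A (Suc n) x) L \<le> K * inv_covol (?A n x) L" if L: "L \<in> Rat l" for l L n x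
      proof (rule comp[OF L _ _ dg dg])
        show "?g n x = diag2 (1/2) ** ?g (Suc n) x" by (simp add: matrix_mul_assoc diag2_mult)
        show "norm (diag2 (1/2)) \<le> 4" using norm_mat2_le[of "diag2 (1/2)"] by simp
      qed
      show "\<exists>j. 1 \<le> j \<and> j \<le> l \<and> l + j \<le> 2 * ?d \<and>
          inv_covol (?A n x) L * inv_covol (?A n x) M \<le> ealpha_l (l - j) (?A n x) * ealpha_l (l + j) (?A n x)"
        if "L \<in> Rat l" "M \<in> Rat l" "L \<noteq> M" for l L M n x
        by (rule inv_covol_submodular[OF inv that, unfolded card])
      show "ealpha_l l (?A 0 x) \<le> K * ealpha B" if l: "l \<le> 2 * ?d" and x: "0 \<le> x" "x < 1" for l x
      proof (rule ealpha_l_least)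
        show "l \<le> CARD('d \<times> 2)" using l by simp
        fix L :: "(real^('d \<times> 2)) set" assume L: "L \<in> Rat l"
        have "inv_covol (?A 0 x) L \<le> K * inv_covol (rho (mat 1) ** B) L"
        proof (rule comp[OF L _ _ _ dg])
          show "mat 1 = unip (- x) ** ?g 0 x" by (simp add: mat2_eq_iff mat2_mult_nth mat_def)
          show "norm (unip (- x)) \<le> 4" using norm_mat2_le[of "unip (- x)"] x by simp
        qed simp
        also have "\<dots> \<le> K * ealpha B"
          using inv_covol_le[OF B L] ealpha_l_le[of l B] l K(1) by (intro mult_left_mono) (auto simp: rho_one)
        finally show "inv_covol (?A 0 x) L \<le> K * ealpha B" .
      qed
      have ends: "ealpha_l l (?A n x) \<le> K * ealpha B" if l: "l = 0 \<or> l = 2 * ?d" for l n x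
      proof (rule ealpha_l_least)
        show l': "l \<le> CARD('d \<times> 2)" using l by auto
        fix L :: "(real^('d \<times> 2)) set" assume L: "L \<in> Rat l"
        have "inv_covol (?A n x) L = inv_covol (rho (mat 1) ** B) L"
          unfolding f_eq[OF L] using act_extreme[OF l b(1)[OF L], of "2^n"] by (simp add: act_one b(1)[OF L])
        also have "\<dots> \<le> 1 * ealpha B" using inv_covol_le[OF B L] ealpha_l_le[OF l', of B] by (simp add: rho_one)
        also have "\<dots> \<le> K * ealpha B" using K(1) ealpha_pos[OF B] by (intro mult_right_mono) auto
        finally show "inv_covol (?A n x) L \<le> K * ealpha B" .
      qed
      show "ealpha_l 0 (?A n x) \<le> K * ealpha B" "ealpha_l (2 * ?d) (?A n x) \<le> K * ealpha B" for n x
        using ends by auto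
      show "(\<integral>\<^sup>+y\<in>{x..<x + (1/4)^s}. ennreal (inv_covol (?A (s + m) y) L powr \<beta>) \<partial>lborel)
        \<le> ennreal (K * (1/4)^s * 2 powr ((\<beta> - 2 / ?d) * (real l * (2 * ?d - real l) / ?d) * m) * inv_covol (?A s x) L powr \<beta>)"
        if l: "1 \<le> l" "l < 2 * ?d" and L: "L \<in> Rat l" for l L s m x
      proof -
        let ?\<delta> = "(1/4)^s :: real"
        define v where "v = act l (?g s x) (b L)"
        have v: "v \<in> ext_pow l" "v \<noteq> 0" using act_pos[OF b[OF L] dg, of s x] by (auto simp: v_def ext_map_in_ext_pow)
        have [measurable]: "(\<lambda>y. inv_covol (?A (s + m) y) L) \<in> borel_measurable borel"
        proof -
          have [measurable]: "(\<lambda>y. norm (act l (?g (s + m) y) (b L))) \<in> borel_measurable borel"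
            by (intro borel_measurable_continuous_onI continuous_on_norm act_unip_continuous)
          show ?thesis unfolding f_eq[OF L] by measurable
        qed
        \<comment> \<open>Renormalisation: seen from scale \<open>s\<close>, the remaining
          \<open>m\<close> steps on the cell look like the path from scale 0 on the unit interval,
          applied to \<open>v\<close>.\<close>
        have shift: "?g (s + m) (x + ?\<delta> * u) = (diag2 (2^m) ** unip u) ** ?g s x" for u
        proof -
          have "?g (s + m) (x + ?\<delta> * u) = diag2 (2^m) ** (diag2 (2^s) ** unip (?\<delta> * u + x))"
            by (simp add: matrix_mul_assoc diag2_mult power_add mult.commute add.commute)
          also have "\<dots> = diag2 (2^m) ** (unip ((2^s)\<^sup>2 * (?\<delta> * u)) ** ?g s x)" by (subst diag_unip_add) auto
          also have "(2^s)\<^sup>2 * (?\<delta> * u) = u"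
          proof -
            have "(2^s)\<^sup>2 * ?\<delta> = (4 * (1/4))^s" unfolding power_mult_distrib by (simp add: power2_eq_square flip: power_mult_distrib)
            then show ?thesis by (simp flip: mult.assoc)
          qed
          finally show ?thesis by (simp add: matrix_mul_assoc)
        qed
        have scaled: "inv_covol (?A (s + m) (x + ?\<delta> * u)) L powr \<beta>
          = inv_covol (?A s x) L powr \<beta> * (norm v / norm (act l (diag2 (2^m) ** unip u) v)) powr \<beta>" for u
        proof -
          have "inv_covol (?A (s + m) (x + ?\<delta> * u)) L = 1 / norm (act l (diag2 (2^m) ** unip u) v)"
            unfolding f_eq[OF L] shift act_mult[of l _ "?g s x"] v_def ..
          also have "\<dots> = inv_covol (?A s x) L * (norm v / norm (act l (diag2 (2^m) ** unip u) v))"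
            unfolding f_eq[OF L] v_def[symmetric] using v by simp
          finally have e: "inv_covol (?A (s + m) (x + ?\<delta> * u)) L
            = inv_covol (?A s x) L * (norm v / norm (act l (diag2 (2^m) ** unip u) v))" .
          show ?thesis unfolding e by (rule powr_mult)
        qed
        have "(\<integral>\<^sup>+y\<in>{x..<x + ?\<delta>}. ennreal (inv_covol (?A (s + m) y) L powr \<beta>) \<partial>lborel)
          = ennreal \<bar>?\<delta>\<bar> * (\<integral>\<^sup>+u. ennreal (inv_covol (?A (s + m) (x + ?\<delta> * u)) L powr \<beta>) * indicator {x..<x + ?\<delta>} (x + ?\<delta> * u) \<partial>lborel)"
          by (rule nn_integral_real_affine) auto
        also have "\<dots> = ennreal ?\<delta> * (\<integral>\<^sup>+u. ennreal (inv_covol (?A s x) L powr \<beta>) *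
            (ennreal ((norm v / norm (act l (diag2 (2^m) ** unip u) v)) powr \<beta>) * indicator {0..<1} u) \<partial>lborel)"
        proof -
          have "indicator {x..<x + c} (x + c * u) = (indicator {0..<1} u :: ennreal)" if "0 < c" for c u :: real
            using that by (auto simp: indicator_def zero_le_mult_iff)
          from this[of ?\<delta>] have "indicator {x..<x + ?\<delta>} (x + ?\<delta> * u) = (indicator {0..<1} u :: ennreal)" for u
            by simp
          then show ?thesis unfolding scaled by (simp add: ennreal_mult mult.assoc)
        qed
        also have "\<dots> = ennreal ?\<delta> * (ennreal (inv_covol (?A s x) L powr \<beta>) *
            (\<integral>\<^sup>+u\<in>{0..<1}. ennreal ((norm v / norm (act l (diag2 (2^m) ** unip u) v)) powr \<beta>) \<partial>lborel))"
        proof -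
          have [measurable]: "(\<lambda>u. norm (act l (diag2 (2^m) ** unip u) v)) \<in> borel_measurable borel"
            by (intro borel_measurable_continuous_onI continuous_on_norm act_unip_continuous)
          show ?thesis by (subst nn_integral_cmult) auto
        qed
        also have "\<dots> \<le> ennreal ?\<delta> * (ennreal (inv_covol (?A s x) L powr \<beta>) *
            ennreal (Cs l * 2 powr (\<theta> * real (min l (2 * ?d - l)) * real m)))"
          by (intro mult_left_mono Cs(2)[OF l v]) auto
        also have "\<dots> = ennreal (Cs l * ?\<delta> * 2 powr (\<theta> * real (min l (2 * ?d - l)) * real m) * inv_covol (?A s x) L powr \<beta>)"
          using Cs(1)[OF l] by (simp add: mult_ac flip: ennreal_mult)
        also have "\<dots> \<le> ennreal (K * ?\<delta> * 2 powr (\<theta> * (real l * (2 * ?d - real l) / ?d) * real m) * inv_covol (?A s x) L powr \<beta>)"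
        proof -
          \<comment> \<open>Here the sharper exponent \<open>min l (2d - l)\<close> is given up for
            its strictly concave majorant.\<close>
          have minw: "real (min l (2 * ?d - l)) \<le> real l * (real (2 * ?d) - real l) / ?d"
          proof (cases "l \<le> ?d")
            case True
            then have "real l * real ?d \<le> real l * (2 * real ?d - real l)" by (intro mult_left_mono) auto
            then show ?thesis using True d by (simp add: pos_le_divide_eq)
          next
            case False
            then have "real ?d * (2 * real ?d - real l) \<le> real l * (2 * real ?d - real l)" using l by (intro mult_right_mono) auto
            then show ?thesis using False d l by (simp add: pos_le_divide_eq of_nat_diff mult.commute)
          qed
          have "2 powr (\<theta> * real (min l (2 * ?d - l)) * real m) \<le> 2 powr (\<theta> * (real l * (real (2 * ?d) - real l) / ?d) * real m)"
            by (intro powr_mono mult_right_mono mult_left_mono minw) (use \<theta> in auto)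
          then show ?thesis using K by (intro ennreal_leI mult_right_mono mult_mono KCs[OF l]) auto
        qed
        finally show ?thesis unfolding \<theta>_def .
      qed
    qed
    have w_le: "ms.w l \<le> ?d" if "l \<le> 2 * ?d" for l
    proof -
      have "real l * (2 * ?d - real l) \<le> real ?d * ?d"
        using zero_le_power2[of "real l - ?d"] by (simp add: power2_eq_square algebra_simps)
      then show ?thesis using d by (simp add: ms.w_def pos_divide_le_eq)
    qed
    let ?X = "Bc powr (1 + real ?d) * ealpha B powr \<beta> * 2 powr ((\<beta> * real ?d - 2) * real n)"
    have each: "ms.avg (\<lambda>x. ealpha_l l (?A n x) powr \<beta>) \<le> ennreal ?X" if l: "l \<le> 2 * ?d" for l
    proof -
      have "ms.avg (\<lambda>x. ealpha_l l (?A n x) powr \<beta>)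
        \<le> ennreal (Bc powr (1 + ms.w l) * ealpha B powr \<beta> * 2 powr (ms.\<theta> * ms.w l * n))"
        using Bc by (intro ms.avg_al_bound l) (auto simp: Q_def \<theta>_def ms.\<theta>_def)
      also have "\<dots> \<le> ennreal ?X"
      proof -
        have "ms.\<theta> * ms.w l \<le> \<theta> * ?d"
          using w_le[OF l] \<theta> by (simp add: ms.\<theta>_def \<theta>_def mult_left_mono)
        also have "\<theta> * ?d = \<beta> * real ?d - 2" using d by (simp add: \<theta>_def field_simps)
        finally have "2 powr (ms.\<theta> * ms.w l * n) \<le> 2 powr ((\<beta> * real ?d - 2) * real n)"
          by (intro powr_mono mult_right_mono) auto
        moreover have "Bc powr (1 + ms.w l) \<le> Bc powr (1 + real ?d)"
          using w_le[OF l] Bc(1) by (intro powr_mono) auto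
        ultimately show ?thesis by (intro ennreal_leI mult_mono) auto
      qed
      finally show ?thesis .
    qed
    have "(\<integral>\<^sup>+x\<in>{0..<1}. ennreal (ealpha (?A n x) powr \<beta>) \<partial>lborel)
       \<le> (\<integral>\<^sup>+x. (\<Sum>l\<in>{0..2 * ?d}. ennreal (indicator {0..<1} x * ealpha_l l (?A n x) powr \<beta>)) \<partial>lborel)"
    proof (rule nn_integral_mono)
      fix x :: real
      have "ealpha (?A n x) \<in> (\<lambda>l. ealpha_l l (?A n x)) ` {0..CARD('d \<times> 2)}"
        unfolding ealpha_def by (rule Max_in) auto
      then have "ealpha (?A n x) \<in> (\<lambda>l. ealpha_l l (?A n x)) ` {0..2 * ?d}" unfolding card .
      then obtain l where l: "l \<in> {0..2 * ?d}" "ealpha (?A n x) = ealpha_l l (?A n x)" by auto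
      have "ennreal (ealpha (?A n x) powr \<beta>) * indicator {0..<1} x = ennreal (indicator {0..<1} x * ealpha_l l (?A n x) powr \<beta>)"
        unfolding l(2) by (auto split: split_indicator)
      also have "\<dots> \<le> (\<Sum>l\<in>{0..2 * ?d}. ennreal (indicator {0..<1} x * ealpha_l l (?A n x) powr \<beta>))"
        using l(1) by (intro member_le_sum) auto
      finally show "ennreal (ealpha (?A n x) powr \<beta>) * indicator {0..<1} x
        \<le> (\<Sum>l\<in>{0..2 * ?d}. ennreal (indicator {0..<1} x * ealpha_l l (?A n x) powr \<beta>))" .
    qed
    also have "\<dots> = (\<Sum>l\<in>{0..2 * ?d}. ms.avg (\<lambda>x. ealpha_l l (?A n x) powr \<beta>))"
      unfolding ms.avg_def
    proof (rule nn_integral_sum)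
      fix l assume "l \<in> {0..2 * ?d}"
      then have [measurable]: "(\<lambda>x. ealpha_l l (?A n x)) \<in> borel_measurable borel" by (intro ms.meas_al) auto
      show "(\<lambda>x. ennreal (indicator {0..<1} x * ealpha_l l (?A n x) powr \<beta>)) \<in> borel_measurable lborel" by measurable
    qed
    also have "\<dots> \<le> (\<Sum>l\<in>{0..2 * ?d}. ennreal ?X)" by (intro sum_mono each) auto
    also have "\<dots> = ennreal (R * ealpha B powr \<beta> * 2 powr ((\<beta> * ?d - 2) * n))"
    proof -
      have "(\<Sum>l\<in>{0..2 * ?d}. ennreal ?X) = ennreal (\<Sum>l\<in>{0..2 * ?d}. ?X)" by (intro sum_ennreal) auto
      also have "(\<Sum>l\<in>{0..2 * ?d}. ?X) = R * ealpha B powr \<beta> * 2 powr ((\<beta> * ?d - 2) * n)"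
        by (simp add: R_def mult.assoc)
      finally show ?thesis .
    qed
    finally show "(\<integral>\<^sup>+x\<in>{0..<1}. ennreal (ealpha (?A n x) powr \<beta>) \<partial>lborel)
      \<le> ennreal (R * ealpha B powr \<beta> * 2 powr ((\<beta> * real ?d - 2) * real n))" .
  qed
qed

section \<open>Comparison of \<open>alpha\<close> with its Euclidean version\<close>

lemma lattice_eq_image:
  fixes \<Delta> :: "(real^'n::finite) set"
  assumes "lattice_in UNIV \<Delta>"
  obtains B :: "real^'n^'n" where "invertible B" "\<Delta> = (*v) B ` zvec"
proof -
  let ?n = "CARD('n)" and ?e = "from_nat_into (UNIV :: 'n set)"
  obtain u where "zbasis ?n u (UNIV \<inter> \<Delta>)" using assms by (auto simp: lattice_in_def)
  then have nz: "wedge ?n u \<noteq> 0" and \<Delta>: "\<Delta> = {\<Sum>a<?n. real_of_int (c a) *\<^sub>R u a | c. True}"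
    by (auto simp: zbasis_def wedge_nonzero_iff)
  have e: "bij_betw ?e {..<?n} UNIV" by (rule bij_betw_from_nat_into_finite) simp
  define g where "g = the_inv_into {..<?n} ?e"
  have ge: "g (?e a) = a" if "a < ?n" for a
    using e that by (simp add: g_def the_inv_into_f_f bij_betw_def)
  define B :: "real^'n^'n" where "B = (\<chi> i j. u (g j) $ i)"
  have Bx: "B *v x = (\<Sum>a<?n. x $ ?e a *\<^sub>R u a)" for x
  proof -
    have "B *v x = (\<Sum>j\<in>UNIV. x $ j *\<^sub>R u (g j))"
      by (simp add: vec_eq_iff matrix_vector_mult_def B_def mult.commute)
    also have "\<dots> = (\<Sum>a<?n. x $ ?e a *\<^sub>R u (g (?e a)))" by (rule sum.reindex_bij_betw[OF e, symmetric])
    finally show ?thesis by (simp add: ge)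
  qed
  have "x = 0" if "B *v x = 0" for x
  proof -
    have "(\<Sum>a<?n. x $ ?e a *\<^sub>R u a) = (\<Sum>a<?n. 0 *\<^sub>R u a)" using that by (simp add: Bx)
    then have z: "x $ ?e a = 0" if "a < ?n" for a
      using wedge_nonzero_coeffs_unique[OF nz, of "\<lambda>a. x $ ?e a" "\<lambda>a. 0" a] that by simp
    have "x $ j = 0" for j
    proof -
      obtain a where "a < ?n" "j = ?e a" using e by (auto simp: bij_betw_def image_iff)
      then show ?thesis using z by simp
    qed
    then show ?thesis by (simp add: vec_eq_iff)
  qed
  then have "invertible B" by (simp add: invertible_left_inverse matrix_left_invertible_ker)
  moreover have "\<Delta> = (*v) B ` zvec"
  proof (intro equalityI subsetI)
    fix y assume "y \<in> \<Delta>"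
    then obtain c where c: "y = (\<Sum>a<?n. real_of_int (c a) *\<^sub>R u a)" unfolding \<Delta> by auto
    have "y = B *v (\<chi> j. real_of_int (c (g j)))" unfolding Bx c by (simp add: ge)
    then show "y \<in> (*v) B ` zvec" by (rule image_eqI) (simp add: zvec_def)
  next
    fix y assume "y \<in> (*v) B ` zvec"
    then obtain x where x: "x \<in> zvec" "y = B *v x" by auto
    have "y = (\<Sum>a<?n. real_of_int \<lfloor>x $ ?e a\<rfloor> *\<^sub>R u a)"
      unfolding x(2) Bx using x(1) by (intro sum.cong) (auto simp: zvec_def Ints_def dest: spec)
    then show "y \<in> \<Delta>" unfolding \<Delta> by (intro CollectI exI[of _ "\<lambda>a. \<lfloor>x $ ?e a\<rfloor>"]) simp
  qed
  ultimately show ?thesis using that by blast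
qed

text \<open>By homogeneity the unit sphere of \<open>V\<close> decides, and it is compact.\<close>

lemma quasinorm_equiv:
  fixes V :: "'a::euclidean_space set"
  assumes q: "quasinorm_on V q" and V: "subspace V"
  obtains c C where "0 < c" "\<And>x. x \<in> V \<Longrightarrow> c * norm x \<le> q x" "\<And>x. x \<in> V \<Longrightarrow> q x \<le> C * norm x"
proof -
  let ?S = "sphere 0 1 \<inter> V"
  have cont: "continuous_on ?S q" using q by (auto simp: quasinorm_on_def intro: continuous_on_subset)
  have comp: "compact ?S" by (intro compact_Int_closed compact_sphere closed_subspace V)
  have pos: "0 < q x" if "x \<in> ?S" for x
  proof -
    have "x \<in> V" "x \<noteq> 0" using that by auto
    then show ?thesis using q unfolding quasinorm_on_def by (metis order_le_less)
  qed
  obtain c C where c: "0 < c" "\<And>x. x \<in> ?S \<Longrightarrow> c \<le> q x" "\<And>x. x \<in> ?S \<Longrightarrow> q x \<le> C"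
  proof (cases "?S = {}")
    case True
    then show ?thesis using that[of 1 1] by auto
  next
    case False
    obtain x where x: "x \<in> ?S" "\<And>y. y \<in> ?S \<Longrightarrow> q x \<le> q y" using continuous_attains_inf[OF comp False cont] by blast
    obtain z where z: "z \<in> ?S" "\<And>y. y \<in> ?S \<Longrightarrow> q y \<le> q z" using continuous_attains_sup[OF comp False cont] by blast
    show ?thesis by (rule that[OF pos[OF x(1)] x(2) z(2)])
  qed
  have "c * norm x \<le> q x \<and> q x \<le> C * norm x" if x: "x \<in> V" for x
  proof (cases "x = 0")
    case True
    moreover from this have "q 0 = 0" using q x unfolding quasinorm_on_def by blast
    ultimately show ?thesis by simp
  next
    case False
    let ?u = "(1 / norm x) *\<^sub>R x"
    have u: "?u \<in> ?S" using False x V by (auto intro: subspace_scale)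
    have "q (norm x *\<^sub>R ?u) = \<bar>norm x\<bar> * q ?u" using q u unfolding quasinorm_on_def by blast
    then have "q x = norm x * q ?u" using False by simp
    then show ?thesis using c(2,3)[OF u] by (simp add: mult.commute[of _ "norm x"] mult_left_mono)
  qed
  then show ?thesis using that[OF c(1)] by blast
qed

lemma zbasis_image:
  fixes A :: "real^'n::finite^'n"
  assumes "zbasis l u \<Gamma>" "invertible A"
  shows "zbasis l (\<lambda>a. A *v u a) ((*v) A ` \<Gamma>)"
proof -
  have "wedge l u \<noteq> 0" using assms(1) by (simp add: zbasis_def wedge_nonzero_iff)
  then have "wedge l (\<lambda>a. A *v u a) \<noteq> 0"
    using ext_map_nonzero[OF assms(2) wedge_in_ext_pow] by (force simp: ext_map_wedge[symmetric])
  moreover have "A *v (\<Sum>a<l. real_of_int (c a) *\<^sub>R u a) = (\<Sum>a<l. real_of_int (c a) *\<^sub>R (A *v u a))" for c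
    by (simp add: linear_sum[OF matrix_vector_mul_linear] linear_scale[OF matrix_vector_mul_linear])
  ultimately show ?thesis
    using assms(1) unfolding zbasis_def wedge_nonzero_iff by (auto simp: image_def)
qed

lemma dim_image_invertible: "invertible A \<Longrightarrow> dim ((*v) (A :: real^'n::finite^'n) ` L) = dim L"
  by (intro dim_image_eq) (auto intro: inj_on_subset[OF inj_matrix_vector_mult])

lemma rational_image:
  fixes A :: "real^'n::finite^'n"
  assumes "rational \<Delta> L" "invertible A"
  shows "rational ((*v) A ` \<Delta>) ((*v) A ` L)"
proof -
  obtain u where u: "subspace L" "zbasis (dim L) u (L \<inter> \<Delta>)" "span (u ` {..<dim L}) = L"
    using assms(1) by (auto simp: rational_def lattice_in_def)
  have "(*v) A ` L \<inter> (*v) A ` \<Delta> = (*v) A ` (L \<inter> \<Delta>)"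
    using inj_matrix_vector_mult[OF assms(2)] by (simp add: image_Int)
  moreover have "span ((\<lambda>a. A *v u a) ` {..<dim L}) = (*v) A ` L"
    using span_linear_image[OF matrix_vector_mul_linear, of A "u ` {..<dim L}"] u(3) by (simp add: image_image)
  ultimately show ?thesis
    using zbasis_image[OF u(2) assms(2)] u(1)
    unfolding rational_def lattice_in_def dim_image_invertible[OF assms(2)]
    by (auto intro!: linear_subspace_image matrix_vector_mul_linear)
qed

text \<open>The basis chosen by \<open>SOME\<close> changes the wedge product at most by a sign,
  which \<open>q l\<close> ignores. Dimension 0 is separate because there the value is 1 by
  convention.\<close>

lemma covol_image:
  fixes A :: "real^'n::finite^'n"
  assumes A: "invertible A" and L: "L \<in> Rat l"
    and q: "\<And>x. 1 \<le> l \<Longrightarrow> x \<in> ext_pow l \<Longrightarrow> q l (- x) = q l x"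
  shows "covol q ((*v) A ` zvec) ((*v) A ` L) = (if l = 0 then 1 else q l (ext_map l A (lat_wedge L)))"
proof -
  have rat: "rational zvec L" and dim: "dim L = l" using L by (auto simp: Rat_def)
  have dimA: "dim ((*v) A ` L) = l" using dim_image_invertible[OF A] dim by simp
  have sub: "subspace ((*v) A ` L)" using rational_image[OF rat A] by (simp add: rational_def)
  have zero: "(*v) A ` L = {0} \<longleftrightarrow> l = 0"
  proof
    assume e: "(*v) A ` L = {0}"
    have "dim ((*v) A ` L) = 0" unfolding e dim_eq_0 by simp
    then show "l = 0" unfolding dimA .
  next
    assume "l = 0"
    then have "(*v) A ` L \<subseteq> {0}" using dimA unfolding dim_eq_0[symmetric] by simp
    from subset_singletonD[OF this] show "(*v) A ` L = {0}" using subspace_0[OF sub] by (elim disjE) simp_all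
  qed
  obtain u where u: "primitive l u" "span (u ` {..<l}) = L" "lat_wedge L = wedge l u"
    using lat_wedge_eq[OF rat] dim by metis
  have "zbasis l u (L \<inter> zvec)" using u zbasis_iff_primitive[of L u l] by simp
  then have zb: "zbasis l (\<lambda>a. A *v u a) ((*v) A ` L \<inter> (*v) A ` zvec)"
    using zbasis_image[OF _ A] image_Int[OF inj_matrix_vector_mult[OF A]] by metis
  define v where "v = (SOME u. zbasis l u ((*v) A ` L \<inter> (*v) A ` zvec))"
  have "zbasis l v ((*v) A ` L \<inter> (*v) A ` zvec)"
    unfolding v_def by (rule someI[of "\<lambda>u. zbasis l u ((*v) A ` L \<inter> (*v) A ` zvec)", OF zb])
  from zbasis_wedge_unique[OF this zb]
  have "wedge l v = ext_map l A (lat_wedge L) \<or> wedge l v = - ext_map l A (lat_wedge L)"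
    by (simp add: u(3) ext_map_wedge)
  then have "q l (wedge l v) = q l (ext_map l A (lat_wedge L))" if "1 \<le> l"
    using q[OF that ext_map_in_ext_pow] by auto
  then show ?thesis unfolding covol_def zero dimA v_def[symmetric] by auto
qed

text \<open>Rational subspaces of the moved lattice are exactly the images of those of
  \<open>zvec\<close>, so the supremum runs over a fixed countable set of integer vectors.\<close>

lemma alpha_l_eq:
  fixes A :: "real^'n::finite^'n"
  assumes A: "invertible A" and q: "\<And>x. 1 \<le> l \<Longrightarrow> x \<in> ext_pow l \<Longrightarrow> q l (- x) = q l x"
  shows "alpha_l q l ((*v) A ` zvec) = (SUP w\<in>lat_wedge ` Rat l. 1 / (if l = 0 then 1 else q l (ext_map l A w)))"
proof -
  have "{1 / covol q ((*v) A ` zvec) L | L. rational ((*v) A ` zvec) L \<and> dim L = l}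
     = (\<lambda>L. 1 / covol q ((*v) A ` zvec) ((*v) A ` L)) ` Rat l" (is "?S = ?T")
  proof (intro equalityI subsetI)
    fix y assume "y \<in> ?S"
    then obtain L where L: "y = 1 / covol q ((*v) A ` zvec) L" "rational ((*v) A ` zvec) L" "dim L = l" by auto
    obtain A' where A': "A ** A' = mat 1" "A' ** A = mat 1" using A by (auto simp: invertible_def)
    have inv': "invertible A'" using A' by (auto simp: invertible_def)
    have "rational ((*v) A' ` (*v) A ` zvec) ((*v) A' ` L)" by (rule rational_image[OF L(2) inv'])
    then have "(*v) A' ` L \<in> Rat l"
      using L(3) dim_image_invertible[OF inv'] by (simp add: Rat_def image_image matrix_vector_mul_assoc A')
    moreover have "L = (*v) A ` (*v) A' ` L" by (simp add: image_image matrix_vector_mul_assoc A')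
    ultimately show "y \<in> ?T" using L(1) by (metis image_eqI)
  next
    fix y assume "y \<in> ?T"
    then obtain L where "L \<in> Rat l" "y = 1 / covol q ((*v) A ` zvec) ((*v) A ` L)" by auto
    then show "y \<in> ?S"
      using rational_image[OF _ A] dim_image_invertible[OF A] by (auto simp: Rat_def)
  qed
  also have "\<dots> = (\<lambda>w. 1 / (if l = 0 then 1 else q l (ext_map l A w))) ` lat_wedge ` Rat l"
    unfolding image_image
  proof (intro image_cong refl)
    fix L :: "(real^'n) set" assume "L \<in> Rat l"
    then have "covol q ((*v) A ` zvec) ((*v) A ` L) = (if l = 0 then 1 else q l (ext_map l A (lat_wedge L)))"
      by (rule covol_image[OF A]) (rule q)
    then show "1 / covol q ((*v) A ` zvec) ((*v) A ` L) = 1 / (if l = 0 then 1 else q l (ext_map l A (lat_wedge L)))"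
      by simp
  qed
  finally show ?thesis unfolding alpha_l_def by simp
qed

text \<open>The convention for the zero subspace agrees with the Euclidean norm of the empty wedge
  product.\<close>

lemma norm_ext_map_0:
  fixes A :: "real^'n::finite^'n"
  assumes "L \<in> Rat 0" shows "norm (ext_map 0 A (lat_wedge L)) = 1"
proof -
  have "rational zvec L" "dim L = 0" using assms by (simp_all only: Rat_def mem_Collect_eq)
  then obtain u where u: "lat_wedge L = wedge 0 u" using lat_wedge_eq[of L] by metis
  have "wedge 0 v = axis {} 1" for v :: "nat \<Rightarrow> real^'n"
  proof -
    have "wedge 0 v = wedge (card ({} :: 'n set)) (\<lambda>a. axis (from_nat_into {} a) 1)"
      unfolding card.empty by (rule wedge_cong) simp
    then show ?thesis unfolding wedge_axis .
  qed
  then show ?thesis unfolding u ext_map_wedge by simp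
qed

lemma alpha_compare:
  fixes A :: "real^'n::finite^'n" and q :: "nat \<Rightarrow> real^('n set) \<Rightarrow> real"
  assumes c: "0 < c" "c \<le> 1" "1 \<le> C" and A: "invertible A"
    and q: "\<And>i x. 1 \<le> i \<Longrightarrow> i \<le> CARD('n) \<Longrightarrow> x \<in> ext_pow i \<Longrightarrow> c * norm x \<le> q i x"
      "\<And>i x. 1 \<le> i \<Longrightarrow> i \<le> CARD('n) \<Longrightarrow> x \<in> ext_pow i \<Longrightarrow> q i x \<le> C * norm x"
      "\<And>i x. 1 \<le> i \<Longrightarrow> i \<le> CARD('n) \<Longrightarrow> x \<in> ext_pow i \<Longrightarrow> q i (- x) = q i x"
  shows "alpha q ((*v) A ` zvec) \<le> ealpha A / c" "ealpha A \<le> C * alpha q ((*v) A ` zvec)"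
    "l \<le> CARD('n) \<Longrightarrow> bdd_above ((\<lambda>w. 1 / (if l = 0 then 1 else q l (ext_map l A w))) ` lat_wedge ` Rat l)"
proof -
  let ?Q = "\<lambda>l w. 1 / (if l = 0 then 1 else q l (ext_map l A w))"
  have le: "?Q l (lat_wedge L) \<le> inv_covol A L / c" "inv_covol A L \<le> C * ?Q l (lat_wedge L)"
    if l: "l \<le> CARD('n)" and L: "L \<in> Rat l" for l L
  proof -
    let ?x = "ext_map l A (lat_wedge L)"
    have n: "0 < norm ?x" by (rule ext_map_nonzero[OF A lat_wedge_props(1,3)[OF L]])
    have "?Q l (lat_wedge L) \<le> inv_covol A L / c \<and> inv_covol A L \<le> C * ?Q l (lat_wedge L)"
    proof (cases "l = 0")
      case True
      then show ?thesis using c norm_ext_map_0[of L A] L by (auto simp: inv_covol_eq[OF L])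
    next
      case False
      then have b: "c * norm ?x \<le> q l ?x" "q l ?x \<le> C * norm ?x"
        using q(1,2)[of l ?x] l ext_map_in_ext_pow by auto
      have qp: "0 < q l ?x" using b(1) n c(1) by (metis less_le_trans mult_pos_pos)
      have "1 / q l ?x \<le> 1 / (c * norm ?x)" using b(1) n c(1) by (intro frac_le) auto
      moreover have "1 / norm ?x \<le> C * (1 / q l ?x)" using b(2) n qp by (simp add: field_simps)
      ultimately show ?thesis using False by (simp add: inv_covol_eq[OF L] mult.commute)
    qed
    then show "?Q l (lat_wedge L) \<le> inv_covol A L / c" "inv_covol A L \<le> C * ?Q l (lat_wedge L)" by auto
  qed
  have up: "?Q l (lat_wedge L) \<le> ealpha_l l A / c" if "l \<le> CARD('n)" "L \<in> Rat l" for l L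
    using le(1)[OF that] inv_covol_le[OF A that(2)] c(1) by (meson divide_right_mono less_imp_le order_trans)
  show bdd: "bdd_above (?Q l ` lat_wedge ` Rat l)" if "l \<le> CARD('n)" for l
    unfolding image_image by (rule bdd_aboveI2) (rule up[OF that])
  have eq: "alpha_l q l ((*v) A ` zvec) = (SUP w\<in>lat_wedge ` Rat l. ?Q l w)" if "l \<le> CARD('n)" for l
    using q(3) that by (intro alpha_l_eq A) auto
  have 1: "alpha_l q l ((*v) A ` zvec) \<le> ealpha_l l A / c" if "l \<le> CARD('n)" for l
    unfolding eq[OF that] using up[OF that] Rat_nonempty[OF that] by (intro cSUP_least) auto
  have 2: "ealpha_l l A \<le> C * alpha_l q l ((*v) A ` zvec)" if "l \<le> CARD('n)" for l
  proof (rule ealpha_l_least[OF that])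
    fix L :: "(real^'n) set" assume L: "L \<in> Rat l"
    have "inv_covol A L \<le> C * ?Q l (lat_wedge L)" by (rule le(2)[OF that L])
    also have "\<dots> \<le> C * alpha_l q l ((*v) A ` zvec)"
      unfolding eq[OF that] using L c(3) by (intro mult_left_mono cSUP_upper bdd[OF that]) auto
    finally show "inv_covol A L \<le> C * alpha_l q l ((*v) A ` zvec)" .
  qed
  show "alpha q ((*v) A ` zvec) \<le> ealpha A / c"
    unfolding alpha_def
  proof (rule Max.boundedI)
    fix y assume "y \<in> (\<lambda>l. alpha_l q l ((*v) A ` zvec)) ` {0..CARD('n)}"
    then obtain l where "l \<le> CARD('n)" "y = alpha_l q l ((*v) A ` zvec)" by auto
    then show "y \<le> ealpha A / c" using 1 ealpha_l_le[of l A] c(1) by (meson divide_right_mono less_imp_le order_trans)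
  qed auto
  show "ealpha A \<le> C * alpha q ((*v) A ` zvec)"
    unfolding ealpha_def
  proof (rule Max.boundedI)
    fix y assume "y \<in> (\<lambda>l. ealpha_l l A) ` {0..CARD('n)}"
    then obtain l where l: "l \<le> CARD('n)" "y = ealpha_l l A" by auto
    have "alpha_l q l ((*v) A ` zvec) \<le> alpha q ((*v) A ` zvec)" unfolding alpha_def using l(1) by (intro Max_ge) auto
    then show "y \<le> C * alpha q ((*v) A ` zvec)" using 2[OF l(1)] l(2) c(3) by (meson mult_left_mono order_trans zero_le_one)
  qed auto
qed

section \<open>Averaging over the rotation group\<close>

lemma SO2_iff: "k \<in> SO2 \<longleftrightarrow> transpose k ** k = mat 1 \<and> det k = 1"
  using matrix_left_right_inverse[of "transpose k" k]
  by (auto simp: SO2_def rotation_matrix_def orthogonal_matrix_def)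

lemma SO2_mult: "k \<in> SO2 \<Longrightarrow> k' \<in> SO2 \<Longrightarrow> k ** k' \<in> SO2"
  by (auto simp: SO2_def rotation_matrix_def orthogonal_matrix_mul det_mul)

lemma SO2_transpose: "k \<in> SO2 \<Longrightarrow> transpose k \<in> SO2"
  by (auto simp: SO2_def rotation_matrix_def orthogonal_matrix_transpose)

lemma SO2_inverse: "k \<in> SO2 \<Longrightarrow> transpose k ** k = mat 1 \<and> k ** transpose k = mat 1"
  by (auto simp: SO2_def rotation_matrix_def orthogonal_matrix_def)

lemma norm_SO2_mult: "k \<in> SO2 \<Longrightarrow> norm (k *v x) = norm x"
  using orthogonal_transformation_matrix[of "(*v) k"]
  by (auto simp: SO2_def rotation_matrix_def orthogonal_transformation_norm)

lemma abs_le_1_of_squares: "a * a + b * b = (1::real) \<Longrightarrow> \<bar>a\<bar> \<le> 1"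
  by (metis abs_le_square_iff abs_one le_add_same_cancel1 one_power2 power2_eq_square zero_le_square)

lemma SO2_entry: "k \<in> SO2 \<Longrightarrow> \<bar>k $ i $ j\<bar> \<le> 1"
proof -
  assume "k \<in> SO2"
  then have "transpose k ** k = mat 1" by (simp add: SO2_iff)
  then have "k$1$1 * k$1$1 + k$2$1 * k$2$1 = 1" "k$1$2 * k$1$2 + k$2$2 * k$2$2 = 1"
    by (simp_all add: mat2_eq_iff mat2_mult_nth transpose_def mat_def)
  then have "\<bar>k$1$1\<bar> \<le> 1" "\<bar>k$2$1\<bar> \<le> 1" "\<bar>k$1$2\<bar> \<le> 1" "\<bar>k$2$2\<bar> \<le> 1"
    by (auto intro: abs_le_1_of_squares simp: add.commute)
  then show ?thesis using exhaust_2[of i] exhaust_2[of j] by auto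
qed

text \<open>A unit vector of maximal stretch and its image are rotated to the first axis. The
  remaining matrix has first column (s, 0) and determinant 1; maximality forces its last free entry
  to be 0.\<close>

lemma singular_values:
  assumes h: "h \<in> SL2"
  obtains k1 k2 s where "k1 \<in> SO2" "k2 \<in> SO2" "1 \<le> s" "h = k1 ** diag2 s ** k2" "s = onorm (\<lambda>v. h *v v)"
proof -
  have det: "det h = 1" using h by (simp add: SL2_def)
  have "continuous_on (sphere 0 1) (\<lambda>v. norm (h *v v))"
    by (intro continuous_on_norm linear_continuous_on) (simp add: linear_linear)
  then have cont: "continuous_on (sphere 0 1 :: (real^2) set) (\<lambda>v. norm (h *v v))" .
  have ne: "sphere 0 1 \<noteq> ({} :: (real^2) set)" using norm_axis_1[of "1::2"] by (metis dist_0_norm empty_iff mem_sphere)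
  obtain v where v': "v \<in> sphere 0 1" "\<forall>w\<in>sphere 0 1. norm (h *v w) \<le> norm (h *v v)"
    using continuous_attains_sup[OF compact_sphere ne cont] by blast
  have v: "norm v = 1" "\<And>w. norm w = 1 \<Longrightarrow> norm (h *v w) \<le> norm (h *v v)" using v' by auto
  define s where "s = norm (h *v v)"
  have bound: "norm (h *v w) \<le> s * norm w" for w
  proof (cases "w = 0")
    case False
    have "norm (h *v ((1 / norm w) *\<^sub>R w)) \<le> s" unfolding s_def using False by (intro v(2)) simp
    then show ?thesis using False by (simp add: linear_scale[OF matrix_vector_mul_linear] field_simps)
  qed simp
  have on: "s = onorm (\<lambda>v. h *v v)"
  proof (rule antisym)
    show "s \<le> onorm (\<lambda>v. h *v v)"
      using onorm[of "(*v) h" v] v(1) by (simp add: s_def matrix_vector_mul_bounded_linear)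
    show "onorm (\<lambda>v. h *v v) \<le> s" by (rule onorm_le) (rule bound)
  qed
  have hv: "h *v v \<noteq> 0"
  proof
    assume "h *v v = 0"
    moreover have "invertible h" using det by (simp add: invertible_det_nz)
    ultimately have "v = 0" by (metis invertible_def matrix_vector_mul_assoc matrix_vector_mul_lid matrix_vector_mult_0_right)
    with v(1) show False by simp
  qed
  then have s0: "0 < s" by (simp add: s_def)
  have nsq: "x $ 1 * x $ 1 + x $ 2 * x $ 2 = (norm x)\<^sup>2" for x :: "real^2"
    by (simp add: power2_norm_eq_inner inner_vec_def sum_2)
  define u where "u = (1 / s) *\<^sub>R (h *v v)"
  have u: "norm u = 1" using s0 by (simp add: u_def s_def)
  define rot :: "real^2 \<Rightarrow> real^2^2" where "rot x = vector [vector [x $ 1, - x $ 2], vector [x $ 2, x $ 1]]" for x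
  have rot_nth: "rot x $ 1 $ 1 = x $ 1" "rot x $ 1 $ 2 = - x $ 2" "rot x $ 2 $ 1 = x $ 2" "rot x $ 2 $ 2 = x $ 1" for x
    by (simp_all add: rot_def vector_def)
  have rot: "rot x \<in> SO2" if "norm x = 1" for x
    using nsq[of x] that
    by (simp add: SO2_iff mat2_eq_iff mat2_mult_nth transpose_def mat_def rot_nth det_2)
  have rot_axis: "rot x *v axis 1 1 = x" for x
    by (simp add: matrix_vector_mult_basis column_def vec_eq_iff forall_2 rot_nth)
  define k1 where "k1 = rot u"
  define k2 where "k2 = transpose (rot v)"
  have k: "k1 \<in> SO2" "k2 \<in> SO2" using rot u v(1) SO2_transpose by (auto simp: k1_def k2_def)
  define M where "M = transpose k1 ** h ** transpose k2"
  have Mnorm: "norm (M *v w) \<le> s * norm w" for w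
  proof -
    have "norm (M *v w) = norm (h *v (transpose k2 *v w))"
      unfolding M_def matrix_vector_mul_assoc[symmetric] by (rule norm_SO2_mult[OF SO2_transpose[OF k(1)]])
    also have "\<dots> \<le> s * norm (transpose k2 *v w)" by (rule bound)
    also have "\<dots> = s * norm w" using norm_SO2_mult[OF SO2_transpose[OF k(2)]] by simp
    finally show ?thesis .
  qed
  have "M *v axis 1 1 = transpose k1 *v (h *v v)"
    unfolding M_def matrix_vector_mul_assoc[symmetric] by (simp add: k2_def rot_axis)
  also have "h *v v = s *\<^sub>R (k1 *v axis 1 1)" using s0 by (simp add: k1_def rot_axis u_def)
  also have "transpose k1 *v (s *\<^sub>R (k1 *v axis 1 1)) = s *\<^sub>R axis 1 1"
    using SO2_inverse[OF k(1)] by (simp add: linear_scale[OF matrix_vector_mul_linear] matrix_vector_mul_assoc)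
  finally have "column 1 M = s *\<^sub>R axis 1 1" unfolding matrix_vector_mult_basis .
  then have M1: "M $ 1 $ 1 = s" "M $ 2 $ 1 = 0"
    by (simp_all add: column_def vec_eq_iff forall_2 axis_def)
  have "det M = 1" using det k by (simp add: M_def det_mul det_transpose SO2_iff)
  then have M2: "M $ 2 $ 2 = 1 / s" using M1 s0 by (simp add: det_2 field_simps)
  have Mw: "(M *v w) $ 1 = s * w $ 1 + M $ 1 $ 2 * w $ 2" "(M *v w) $ 2 = w $ 2 / s" for w
    using M1 M2 by (simp_all add: matrix_vector_mult_def sum_2)
  have M12: "M $ 1 $ 2 = 0"
  proof -
    define c where "c = M $ 1 $ 2"
    \<comment> \<open>The first row of \<open>M\<close> itself: the first coordinate of its image is
      its squared norm, so the bound by \<open>s\<close> forces the row to have norm at most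
      \<open>s\<close>.\<close>
    define w :: "real^2" where "w = vector [s, c]"
    have w: "w $ 1 = s" "w $ 2 = c" by (simp_all add: w_def vector_def)
    have nw: "(norm w)\<^sup>2 = s * s + c * c" using nsq[of w] w by simp
    have pos: "0 < norm w" using w s0 by (metis zero_less_norm_iff zero_index less_irrefl)
    have "(norm w)\<^sup>2 = (M *v w) $ 1" unfolding nw Mw w c_def by simp
    also have "\<dots> \<le> norm (M *v w)" using component_le_norm_cart[of "M *v w" 1] by simp
    also have "\<dots> \<le> s * norm w" by (rule Mnorm)
    finally have "norm w \<le> s" using pos by (simp add: power2_eq_square)
    then have "(norm w)\<^sup>2 \<le> s\<^sup>2" by (intro power_mono) auto
    then have "c * c \<le> 0" unfolding nw by (simp add: power2_eq_square)
    then show ?thesis by (auto simp: c_def mult_le_0_iff)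
  qed
  have "M = diag2 s" using M1 M2 M12 by (simp add: mat2_eq_iff)
  then have "h = k1 ** diag2 s ** k2"
    using SO2_inverse[OF k(1)] SO2_inverse[OF k(2)] unfolding M_def
    by (metis matrix_mul_assoc matrix_mul_lid matrix_mul_rid)
  moreover have "1 \<le> s"
  proof -
    have "1 / s = (M *v axis 2 1) $ 2" unfolding Mw by (simp add: axis_def)
    also have "\<dots> \<le> norm (M *v axis 2 1)" using component_le_norm_cart[of "M *v axis 2 1" 2] by simp
    also have "\<dots> \<le> s" using Mnorm[of "axis 2 1"] by simp
    finally have "1 \<le> s * s" using s0 by (simp add: field_simps)
    then show ?thesis using s0 by (metis mult_le_one not_le less_imp_le mult_less_cancel_left2 dual_order.strict_trans1)
  qed
  ultimately show ?thesis using that k on by blast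
qed

lemma continuous_on_matrix_mult: "continuous_on UNIV (\<lambda>p :: (real^2^2) \<times> (real^2^2). fst p ** snd p)"
  unfolding matrix_matrix_mult_def by (intro continuous_intros continuous_on_vec_lambda)

lemma continuous_on_act: "continuous_on UNIV (\<lambda>k. act l k x)"
proof -
  have ax: "continuous_on UNIV (\<lambda>k. act l k (axis T 1) $ S)" if T: "card T = l" for S T
  proof (cases "card S = l")
    case False
    then have "act l k (axis T 1) $ S = 0" for k using ext_pow_nth[OF ext_map_in_ext_pow] by blast
    then show ?thesis by simp
  next
    case True
    have entry: "continuous_on UNIV (\<lambda>k. rho k $ p $ q)" for p q
      by (cases "fst p = fst q") (auto simp: rho_def intro!: continuous_intros)
    show ?thesis unfolding ext_map_nth_axis[OF True T]
      by (intro continuous_intros continuous_on_prod entry)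
  qed
  have "continuous_on UNIV (\<lambda>k. act l k x $ S)" for S
  proof -
    have eq: "(\<lambda>k. act l k x $ S) = (\<lambda>k. \<Sum>T | card T = l. x $ T * act l k (axis T 1) $ S)"
      by (subst act_eq_sum) simp
    show ?thesis unfolding eq by (intro continuous_on_sum continuous_on_mult continuous_on_const ax) simp
  qed
  then have "continuous_on UNIV (\<lambda>k. \<chi> S. act l k x $ S)" by (rule continuous_on_vec_lambda)
  then show ?thesis by simp
qed

section \<open>Integration against Haar measure on the rotations\<close>

lemma haar_measurable:
  assumes haar: "normalized_haar SO2 \<sigma>"
  shows "space \<sigma> = SO2" "(\<lambda>k. k) \<in> measurable \<sigma> borel"
    "g \<in> measurable N borel \<Longrightarrow> (\<And>y. y \<in> space N \<Longrightarrow> g y \<in> SO2) \<Longrightarrow> g \<in> measurable N \<sigma>"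
proof -
  have sets: "sets \<sigma> = sets (restrict_space borel SO2)" using haar by (simp add: normalized_haar_def)
  show "space \<sigma> = SO2" using sets_eq_imp_space_eq[OF sets] by (simp add: space_restrict_space)
  show "(\<lambda>k. k) \<in> measurable \<sigma> borel"
    unfolding measurable_cong_sets[OF sets refl] by (rule measurable_restrict_space1) simp
  show "g \<in> measurable N \<sigma>" if "g \<in> measurable N borel" "\<And>y. y \<in> space N \<Longrightarrow> g y \<in> SO2"
    unfolding measurable_cong_sets[OF refl sets] using that by (intro measurable_restrict_space2) auto
qed

lemma matrix_mult_measurable:
  fixes g1 g2 :: "'b \<Rightarrow> real^2^2"
  assumes "g1 \<in> measurable N borel" "g2 \<in> measurable N borel"
  shows "(\<lambda>y. g1 y ** g2 y) \<in> measurable N borel"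
  using borel_measurable_continuous_Pair[OF assms continuous_on_matrix_mult] by simp

lemma haar_translate_measurable:
  assumes "normalized_haar SO2 \<sigma>" "k \<in> SO2"
  shows "(\<lambda>x. k ** x) \<in> measurable \<sigma> \<sigma>"
  using assms by (intro haar_measurable(3)[OF assms(1)] matrix_mult_measurable haar_measurable(2))
    (auto simp: haar_measurable(1) intro: SO2_mult)

lemma haar_translate:
  assumes haar: "normalized_haar SO2 \<sigma>" and k: "k \<in> SO2" and F: "F \<in> borel_measurable \<sigma>"
  shows "(\<integral>\<^sup>+x. F (k ** x) \<partial>\<sigma>) = (\<integral>\<^sup>+x. F x \<partial>\<sigma>)"
proof -
  have "distr \<sigma> \<sigma> (\<lambda>x. k ** x) = \<sigma>" using haar k by (simp add: normalized_haar_def)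
  then have "(\<integral>\<^sup>+x. F x \<partial>\<sigma>) = (\<integral>\<^sup>+x. F x \<partial>distr \<sigma> \<sigma> (\<lambda>x. k ** x))" by simp
  also have "\<dots> = (\<integral>\<^sup>+x. F (k ** x) \<partial>\<sigma>)"
    by (rule nn_integral_distr[OF haar_translate_measurable[OF haar k]]) (simp add: F)
  finally show ?thesis ..
qed

lemma haar_finite:
  assumes "normalized_haar SO2 \<sigma>" shows "finite_measure \<sigma>"
  using assms by (intro finite_measureI) (simp add: haar_measurable(1) normalized_haar_def)

text \<open>Since \<open>\<sigma>\<close> is invariant, one may average over an arbitrary arc \<open>\<kappa>\<close> before integrating; no
  comparison of \<open>\<sigma>\<close> with Lebesgue measure on the circle is needed.\<close>

lemma haar_arc_average:
  assumes haar: "normalized_haar SO2 \<sigma>" and \<kappa>: "continuous_on UNIV \<kappa>" "\<And>x. \<kappa> x \<in> SO2"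
    and F: "F \<in> borel_measurable \<sigma>"
  shows "(\<integral>\<^sup>+k. F k \<partial>\<sigma>) = (\<integral>\<^sup>+k. (\<integral>\<^sup>+x. F (\<kappa> x ** k) * indicator {0..<1::real} x \<partial>lborel) \<partial>\<sigma>)"
proof -
  interpret finite_measure \<sigma> by (rule haar_finite[OF haar])
  interpret pair_sigma_finite lborel \<sigma> by unfold_locales
  have joint: "(\<lambda>p. F (\<kappa> (fst p) ** snd p)) \<in> borel_measurable (lborel \<Otimes>\<^sub>M \<sigma>)"
  proof -
    have \<kappa>m: "\<kappa> \<in> measurable lborel borel" using borel_measurable_continuous_onI[OF \<kappa>(1)] by simp
    have "(\<lambda>p. \<kappa> (fst p) ** snd p) \<in> measurable (lborel \<Otimes>\<^sub>M \<sigma>) \<sigma>"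
      by (intro haar_measurable(3)[OF haar] matrix_mult_measurable measurable_compose[OF measurable_fst \<kappa>m]
          measurable_compose[OF measurable_snd haar_measurable(2)[OF haar]])
        (auto simp: space_pair_measure haar_measurable(1)[OF haar] intro: SO2_mult \<kappa>)
    from measurable_compose[OF this F] show ?thesis .
  qed
  have Fx: "(\<lambda>k. F (\<kappa> x ** k)) \<in> borel_measurable \<sigma>" for x
    using measurable_compose[OF haar_translate_measurable[OF haar \<kappa>(2)] F] .
  let ?G = "\<lambda>x k. F (\<kappa> x ** k) * indicator {0..<1::real} x"
  have G: "case_prod ?G \<in> borel_measurable (lborel \<Otimes>\<^sub>M \<sigma>)"
    unfolding split_beta' by (intro borel_measurable_times_ennreal joint) simp
  have "(\<integral>\<^sup>+k. (\<integral>\<^sup>+x. ?G x k \<partial>lborel) \<partial>\<sigma>) = (\<integral>\<^sup>+x. (\<integral>\<^sup>+k. ?G x k \<partial>\<sigma>) \<partial>lborel)"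
    by (rule Fubini'[OF G])
  also have "\<dots> = (\<integral>\<^sup>+x. (\<integral>\<^sup>+k. F k \<partial>\<sigma>) * indicator {0..<1::real} x \<partial>lborel)"
    by (intro nn_integral_cong) (simp add: nn_integral_multc Fx haar_translate[OF haar \<kappa>(2) F])
  also have "\<dots> = (\<integral>\<^sup>+k. F k \<partial>\<sigma>)" by (simp add: nn_integral_cmult_indicator)
  finally show ?thesis ..
qed

text \<open>Rotation by \<open>- arctan x\<close>.\<close>

definition rot_arc :: "real \<Rightarrow> real^2^2" where
  "rot_arc x = vector [vector [1 / sqrt (1 + x\<^sup>2), x / sqrt (1 + x\<^sup>2)], vector [- x / sqrt (1 + x\<^sup>2), 1 / sqrt (1 + x\<^sup>2)]]"

lemma rot_arc_nth [simp]: "rot_arc x $ 1 $ 1 = 1 / sqrt (1 + x\<^sup>2)" "rot_arc x $ 1 $ 2 = x / sqrt (1 + x\<^sup>2)"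
  "rot_arc x $ 2 $ 1 = - x / sqrt (1 + x\<^sup>2)" "rot_arc x $ 2 $ 2 = 1 / sqrt (1 + x\<^sup>2)"
  by (simp_all add: rot_arc_def vector_def)

lemma arc_sqrt: "0 < sqrt (1 + x\<^sup>2)" "sqrt (1 + x\<^sup>2) * sqrt (1 + x\<^sup>2) = 1 + x * x"
proof -
  have "0 < 1 + x\<^sup>2" by (simp add: add_pos_nonneg)
  then show "0 < sqrt (1 + x\<^sup>2)" "sqrt (1 + x\<^sup>2) * sqrt (1 + x\<^sup>2) = 1 + x * x"
    by (simp_all add: power2_eq_square)
qed

lemma rot_arc_SO2: "rot_arc x \<in> SO2"
proof -
  define r where "r = sqrt (1 + x\<^sup>2)"
  have r: "0 < r" "r * r = 1 + x * x" using arc_sqrt by (auto simp: r_def)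
  then have "1 + x * x \<noteq> 0" by (metis mult_pos_pos less_irrefl)
  show ?thesis
    unfolding SO2_iff mat2_eq_iff mat2_mult_nth transpose_def det_2 mat_def
    using r \<open>1 + x * x \<noteq> 0\<close> by (simp add: r_def[symmetric] divide_simps)
qed

lemma continuous_rot_arc: "continuous_on UNIV rot_arc"
proof -
  have nz: "sqrt (1 + x\<^sup>2) \<noteq> 0" for x :: real
    using arc_sqrt(1)[of x] by (rule less_imp_neq[THEN not_sym])
  have "continuous_on UNIV (\<lambda>x::real. 1 / sqrt (1 + x\<^sup>2))" "continuous_on UNIV (\<lambda>x::real. x / sqrt (1 + x\<^sup>2))"
    "continuous_on UNIV (\<lambda>x::real. - x / sqrt (1 + x\<^sup>2))"
    by (intro continuous_intros ballI nz)+
  then have "continuous_on UNIV (\<lambda>x. rot_arc x $ i $ j)" for i j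
    using exhaust_2[of i] exhaust_2[of j] by (elim disjE) (simp_all only: rot_arc_nth)
  then have "continuous_on UNIV (\<lambda>x. \<chi> i j. rot_arc x $ i $ j)" by (intro continuous_on_vec_lambda)
  then show ?thesis by simp
qed

text \<open>Up to a lower triangular factor, which is bounded after conjugation by the contracting
  \<open>diag2 (2^n)\<close>, the rotation \<open>rot_arc x\<close> is the unipotent \<open>unip x\<close>.\<close>

lemma unip_eq_rot_arc:
  assumes "x \<in> {0..1}"
  obtains b where "norm b \<le> 8" "diag2 (2^n) ** unip x = b ** (diag2 (2^n) ** rot_arc x)"
proof
  define r where "r = sqrt (1 + x\<^sup>2)"
  define t where "t = (2::real)^n"
  have r: "0 < r" "r * r = 1 + x * x" using arc_sqrt by (auto simp: r_def)
  have t: "1 \<le> t" by (simp add: t_def one_le_power)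
  have xx: "0 \<le> x" "x \<le> 1" using assms by auto
  have r1: "1 \<le> r" unfolding r_def by simp
  have r2: "r \<le> 2" unfolding r_def
    using xx by (intro real_le_lsqrt) (auto simp: power2_eq_square intro: order_trans[OF mult_mono[of x 1 x 1]])
  \<comment> \<open>The triangular factor has lower left entry \<open>x / r\<close>; conjugation by
    \<open>diag2 t\<close> divides it by \<open>t * t\<close>, so it stays bounded.\<close>
  let ?b = "vector [vector [r, 0], vector [x / (r * t * t), 1 / r]] :: real^2^2"
  have b: "?b $ 1 $ 1 = r" "?b $ 1 $ 2 = 0" "?b $ 2 $ 1 = x / (r * t * t)" "?b $ 2 $ 2 = 1 / r"
    by (simp_all add: vector_def)
  have "1 * 1 * 1 \<le> r * t * t" using r1 t by (intro mult_mono) auto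
  then have "\<bar>x / (r * t * t)\<bar> \<le> 1" using xx by (simp add: abs_le_iff divide_le_eq)
  moreover have "\<bar>1 / r\<bar> \<le> 1" using r1 by simp
  moreover have "norm ?b \<le> \<bar>r\<bar> + \<bar>0\<bar> + \<bar>x / (r * t * t)\<bar> + \<bar>1 / r\<bar>"
    using norm_mat2_le[of ?b] unfolding b .
  ultimately show "norm ?b \<le> 8" using r1 r2 by linarith
  show "diag2 (2^n) ** unip x = ?b ** (diag2 (2^n) ** rot_arc x)"
    unfolding mat2_eq_iff mat2_mult_nth b using r t
    by (simp add: r_def[symmetric] t_def[symmetric] divide_simps)
qed

text \<open>Covolumes grow at most by \<open>Ca\<close> under \<open>b\<close>, so their inverses
  shrink at most by this factor; this absorbs each bounded group element.\<close>

lemma ealpha_act_le: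
  fixes B :: "real^('d::finite \<times> 2)^('d \<times> 2)"
  assumes Ca: "\<And>l g x. l \<le> 2 * CARD('d) \<Longrightarrow> norm g \<le> 8 \<Longrightarrow> norm (act l g (x :: real^(('d \<times> 2) set))) \<le> Ca * norm x"
    "1 \<le> Ca"
    and B: "invertible B" and g: "g2 = b ** g1" "norm b \<le> 8" "det g1 \<noteq> 0" "det g2 \<noteq> 0"
  shows "ealpha (rho g1 ** B) \<le> Ca * ealpha (rho g2 ** B)"
proof -
  have card: "CARD('d \<times> 2) = 2 * CARD('d)" by simp
  have inv: "invertible (rho g1 ** B)" "invertible (rho g2 ** B)"
    using g(3,4) B by (auto intro: invertible_mult invertible_rho)
  have "ealpha_l l (rho g1 ** B) \<le> Ca * ealpha (rho g2 ** B)" if l: "l \<le> CARD('d \<times> 2)" for l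
  proof (rule ealpha_l_least[OF l])
    fix L :: "(real^('d \<times> 2)) set" assume L: "L \<in> Rat l"
    let ?x1 = "ext_map l (rho g1 ** B) (lat_wedge L)" and ?x2 = "ext_map l (rho g2 ** B) (lat_wedge L)"
    have "?x2 = act l b ?x1" by (simp add: g(1) rho_mult ext_map_mult)
    then have "norm ?x2 \<le> Ca * norm ?x1" using Ca(1)[OF l[unfolded card] g(2)] by metis
    moreover have "0 < norm ?x1" "0 < norm ?x2"
      using ext_map_nonzero[OF inv(1) lat_wedge_props(1,3)[OF L]] ext_map_nonzero[OF inv(2) lat_wedge_props(1,3)[OF L]] .
    ultimately have "inv_covol (rho g1 ** B) L \<le> Ca * inv_covol (rho g2 ** B) L"
      unfolding inv_covol_eq[OF L] by (simp add: field_simps)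
    also have "\<dots> \<le> Ca * ealpha (rho g2 ** B)"
      using inv_covol_le[OF inv(2) L] ealpha_l_le[OF l, of "rho g2 ** B"] Ca(2) by (intro mult_left_mono) auto
    finally show "inv_covol (rho g1 ** B) L \<le> Ca * ealpha (rho g2 ** B)" .
  qed
  then show ?thesis unfolding ealpha_def[of "rho g1 ** B"] by (intro Max.boundedI) auto
qed

lemma ealpha_haar_measurable:
  fixes B :: "real^('d::finite \<times> 2)^('d \<times> 2)"
  assumes haar: "normalized_haar SO2 \<sigma>" and B: "invertible B" and g: "det g \<noteq> 0"
  shows "(\<lambda>k. ealpha (rho (g ** k) ** B)) \<in> borel_measurable \<sigma>"
  unfolding ealpha_def
proof (rule borel_measurable_Max)
  fix l assume "l \<in> {0..CARD('d \<times> 2)}"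
  show "(\<lambda>k. ealpha_l l (rho (g ** k) ** B)) \<in> borel_measurable \<sigma>"
  proof (rule ealpha_l_measurable)
    fix w
    have "continuous_on UNIV (\<lambda>k. norm (act l g (act l k (ext_map l B w))))"
      by (intro continuous_on_norm continuous_on_compose2[OF linear_continuous_on continuous_on_act]) (auto simp: linear_linear linear_ext_map)
    then have "(\<lambda>k. norm (act l g (act l k (ext_map l B w)))) \<in> borel_measurable borel"
      by (rule borel_measurable_continuous_onI)
    from measurable_compose[OF haar_measurable(2)[OF haar] this]
    show "(\<lambda>k. norm (ext_map l (rho (g ** k) ** B) w)) \<in> borel_measurable \<sigma>"
      by (simp add: ext_map_mult act_mult)
  next
    fix k assume "k \<in> space \<sigma>"
    then show "invertible (rho (g ** k) ** B)"
      using g B by (intro invertible_mult invertible_rho) (auto simp: haar_measurable(1)[OF haar] det_mul SO2_iff)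
  qed
qed simp

text \<open>By \<open>alpha_l_eq\<close> each dimension gives a countable supremum of functions that
  are continuous on the rotations.\<close>

lemma alpha_haar_measurable:
  fixes B :: "real^('d::finite \<times> 2)^('d \<times> 2)"
  assumes haar: "normalized_haar SO2 \<sigma>" and B: "invertible B" and h: "det h \<noteq> 0"
    and q: "\<And>i. 1 \<le> i \<Longrightarrow> i \<le> 2 * CARD('d) \<Longrightarrow> quasinorm_on (ext_pow i) (q i)"
    and sym: "\<And>i x. 1 \<le> i \<Longrightarrow> i \<le> 2 * CARD('d) \<Longrightarrow> x \<in> ext_pow i \<Longrightarrow> q i (- x) = q i x"
    and bdd: "\<And>l k. l \<le> 2 * CARD('d) \<Longrightarrow> k \<in> SO2 \<Longrightarrow>
      bdd_above ((\<lambda>w. 1 / (if l = 0 then 1 else q l (ext_map l (rho (h ** k) ** B) w))) ` lat_wedge ` Rat l)"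
  shows "(\<lambda>k. alpha q ((*v) (rho (h ** k) ** B) ` zvec)) \<in> borel_measurable \<sigma>"
  unfolding alpha_def
proof (rule borel_measurable_Max)
  have card: "CARD('d \<times> 2) = 2 * CARD('d)" by simp
  have sets: "sets \<sigma> = sets (restrict_space borel SO2)" using haar by (simp add: normalized_haar_def)
  note sp = haar_measurable(1)[OF haar]
  fix l assume "l \<in> {0..CARD('d \<times> 2)}"
  then have l: "l \<le> 2 * CARD('d)" unfolding card by simp
  have inv: "invertible (rho (h ** k) ** B)" if "k \<in> SO2" for k
    using h B that by (intro invertible_mult invertible_rho) (auto simp: det_mul SO2_iff)
  have "(\<lambda>k. SUP w\<in>lat_wedge ` Rat l. 1 / (if l = 0 then 1 else q l (ext_map l (rho (h ** k) ** B) w))) \<in> borel_measurable \<sigma>"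
  proof (rule borel_measurable_cSUP[OF countable_lat_wedge])
    fix w :: "real^(('d \<times> 2) set)"
    show "(\<lambda>k. 1 / (if l = 0 then 1 else q l (ext_map l (rho (h ** k) ** B) w))) \<in> borel_measurable \<sigma>"
    proof (cases "l = 0")
      case False
      then have qc: "continuous_on (ext_pow l) (q l)" using q[of l] l by (simp add: quasinorm_on_def)
      have "continuous_on UNIV (\<lambda>k. act l h (act l k (ext_map l B w)))"
        by (intro continuous_on_compose2[OF linear_continuous_on continuous_on_act]) (auto simp: linear_linear linear_ext_map)
      then have "continuous_on SO2 (\<lambda>k. act l h (act l k (ext_map l B w)))" by (rule continuous_on_subset) simp
      then have "continuous_on SO2 (\<lambda>k. q l (act l h (act l k (ext_map l B w))))"
        by (rule continuous_on_compose2[OF qc]) (auto simp: ext_map_in_ext_pow)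
      then have "(\<lambda>k. q l (act l h (act l k (ext_map l B w)))) \<in> borel_measurable \<sigma>"
        unfolding measurable_cong_sets[OF sets refl] by (rule borel_measurable_continuous_on_restrict)
      then have "(\<lambda>k. 1 / q l (act l h (act l k (ext_map l B w)))) \<in> borel_measurable \<sigma>" by simp
      then show ?thesis using False by (simp add: ext_map_mult act_mult)
    qed simp
  next
    fix k assume "k \<in> space \<sigma>"
    then show "bdd_above ((\<lambda>w. 1 / (if l = 0 then 1 else q l (ext_map l (rho (h ** k) ** B) w))) ` lat_wedge ` Rat l)"
      using bdd[OF l] by (simp only: sp)
  qed
  then show "(\<lambda>k. alpha_l q l ((*v) (rho (h ** k) ** B) ` zvec)) \<in> borel_measurable \<sigma>"
  proof (rule measurable_cong[THEN iffD1, rotated])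
    fix k assume "k \<in> space \<sigma>"
    then have k: "k \<in> SO2" by (simp only: sp)
    show "(SUP w\<in>lat_wedge ` Rat l. 1 / (if l = 0 then 1 else q l (ext_map l (rho (h ** k) ** B) w)))
        = alpha_l q l ((*v) (rho (h ** k) ** B) ` zvec)"
      by (rule alpha_l_eq[OF inv[OF k], symmetric]) (rule sym[OF _ l])
  qed
qed simp

lemma quasinorms_equiv:
  assumes q: "\<And>i. 1 \<le> i \<Longrightarrow> i \<le> n \<Longrightarrow> quasinorm_on (ext_pow i) (q i :: real^('n::finite set) \<Rightarrow> real)"
  obtains c C where "0 < c" "c \<le> 1" "1 \<le> C"
    "\<And>i x. 1 \<le> i \<Longrightarrow> i \<le> n \<Longrightarrow> x \<in> ext_pow i \<Longrightarrow> c * norm x \<le> q i x"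
    "\<And>i x. 1 \<le> i \<Longrightarrow> i \<le> n \<Longrightarrow> x \<in> ext_pow i \<Longrightarrow> q i x \<le> C * norm x"
proof -
  have sub: "subspace (ext_pow i :: (real^('n set)) set)" for i by (simp add: ext_pow_def)
  have "\<forall>i. \<exists>p. 1 \<le> i \<and> i \<le> n \<longrightarrow> 0 < fst p \<and> (\<forall>x\<in>ext_pow i. fst p * norm x \<le> q i x \<and> q i x \<le> snd p * norm x)"
  proof
    fix i
    show "\<exists>p. 1 \<le> i \<and> i \<le> n \<longrightarrow> 0 < fst p \<and> (\<forall>x\<in>ext_pow i. fst p * norm x \<le> q i x \<and> q i x \<le> snd p * norm x)"
    proof (cases "1 \<le> i \<and> i \<le> n")
      case True
      then have qi: "quasinorm_on (ext_pow i) (q i)" using q by blast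
      obtain c C where "0 < c" "\<And>x. x \<in> ext_pow i \<Longrightarrow> c * norm x \<le> q i x" "\<And>x. x \<in> ext_pow i \<Longrightarrow> q i x \<le> C * norm x"
        using quasinorm_equiv[OF qi sub] by metis
      then show ?thesis by (intro exI[of _ "(c, C)"]) auto
    qed auto
  qed
  then obtain p where p: "\<And>i. 1 \<le> i \<Longrightarrow> i \<le> n \<Longrightarrow> 0 < fst (p i)"
    "\<And>i x. 1 \<le> i \<Longrightarrow> i \<le> n \<Longrightarrow> x \<in> ext_pow i \<Longrightarrow> fst (p i) * norm x \<le> q i x \<and> q i x \<le> snd (p i) * norm x"
    unfolding choice_iff by blast
  \<comment> \<open>Inserting 1 covers dimension 0, where the covolume is 1 for the quasinorms and
    the Euclidean norms alike, so the comparison asks for \<open>c \<le> 1\<close> and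
    \<open>1 \<le> C\<close>.\<close>
  define c where "c = Min (insert 1 ((fst \<circ> p) ` {1..n}))"
  define C where "C = Max (insert 1 ((snd \<circ> p) ` {1..n}))"
  show ?thesis
  proof (rule that[of c C])
    show "0 < c" unfolding c_def using p(1) by (subst Min_gr_iff) auto
    show "c \<le> 1" unfolding c_def by (rule Min_le) auto
    show "1 \<le> C" unfolding C_def by (rule Max_ge) auto
    fix i and x :: "real^('n set)" assume i: "1 \<le> i" "i \<le> n" and x: "x \<in> ext_pow i"
    have "c \<le> fst (p i)" unfolding c_def using i by (intro Min_le) auto
    then have "c * norm x \<le> fst (p i) * norm x" by (intro mult_right_mono) auto
    then show "c * norm x \<le> q i x" using p(2)[OF i x] by simp
    have "snd (p i) \<le> C" unfolding C_def using i by (intro Max_ge) auto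
    then have "snd (p i) * norm x \<le> C * norm x" by (intro mult_right_mono) auto
    then show "q i x \<le> C * norm x" using p(2)[OF i x] by simp
  qed
qed

theorem theorem6p11:
  fixes q :: "nat \<Rightarrow> real^(('d::finite \<times> 2) set) \<Rightarrow> real"
    and \<beta> :: real
    and \<sigma> :: "(real^2^2) measure"
  assumes haar: "normalized_haar SO2 \<sigma>"
    and quasinorms: "\<And>i. 1 \<le> i \<Longrightarrow> i \<le> 2 * CARD('d) \<Longrightarrow> quasinorm_on (ext_pow i) (q i)"
    and invariant: "\<And>i k x. 1 \<le> i \<Longrightarrow> i \<le> 2 * CARD('d) \<Longrightarrow> k \<in> SO2 \<Longrightarrow> x \<in> ext_pow i \<Longrightarrow>
      q i (ext_map i (rho k) x) = q i x"
    and "\<beta> > 0"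
    and "\<beta> * real CARD('d) > 2"
  shows "\<exists>R::real. \<forall>h\<in>SL2. \<forall>\<Delta> :: (real^('d \<times> 2)) set. lattice_in UNIV \<Delta> \<longrightarrow>
    integrable \<sigma> (\<lambda>k. alpha q ((\<lambda>v. rho (h ** k) *v v) ` \<Delta>) powr \<beta>) \<and>
    (LINT k|\<sigma>. alpha q ((\<lambda>v. rho (h ** k) *v v) ` \<Delta>) powr \<beta>)
      \<le> R * alpha q \<Delta> powr \<beta> * onorm (\<lambda>v. h *v v) powr (\<beta> * real CARD('d) - 2)"
proof -
  note \<beta> = \<open>\<beta> > 0\<close> \<open>\<beta> * real CARD('d) > 2\<close>
  let ?e = "\<beta> * real CARD('d) - 2"
  have card: "CARD('d \<times> 2) = 2 * CARD('d)" by simp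
  obtain c C where c: "0 < c" "c \<le> 1" "1 \<le> C"
    and q: "\<And>i x. 1 \<le> i \<Longrightarrow> i \<le> 2 * CARD('d) \<Longrightarrow> x \<in> ext_pow i \<Longrightarrow> c * norm x \<le> q i x"
      "\<And>i x. 1 \<le> i \<Longrightarrow> i \<le> 2 * CARD('d) \<Longrightarrow> x \<in> ext_pow i \<Longrightarrow> q i x \<le> C * norm x"
    using quasinorms_equiv[OF quasinorms] by metis
  have sym: "q i (- x) = q i x" if "1 \<le> i" "i \<le> 2 * CARD('d)" "x \<in> ext_pow i" for i x
  proof -
    have "q i ((-1) *\<^sub>R x) = \<bar>-1\<bar> * q i x" using quasinorms[OF that(1,2)] that(3) unfolding quasinorm_on_def by blast
    then show ?thesis by simp
  qed
  have compare: "alpha q ((*v) A ` zvec) \<le> ealpha A / c" "ealpha A \<le> C * alpha q ((*v) A ` zvec)"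
    "l \<le> 2 * CARD('d) \<Longrightarrow> bdd_above ((\<lambda>w. 1 / (if l = 0 then 1 else q l (ext_map l A w))) ` lat_wedge ` Rat l)"
    if A: "invertible A" for A :: "real^('d \<times> 2)^('d \<times> 2)" and l
  proof -
    show "alpha q ((*v) A ` zvec) \<le> ealpha A / c"
      by (rule alpha_compare(1)[OF c A]) (unfold card, (rule q sym; assumption)+)
    show "ealpha A \<le> C * alpha q ((*v) A ` zvec)"
      by (rule alpha_compare(2)[OF c A]) (unfold card, (rule q sym; assumption)+)
    show "bdd_above ((\<lambda>w. 1 / (if l = 0 then 1 else q l (ext_map l A w))) ` lat_wedge ` Rat l)" if "l \<le> 2 * CARD('d)"
      by (rule alpha_compare(3)[OF c A]) (unfold card, (rule q sym; assumption)+, rule that)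
  qed
  obtain Ca where Ca: "1 \<le> Ca" "\<And>l g x. l \<le> 2 * CARD('d) \<Longrightarrow> norm g \<le> 8 \<Longrightarrow>
      norm (act l g (x :: real^(('d \<times> 2) set))) \<le> Ca * norm x"
    by (rule act_bounded[of 8]) (simp, blast)
  have act_le: "ealpha (rho g1 ** B) \<le> Ca * ealpha (rho g2 ** B)"
    if "invertible B" "g2 = b ** g1" "norm b \<le> 8" "det g1 \<noteq> 0" "det g2 \<noteq> 0"
    for B :: "real^('d \<times> 2)^('d \<times> 2)" and g1 g2 b
    by (rule ealpha_act_le[OF _ Ca(1) that]) (rule Ca(2); assumption)
  obtain R0 where R0: "\<And>(B :: real^('d \<times> 2)^('d \<times> 2)) n. invertible B \<Longrightarrow>
    (\<integral>\<^sup>+x\<in>{0..<1}. ennreal (ealpha (rho (diag2 (2^n) ** unip x) ** B) powr \<beta>) \<partial>lborel)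
    \<le> ennreal (R0 * ealpha B powr \<beta> * 2 powr (?e * real n))"
    using unipotent_average[where 'd='d, OF \<beta>(1,2)] by blast
  \<comment> \<open>\<open>R0\<close> comes without a sign; the later products in
    \<open>ennreal\<close> call for a nonnegative constant.\<close>
  define R1 where "R1 = max 0 R0"
  \<comment> \<open>The factors stem, in this order, from replacing \<open>h\<close> by
    \<open>diag2 (2^n)\<close> and quasinorms by norms, replacing the arc by unipotents, the
    unipotent average, removing the rotation \<open>k\<close> from the base lattice, and returning
    to quasinorms.\<close>
  define R where "R = (Ca / c) powr \<beta> * Ca powr \<beta> * R1 * Ca powr \<beta> * C powr \<beta>"
  have R1: "0 \<le> R1" "R0 \<le> R1" by (auto simp: R1_def)
  show ?thesis
  proof (intro exI[of _ R] ballI allI impI)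
    fix h and \<Delta> :: "(real^('d \<times> 2)) set" assume h: "h \<in> SL2" and "lattice_in UNIV \<Delta>"
    then obtain B :: "real^('d \<times> 2)^('d \<times> 2)" where B: "invertible B" "\<Delta> = (*v) B ` zvec"
      using lattice_eq_image by blast
    have dh: "det h = 1" using h by (simp add: SL2_def)
    obtain k1 k2 s where k: "k1 \<in> SO2" "k2 \<in> SO2" and s: "1 \<le> s" "h = k1 ** diag2 s ** k2" "s = onorm (\<lambda>v. h *v v)"
      using singular_values[OF h] by metis
    \<comment> \<open>The averages are known only at the scales \<open>2^n\<close>; the ratio of
      \<open>2^n\<close> to \<open>s\<close> lies between 1/2 and 1 and is absorbed as a bounded
      factor.\<close>
    define n where "n = nat \<lfloor>log 2 s\<rfloor>"
    have n: "2^n \<le> s" "s \<le> 2 * 2^n"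
    proof -
      have "0 \<le> log 2 s" using s(1) by simp
      then have ln: "real n \<le> log 2 s" "log 2 s \<le> real n + 1" unfolding n_def by linarith+
      have "2 powr real n \<le> s" using ln(1) s(1) by (simp add: le_log_iff)
      then show "2^n \<le> s" by (simp add: powr_realpow)
      have "s \<le> 2 powr (real n + 1)" using ln(2) s(1) by (simp add: log_le_iff)
      then show "s \<le> 2 * 2^n" by (simp add: powr_add powr_realpow)
    qed
    have image: "(\<lambda>v. rho (h ** k) *v v) ` \<Delta> = (*v) (rho (h ** k) ** B) ` zvec" for k
      by (simp add: B(2) image_image matrix_vector_mul_assoc)
    define F where "F k = alpha q ((\<lambda>v. rho (h ** k) *v v) ` \<Delta>) powr \<beta>" for k
    define G where "G k = ennreal (ealpha (rho (diag2 (2^n) ** k) ** B) powr \<beta>)" for k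
    have invh: "invertible (rho (h ** k) ** B)" if "k \<in> SO2" for k
      using that dh B(1) by (intro invertible_mult invertible_rho) (auto simp: det_mul SO2_iff)
    have sp: "space \<sigma> = SO2" by (rule haar_measurable(1)[OF haar])
    have Fm: "F \<in> borel_measurable \<sigma>"
    proof -
      have "(\<lambda>k. alpha q ((*v) (rho (h ** k) ** B) ` zvec)) \<in> borel_measurable \<sigma>"
        using dh sym compare(3)[OF invh] by (intro alpha_haar_measurable[OF haar B(1)] quasinorms) auto
      then show ?thesis unfolding F_def[abs_def] image by simp
    qed
    have Gm: "G \<in> borel_measurable \<sigma>"
      using ealpha_haar_measurable[OF haar B(1), of "diag2 (2^n)"] unfolding G_def[abs_def] by simp
    have FG: "ennreal (F k) \<le> ennreal ((Ca / c) powr \<beta>) * G (k2 ** k)" if kk: "k \<in> SO2" for k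
    proof -
      let ?g = "diag2 (2^n) ** (k2 ** k)"
      define r where "r = 2^n / s"
      have det_g: "det ?g \<noteq> 0" "det (h ** k) \<noteq> 0" using k kk dh by (auto simp: det_mul SO2_iff)
      have r: "0 < r" "r \<le> 1" "1 / r \<le> 2" "r * s = 2^n" using n s(1) by (auto simp: r_def divide_le_eq)
      then have r': "\<bar>r\<bar> \<le> 1" "\<bar>1 / r\<bar> \<le> 2" by simp_all
      \<comment> \<open>The left rotation of \<open>h\<close> and the rounding of \<open>s\<close>
        go into one bounded left factor; \<open>k2\<close> stays beside \<open>k\<close>, where
        invariance of \<sigma> removes it.\<close>
      have eq: "?g = (diag2 r ** transpose k1) ** (h ** k)"
      proof -
        have "(diag2 r ** transpose k1) ** (h ** k) = diag2 r ** (transpose k1 ** k1) ** diag2 s ** (k2 ** k)"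
          unfolding s(2) by (simp add: matrix_mul_assoc)
        also have "\<dots> = (diag2 r ** diag2 s) ** (k2 ** k)" using SO2_inverse[OF k(1)] by (simp add: matrix_mul_assoc)
        also have "\<dots> = ?g" by (simp add: diag2_mult r(4))
        finally show ?thesis ..
      qed
      have small: "norm (diag2 r ** transpose k1) \<le> 8"
      proof -
        have "\<bar>r * k1 $ i $ j\<bar> \<le> 1 * 1" "\<bar>1 / r * k1 $ i $ j\<bar> \<le> 2 * 1" for i j
          unfolding abs_mult by (intro mult_mono r' SO2_entry[OF k(1)]; simp)+
        from this(1)[of 1 1] this(1)[of 2 1] this(2)[of 1 2] this(2)[of 2 2]
        show ?thesis using norm_mat2_le[of "diag2 r ** transpose k1"]
          by (simp add: mat2_mult_nth transpose_def)
      qed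
      have "alpha q ((*v) (rho (h ** k) ** B) ` zvec) \<le> ealpha (rho (h ** k) ** B) / c"
        by (rule compare(1)[OF invh[OF kk]])
      also have "\<dots> \<le> Ca * ealpha (rho ?g ** B) / c"
        using c by (intro divide_right_mono act_le[OF B(1) eq small det_g(2,1)]) auto
      finally have le: "alpha q ((*v) (rho (h ** k) ** B) ` zvec) \<le> (Ca / c) * ealpha (rho ?g ** B)" by simp
      have "0 < C * alpha q ((*v) (rho (h ** k) ** B) ` zvec)"
        using compare(2)[OF invh[OF kk]] ealpha_pos[OF invh[OF kk]] by linarith
      then have "0 \<le> alpha q ((*v) (rho (h ** k) ** B) ` zvec)" using c(3) by (simp add: zero_less_mult_iff)
      then have "F k \<le> ((Ca / c) * ealpha (rho ?g ** B)) powr \<beta>"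
        unfolding F_def image using le \<beta>(1) by (intro powr_mono2) auto
      from this[unfolded powr_mult] show ?thesis unfolding G_def by (simp add: ennreal_leI flip: ennreal_mult)
    qed
    have Gint: "(\<integral>\<^sup>+k. G k \<partial>\<sigma>) \<le> ennreal (Ca powr \<beta> * (R1 * Ca powr \<beta> * ealpha B powr \<beta> * 2 powr (?e * real n)))"
    proof -
      have inner: "(\<integral>\<^sup>+x. G (rot_arc x ** k) * indicator {0..<1::real} x \<partial>lborel)
        \<le> ennreal (Ca powr \<beta> * (R1 * Ca powr \<beta> * ealpha B powr \<beta> * 2 powr (?e * real n)))" if kk: "k \<in> SO2" for k
      proof -
        let ?B = "rho k ** B"
        let ?H = "\<lambda>x. ennreal (ealpha (rho (diag2 (2^n) ** unip x) ** ?B) powr \<beta>) * indicator {0..<1} x"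
        have inv: "invertible ?B" using kk B(1) by (intro invertible_mult invertible_rho) (auto simp: SO2_iff)
        have pw: "G (rot_arc x ** k) \<le> ennreal (Ca powr \<beta>) * ennreal (ealpha (rho (diag2 (2^n) ** unip x) ** ?B) powr \<beta>)"
          if x: "x \<in> {0..<1}" for x
        proof -
          obtain b where b: "norm b \<le> 8" "diag2 (2^n) ** unip x = b ** (diag2 (2^n) ** rot_arc x)"
            using unip_eq_rot_arc[of x n] x by auto
          have "ealpha (rho (diag2 (2^n) ** rot_arc x) ** ?B) \<le> Ca * ealpha (rho (diag2 (2^n) ** unip x) ** ?B)"
            using rot_arc_SO2[of x] by (intro act_le[OF inv b(2,1)]) (auto simp: det_mul SO2_iff)
          moreover have "rho (diag2 (2^n) ** (rot_arc x ** k)) ** B = rho (diag2 (2^n) ** rot_arc x) ** ?B"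
            by (simp add: rho_mult matrix_mul_assoc)
          moreover have "invertible (rho (diag2 (2^n) ** rot_arc x) ** ?B)"
            using rot_arc_SO2[of x] by (intro invertible_mult[OF invertible_rho inv]) (auto simp: det_mul SO2_iff)
          ultimately have "ealpha (rho (diag2 (2^n) ** (rot_arc x ** k)) ** B) powr \<beta>
              \<le> (Ca * ealpha (rho (diag2 (2^n) ** unip x) ** ?B)) powr \<beta>"
            using \<beta>(1) ealpha_pos by (intro powr_mono2) (auto intro: less_imp_le)
          then show ?thesis unfolding G_def by (simp add: powr_mult ennreal_leI flip: ennreal_mult)
        qed
        \<comment> \<open>Rotations are bounded, so \<open>ealpha\<close> changes under them at most
          by \<open>Ca\<close>, uniformly in \<open>k\<close>.\<close>
        have Bk: "ealpha ?B \<le> Ca * ealpha B"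
        proof -
          have "ealpha (rho k ** B) \<le> Ca * ealpha (rho (mat 1) ** B)"
          proof (rule act_le[OF B(1)])
            show "mat 1 = transpose k ** k" using SO2_inverse[OF kk] by simp
            show "norm (transpose k) \<le> 8"
              using norm_mat2_le[of "transpose k"] SO2_entry[OF SO2_transpose[OF kk], of 1 1] SO2_entry[OF SO2_transpose[OF kk], of 1 2]
                SO2_entry[OF SO2_transpose[OF kk], of 2 1] SO2_entry[OF SO2_transpose[OF kk], of 2 2] by linarith
          qed (use kk in \<open>auto simp: SO2_iff\<close>)
          then show ?thesis by (simp add: rho_one)
        qed
        have "(\<integral>\<^sup>+x. G (rot_arc x ** k) * indicator {0..<1::real} x \<partial>lborel) \<le> (\<integral>\<^sup>+x. ennreal (Ca powr \<beta>) * ?H x \<partial>lborel)"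
          using pw by (intro nn_integral_mono) (auto split: split_indicator)
        also have "\<dots> = ennreal (Ca powr \<beta>) * (\<integral>\<^sup>+x. ?H x \<partial>lborel)"
        proof (rule nn_integral_cmult)
          have "(\<lambda>x. ealpha (rho (diag2 (2^n) ** unip x) ** ?B)) \<in> borel_measurable borel"
            unfolding ealpha_def
          proof (rule borel_measurable_Max)
            fix l
            show "(\<lambda>x. ealpha_l l (rho (diag2 (2^n) ** unip x) ** ?B)) \<in> borel_measurable borel"
              by (intro ealpha_l_measurable invertible_mult[OF invertible_rho inv])
                (auto simp: ext_map_mult[of _ _ ?B] det_mul intro!: borel_measurable_continuous_onI continuous_on_norm act_unip_continuous)
          qed simp
          then show "?H \<in> borel_measurable lborel" by simp
        qed
        also have "\<dots> \<le> ennreal (Ca powr \<beta>) * ennreal (R0 * ealpha ?B powr \<beta> * 2 powr (?e * real n))"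
          by (intro mult_left_mono R0[OF inv]) simp
        also have "\<dots> \<le> ennreal (Ca powr \<beta>) * ennreal (R1 * Ca powr \<beta> * ealpha B powr \<beta> * 2 powr (?e * real n))"
        proof (intro mult_left_mono ennreal_leI mult_right_mono)
          have "ealpha ?B powr \<beta> \<le> (Ca * ealpha B) powr \<beta>" using Bk \<beta>(1) less_imp_le[OF ealpha_pos[OF inv]] by (intro powr_mono2) auto
          then have "R1 * ealpha ?B powr \<beta> \<le> R1 * (Ca powr \<beta> * ealpha B powr \<beta>)"
            using R1(1) by (intro mult_left_mono) (auto simp: powr_mult)
          moreover have "R0 * ealpha ?B powr \<beta> \<le> R1 * ealpha ?B powr \<beta>" using R1(2) by (intro mult_right_mono) auto
          ultimately show "R0 * ealpha ?B powr \<beta> \<le> R1 * Ca powr \<beta> * ealpha B powr \<beta>" by simp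
        qed auto
        also have "\<dots> = ennreal (Ca powr \<beta> * (R1 * Ca powr \<beta> * ealpha B powr \<beta> * 2 powr (?e * real n)))"
          using R1(1) by (simp add: ennreal_mult)
        finally show ?thesis .
      qed
      have "(\<integral>\<^sup>+k. G k \<partial>\<sigma>) = (\<integral>\<^sup>+k. (\<integral>\<^sup>+x. G (rot_arc x ** k) * indicator {0..<1::real} x \<partial>lborel) \<partial>\<sigma>)"
        by (rule haar_arc_average[OF haar continuous_rot_arc rot_arc_SO2 Gm])
      also have "\<dots> \<le> (\<integral>\<^sup>+k. ennreal (Ca powr \<beta> * (R1 * Ca powr \<beta> * ealpha B powr \<beta> * 2 powr (?e * real n))) \<partial>\<sigma>)"
        using inner by (intro nn_integral_mono) (simp add: sp)
      also have "\<dots> = ennreal (Ca powr \<beta> * (R1 * Ca powr \<beta> * ealpha B powr \<beta> * 2 powr (?e * real n)))"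
        using haar by (simp add: sp normalized_haar_def)
      finally show ?thesis .
    qed
    have total: "(\<integral>\<^sup>+k. ennreal (F k) \<partial>\<sigma>) \<le> ennreal (R * alpha q \<Delta> powr \<beta> * onorm (\<lambda>v. h *v v) powr ?e)"
    proof -
      have "(\<integral>\<^sup>+k. ennreal (F k) \<partial>\<sigma>) \<le> (\<integral>\<^sup>+k. ennreal ((Ca / c) powr \<beta>) * G (k2 ** k) \<partial>\<sigma>)"
        using FG by (intro nn_integral_mono) (simp add: sp)
      also have "\<dots> = ennreal ((Ca / c) powr \<beta>) * (\<integral>\<^sup>+k. G (k2 ** k) \<partial>\<sigma>)"
        by (rule nn_integral_cmult) (rule measurable_compose[OF haar_translate_measurable[OF haar k(2)] Gm])
      also have "(\<integral>\<^sup>+k. G (k2 ** k) \<partial>\<sigma>) = (\<integral>\<^sup>+k. G k \<partial>\<sigma>)" by (rule haar_translate[OF haar k(2) Gm])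
      also have "ennreal ((Ca / c) powr \<beta>) * (\<integral>\<^sup>+k. G k \<partial>\<sigma>)
        \<le> ennreal ((Ca / c) powr \<beta>) * ennreal (Ca powr \<beta> * (R1 * Ca powr \<beta> * ealpha B powr \<beta> * 2 powr (?e * real n)))"
        by (intro mult_left_mono Gint) simp
      also have "\<dots> = ennreal ((Ca / c) powr \<beta> * (Ca powr \<beta> * (R1 * Ca powr \<beta> * ealpha B powr \<beta> * 2 powr (?e * real n))))"
        using R1(1) by (simp add: ennreal_mult)
      also have "\<dots> \<le> ennreal ((Ca / c) powr \<beta> * (Ca powr \<beta> * (R1 * Ca powr \<beta> * (C powr \<beta> * alpha q \<Delta> powr \<beta>) * s powr ?e)))"
      proof -
        have "ealpha B powr \<beta> \<le> (C * alpha q \<Delta>) powr \<beta>"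
          unfolding B(2) using compare(2)[OF B(1)] \<beta>(1) less_imp_le[OF ealpha_pos[OF B(1)]] by (intro powr_mono2) auto
        then have 1: "ealpha B powr \<beta> \<le> C powr \<beta> * alpha q \<Delta> powr \<beta>" by (simp add: powr_mult)
        have "2 powr (?e * real n) = (2^n) powr ?e" by (simp add: powr_realpow[symmetric] powr_powr mult.commute)
        also have "\<dots> \<le> s powr ?e" using n(1) \<beta>(2) by (intro powr_mono2) auto
        finally have 2: "2 powr (?e * real n) \<le> s powr ?e" .
        show ?thesis using 1 2 R1(1) by (intro ennreal_leI mult_left_mono mult_mono) auto
      qed
      also have "\<dots> = ennreal (R * alpha q \<Delta> powr \<beta> * onorm (\<lambda>v. h *v v) powr ?e)"
        unfolding R_def s(3)[symmetric] by (simp add: mult_ac)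
      finally show ?thesis .
    qed
    have F0: "0 \<le> F k" for k by (simp add: F_def)
    have int: "integrable \<sigma> F"
      by (rule integrableI_nonneg[OF Fm]) (use F0 le_less_trans[OF total ennreal_less_top] in auto)
    have "ennreal (integral\<^sup>L \<sigma> F) = (\<integral>\<^sup>+k. ennreal (F k) \<partial>\<sigma>)"
      by (rule nn_integral_eq_integral[OF int, symmetric]) (simp add: F0)
    with total have "ennreal (integral\<^sup>L \<sigma> F) \<le> ennreal (R * alpha q \<Delta> powr \<beta> * onorm (\<lambda>v. h *v v) powr ?e)" by simp
    moreover have "0 \<le> R * alpha q \<Delta> powr \<beta> * onorm (\<lambda>v. h *v v) powr ?e" using R1(1) by (simp add: R_def)
    ultimately have "integral\<^sup>L \<sigma> F \<le> R * alpha q \<Delta> powr \<beta> * onorm (\<lambda>v. h *v v) powr ?e" by (simp add: ennreal_le_iff)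
    with int show "integrable \<sigma> (\<lambda>k. alpha q ((\<lambda>v. rho (h ** k) *v v) ` \<Delta>) powr \<beta>) \<and>
      (LINT k|\<sigma>. alpha q ((\<lambda>v. rho (h ** k) *v v) ` \<Delta>) powr \<beta>)
        \<le> R * alpha q \<Delta> powr \<beta> * onorm (\<lambda>v. h *v v) powr ?e"
      unfolding F_def[abs_def] by simp
  qed
qed

end
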